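(* Let $\mathcal E$ be one of the following five nonlinear equations on a function $u=u(x^1,x^2,x^3,x^4)$: (N) $u_{24}-u_{13}+u_{11}u_{22}-u_{12}^2=0$; (D) $u_{14}u_{23}-u_{13}u_{24}=1$; (III) $u_{24}=u_{14}u_{33}-u_{13}u_{34}$; (II) $u_{14}=u_{13}u_{24}-u_{12}u_{34}$; (I) $\alpha u_{12}u_{34}+\beta u_{13}u_{24}-(\alpha+\beta)u_{14}u_{23}=0$. Let $\mathfrak g=\mathfrak{cont}(\mathcal E)$ be its Lie algebra of contact symmetries. Then $\mathfrak g$ is an extension $$0\to\mathfrak s_\infty\to\mathfrak g\to\mathfrak s_\diamond\to0,$$ where $\mathfrak s_\diamond$ is finite-dimensional and $\mathfrak s_\infty$ is the derived algebra of $\mathfrak g$; more precisely $\mathfrak s_\infty=[\mathfrak g,\mathfrak g]$ in the cases D, II, I and $\mathfrak s_\infty=[[\mathfrak g,\mathfrak g],[\mathfrak g,\mathfrak g]]$ in the cases N, III. Moreover: (N) $\mathfrak s_\infty=\mathfrak a_0\oplus\mathfrak a_1\oplus\mathfrak a_2\oplus\mathfrak a_3$, $\ \mathfrak s_\diamond=\mathbb R^2\ltimes\mathbb R^1$; (D) $\mathfrak s_\infty=(\mathfrak a_0'\oplus\mathfrak a_1')\oplus(\mathfrak a_0''\oplus\mathfrak a_1'')$, $\ \mathfrak s_\diamond=\mathbb R^3$; (III) $\mathfrak s_\infty=(\mathfrak a_0'\oplus\mathfrak a_1'\oplus\mathfrak a_2')\oplus\mathfrak a_0''$, $\ \mathfrak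 s_\diamond=\mathbb R^2\ltimes\mathbb R^1$; (II) $\mathfrak s_\infty=(\mathfrak a_0'\oplus\mathfrak a_1')\oplus\mathfrak a_0''\oplus\mathfrak a_0'''$, $\ \mathfrak s_\diamond=\mathbb R^1$; (I) $\mathfrak s_\infty=\mathfrak a_0'\oplus\mathfrak a_0''\oplus\mathfrak a_0'''\oplus\mathfrak a_0^{iv}$, $\ \mathfrak s_\diamond=\mathbb R^1$.
   Context: Subscripts of $u$ denote partial derivatives, $u_{ij}=\partial^2u/\partial x^i\partial x^j$. A contact vector field $X_f$ on $J^1(\mathbb R^4)$ is identified with its generating function $f\in C^\infty(J^1(\mathbb R^4))$; the Lie algebra structure is the Jacobi bracket, $[X_f,X_g]=X_{\{f,g\}}$. The algebra $\mathfrak{cont}(\mathcal E)$ consists of the (local) contact fields whose prolongation preserves $\mathcal E$. Notation for the graded pieces: the subscript of $\mathfrak a_i^\gamma$ is the grading and the superscript (empty, or a number of primes) labels a commuting branch. Each $\mathfrak a_i^\gamma$ is a copy of $\mathcal P=C^\infty(\mathbb R^2(p,q))$ (one plane $\mathbb R^2(p,q)$ for each branch $\gamma$), with Poisson bracket $\{A,B\}=A_pB_q-A_qB_p$. Different branches commute: $[\mathfrak a_i^\alpha,\mathfrak a_j^\beta]=0$ for $\alpha\ne\beta$. Inside a branch, writing $A_i$ for $A\in\mathcal P$ viewed as an element of $\mathfrak a_i^\alpha$, the bracket is $[A_i,B_j]=\{A,B\}_{i+j}$, with the convention that it is $0$ if $i+j$ is not one of the gradings occurring in that branch. The quotient $\mathcal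 P/\mathbb R$ is the Lie algebra of Hamiltonian (area preserving) vector fields on $\mathbb R^2$.
   Formalization: The sums of copies of P hold only modulo constants (lower pieces are P/R, constants of the top pieces are identified, since s_∞ has centre R); s_⋄ is R^2 in cases D and III instead of R^3 and R^2⋉R^1; in (I), α, β and α+β are assumed nonzero. *)

theory Defs
  imports "HOL-Analysis.Analysis" "HOL-Library.Function_Algebras"
begin

section \<open>Smooth functions as a real vector space\<close>

instantiation "fun" :: (type, real_vector) real_vector
begin

definition scaleR_fun :: "real \<Rightarrow> ('a \<Rightarrow> 'b) \<Rightarrow> 'a \<Rightarrow> 'b" where
  "scaleR_fun c f = (\<lambda>x. c *\<^sub>R f x)"

instance
  by standard (auto simp: scaleR_fun_def fun_eq_iff algebra_simps)

end

primrec Ck :: "nat \<Rightarrow> ('a::euclidean_space \<Rightarrow> real) \<Rightarrow> bool" where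
  "Ck 0 f \<longleftrightarrow> continuous_on UNIV f"
| "Ck (Suc k) f \<longleftrightarrow> (\<forall>x. f differentiable at x) \<and>
     (\<forall>b\<in>Basis. Ck k (\<lambda>x. frechet_derivative f (at x) b))"

definition smooth :: "('a::euclidean_space \<Rightarrow> real) \<Rightarrow> bool" where
  "smooth f \<longleftrightarrow> (\<forall>k. Ck k f)"


section \<open>Lie algebras given by a carrier and a bracket\<close>

definition lie_subalgebra :: "('a::real_vector \<Rightarrow> 'a \<Rightarrow> 'a) \<Rightarrow> 'a set \<Rightarrow> bool" where
  "lie_subalgebra br L \<longleftrightarrow> subspace L \<and> (\<forall>x\<in>L. \<forall>y\<in>L. br x y \<in> L)"

definition derived_algebra :: "('a::real_vector \<Rightarrow> 'a \<Rightarrow> 'a) \<Rightarrow> 'a set \<Rightarrow> 'a set" where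
  "derived_algebra br L = span {br x y | x y. x \<in> L \<and> y \<in> L}"

definition lie_hom_on ::
  "'a::real_vector set \<Rightarrow> ('a \<Rightarrow> 'a \<Rightarrow> 'a) \<Rightarrow> ('b::real_vector \<Rightarrow> 'b \<Rightarrow> 'b) \<Rightarrow> ('a \<Rightarrow> 'b) \<Rightarrow> bool" where
  "lie_hom_on L br br' \<phi> \<longleftrightarrow>
     (\<forall>x\<in>L. \<forall>y\<in>L. \<phi> (x + y) = \<phi> x + \<phi> y \<and> \<phi> (br x y) = br' (\<phi> x) (\<phi> y)) \<and>
     (\<forall>c. \<forall>x\<in>L. \<phi> (c *\<^sub>R x) = c *\<^sub>R \<phi> x)"

text \<open>Exactness of \<open>0 \<rightarrow> S \<rightarrow> G \<rightarrow> Q \<rightarrow> 0\<close>, where \<open>S\<close> and \<open>G\<close> carry the bracket \<open>br\<close>, the map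
  \<open>S \<rightarrow> G\<close> is the inclusion, and \<open>Q\<close> is the whole type \<open>'b\<close> with the bracket \<open>br'\<close>.\<close>

definition lie_extension ::
  "('a::real_vector \<Rightarrow> 'a \<Rightarrow> 'a) \<Rightarrow> 'a set \<Rightarrow> 'a set \<Rightarrow> ('b::euclidean_space \<Rightarrow> 'b \<Rightarrow> 'b) \<Rightarrow> bool" where
  "lie_extension br S G br' \<longleftrightarrow> lie_subalgebra br G \<and>
     (\<exists>\<pi>. lie_hom_on G br br' \<pi> \<and> \<pi> ` G = UNIV \<and> {x \<in> G. \<pi> x = 0} = S)"

text \<open>Besides the equations whose quotient by \<open>\<s>\<^sub>\<infinity>\<close> is a line, this is the quotient, with \<open>'a = real ^ 2\<close>,
  for the two equations \<open>eq_D\<close> and \<open>eq_III\<close> below. Here the source of the theorem announces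
  three-dimensional quotients \<open>\<real>\<^sup>3\<close> and \<open>\<real>\<^sup>2 \<ltimes> \<real>\<^sup>1\<close>, which is not correct: for \<open>eq_D\<close> the determining
  equations give exactly the functions
  \<open>A\<^sub>2u\<^sub>1 - A\<^sub>1u\<^sub>2 + B\<^sub>4u\<^sub>3 - B\<^sub>3u\<^sub>4 + C(x\<^sup>1,x\<^sup>2) + D(x\<^sup>3,x\<^sup>4) + a(x\<^sup>1u\<^sub>1 - u/2) + b(x\<^sup>3u\<^sub>3 - u/2)\<close>
  with \<open>A = A(x\<^sup>1,x\<^sup>2)\<close>, \<open>B = B(x\<^sup>3,x\<^sup>4)\<close>, and the derived algebra is given by \<open>a = b = 0\<close>. For \<open>eq_III\<close>
  the quotient is spanned by the classes of the two scalings \<open>x\<^sup>1u\<^sub>1 - u\<close> and \<open>x\<^sup>3u\<^sub>3 - 2u\<close>.\<close>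

definition abelian_bracket :: "'a::real_vector \<Rightarrow> 'a \<Rightarrow> 'a" where
  "abelian_bracket x y = 0"

text \<open>The semidirect product of the abelian algebra \<open>\<real>\<^sup>2\<close> and its ideal \<open>\<real>\<^sup>1\<close>, on which
  \<open>a \<in> \<real>\<^sup>2\<close> acts as multiplication by \<open>w a\<close>.\<close>

definition semidirect_bracket ::
  "(real \<times> real \<Rightarrow> real) \<Rightarrow> (real \<times> real) \<times> real \<Rightarrow> (real \<times> real) \<times> real \<Rightarrow> (real \<times> real) \<times> real" where
  "semidirect_bracket w = (\<lambda>(a, s) (b, t). (0, w a * t - w b * s))"


section \<open>Contact vector fields on the space of 1-jets\<close>

text \<open>A point \<open>(x, u, p)\<close> of \<open>J\<^sup>1(\<real>\<^sup>4)\<close> has \<open>p $ i = u\<^sub>i\<close>. A point of \<open>J\<^sup>2(\<real>\<^sup>4)\<close> is a point of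
  \<open>J\<^sup>1(\<real>\<^sup>4)\<close> together with a symmetric matrix \<open>h\<close>, \<open>h $ i $ j = u\<^sub>i\<^sub>j\<close>. The index \<open>4 :: 4\<close> equals
  \<open>0 :: 4\<close>, so \<open>1, 2, 3, 4\<close> are the four elements of the index type.\<close>

type_synonym jet1 = "(real ^ 4) \<times> real \<times> (real ^ 4)"
type_synonym jet2 = "jet1 \<times> (real ^ 4 ^ 4)"

definition Dx :: "4 \<Rightarrow> (jet1 \<Rightarrow> real) \<Rightarrow> jet1 \<Rightarrow> real" where
  "Dx i f z = frechet_derivative f (at z) (axis i 1, 0, 0)"

definition Du :: "(jet1 \<Rightarrow> real) \<Rightarrow> jet1 \<Rightarrow> real" where
  "Du f z = frechet_derivative f (at z) (0, 1, 0)"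

definition Dp :: "4 \<Rightarrow> (jet1 \<Rightarrow> real) \<Rightarrow> jet1 \<Rightarrow> real" where
  "Dp i f z = frechet_derivative f (at z) (0, 0, axis i 1)"

definition contact_form :: "jet1 \<Rightarrow> jet1 \<Rightarrow> real" where
  "contact_form = (\<lambda>(x, u, p) (dx, du, dp). du - p \<bullet> dx)"

text \<open>The field \<open>X\<^sub>f\<close>: the unique infinitesimal symmetry of the contact distribution on which the
  contact form takes the value \<open>f\<close>.\<close>

definition contact_field :: "(jet1 \<Rightarrow> real) \<Rightarrow> jet1 \<Rightarrow> jet1" where
  "contact_field f = (\<lambda>(x, u, p).
     let z = (x, u, p) in
       (\<chi> i. - Dp i f z,
        f z - (\<Sum>i\<in>UNIV. p $ i * Dp i f z),
        \<chi> i. Dx i f z + p $ i * Du f z))"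

lemma contact_form_contact_field: "contact_form z (contact_field f z) = f z"
  by (cases z) (simp add: contact_form_def contact_field_def Let_def inner_vec_def sum_negf)

text \<open>The generating function of \<open>[X\<^sub>f, X\<^sub>g]\<close> is \<open>X\<^sub>f(g) - (\<partial>f/\<partial>u) g\<close>, since the Lie derivative of
  the contact form along \<open>X\<^sub>f\<close> is \<open>\<partial>f/\<partial>u\<close> times that form.\<close>

definition jacobi_bracket :: "(jet1 \<Rightarrow> real) \<Rightarrow> (jet1 \<Rightarrow> real) \<Rightarrow> jet1 \<Rightarrow> real" where
  "jacobi_bracket f g = (\<lambda>z. frechet_derivative g (at z) (contact_field f z) - Du f z * g z)"

text \<open>The total derivative \<open>\<partial>/\<partial>x\<^sup>i + u\<^sub>i \<partial>/\<partial>u + \<Sum>\<^sub>k u\<^sub>i\<^sub>k \<partial>/\<partial>u\<^sub>k\<close>, with the second derivatives \<open>h\<close> kept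
  fixed as parameters. The \<open>u\<^sub>i\<^sub>j\<close> component of the prolongation of \<open>X\<^sub>f\<close> to \<open>J\<^sup>2\<close> is the second
  such derivative of \<open>f\<close>: in the usual prolongation formula the terms with third derivatives of
  \<open>u\<close> cancel.\<close>

definition total_deriv :: "real ^ 4 ^ 4 \<Rightarrow> 4 \<Rightarrow> (jet1 \<Rightarrow> real) \<Rightarrow> jet1 \<Rightarrow> real" where
  "total_deriv h i f = (\<lambda>(x, u, p). frechet_derivative f (at (x, u, p)) (axis i 1, p $ i, h $ i))"

definition prolongation :: "(jet1 \<Rightarrow> real) \<Rightarrow> jet2 \<Rightarrow> jet2" where
  "prolongation f = (\<lambda>(z, h).
     (contact_field f z, \<chi> i j. total_deriv h i (total_deriv h j f) z))"

text \<open>The equation \<open>F = 0\<close> as a subset of \<open>J\<^sup>2\<close>, and its contact symmetry algebra, whose elements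
  are represented by their generating functions.\<close>

definition equation :: "(jet2 \<Rightarrow> real) \<Rightarrow> jet2 set" where
  "equation F = {(z, h). transpose h = h \<and> F (z, h) = 0}"

definition cont :: "(jet2 \<Rightarrow> real) \<Rightarrow> (jet1 \<Rightarrow> real) set" where
  "cont F = {f. smooth f \<and>
     (\<forall>\<theta>\<in>equation F. frechet_derivative F (at \<theta>) (prolongation f \<theta>) = 0)}"


section \<open>The five equations\<close>

definition eq_N :: "jet2 \<Rightarrow> real" where
  "eq_N = (\<lambda>(z, h). h $ 2 $ 4 - h $ 1 $ 3 + h $ 1 $ 1 * h $ 2 $ 2 - (h $ 1 $ 2)\<^sup>2)"

definition eq_D :: "jet2 \<Rightarrow> real" where
  "eq_D = (\<lambda>(z, h). h $ 1 $ 4 * h $ 2 $ 3 - h $ 1 $ 3 * h $ 2 $ 4 - 1)"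

definition eq_III :: "jet2 \<Rightarrow> real" where
  "eq_III = (\<lambda>(z, h). h $ 2 $ 4 - (h $ 1 $ 4 * h $ 3 $ 3 - h $ 1 $ 3 * h $ 3 $ 4))"

definition eq_II :: "jet2 \<Rightarrow> real" where
  "eq_II = (\<lambda>(z, h). h $ 1 $ 4 - (h $ 1 $ 3 * h $ 2 $ 4 - h $ 1 $ 2 * h $ 3 $ 4))"

definition eq_I :: "real \<Rightarrow> real \<Rightarrow> jet2 \<Rightarrow> real" where
  "eq_I \<alpha> \<beta> = (\<lambda>(z, h). \<alpha> * h $ 1 $ 2 * h $ 3 $ 4 + \<beta> * h $ 1 $ 3 * h $ 2 $ 4
     - (\<alpha> + \<beta>) * h $ 1 $ 4 * h $ 2 $ 3)"


section \<open>Graded sums of copies of the Poisson algebra of the plane\<close>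

definition poisson :: "(real \<times> real \<Rightarrow> real) \<Rightarrow> (real \<times> real \<Rightarrow> real) \<Rightarrow> real \<times> real \<Rightarrow> real" where
  "poisson A B = (\<lambda>z.
     frechet_derivative A (at z) (1, 0) * frechet_derivative B (at z) (0, 1)
     - frechet_derivative A (at z) (0, 1) * frechet_derivative B (at z) (1, 0))"

text \<open>The list \<open>ms\<close> has one entry per branch; branch \<open>b\<close> has the gradings \<open>0, \<dots>, ms ! b\<close>. An element
  \<open>A\<close> of the direct sum has the component \<open>A b i\<close> in the piece of grading \<open>i\<close> of branch \<open>b\<close>.\<close>

definition pieces :: "nat list \<Rightarrow> (nat \<times> nat) set" where
  "pieces ms = {(b, i). b < length ms \<and> i \<le> ms ! b}"

definition graded_sum :: "nat list \<Rightarrow> (nat \<Rightarrow> nat \<Rightarrow> real \<times> real \<Rightarrow> real) set" where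
  "graded_sum ms = {A. \<forall>b i. if (b, i) \<in> pieces ms then smooth (A b i) else A b i = 0}"

definition graded_bracket ::
  "nat list \<Rightarrow> (nat \<Rightarrow> nat \<Rightarrow> real \<times> real \<Rightarrow> real) \<Rightarrow> (nat \<Rightarrow> nat \<Rightarrow> real \<times> real \<Rightarrow> real)
    \<Rightarrow> nat \<Rightarrow> nat \<Rightarrow> real \<times> real \<Rightarrow> real" where
  "graded_bracket ms A B = (\<lambda>b k.
     if (b, k) \<in> pieces ms then (\<Sum>i\<le>k. poisson (A b i) (B b (k - i))) else 0)"

text \<open>The constants of the pieces are central in the graded sum and span a space whose dimension is
  the number of pieces, namely four. The algebra \<open>\<s>\<^sub>\<infinity>\<close> contains all \<open>x\<^sup>i\<close> and \<open>u\<^sub>i\<close>, so that its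
  centre is the line spanned by the function \<open>1\<close>. Hence \<open>\<s>\<^sub>\<infinity>\<close> is the sum of its graded pieces
  only up to constants. A piece below the top grading of its branch consists of Hamiltonian fields
  and is a copy of the Poisson algebra modulo constants. The top piece of each branch is a full
  copy of the Poisson algebra, but the constants of these top pieces are one and the same line. For
  instance, for \<open>eq_I\<close> the algebra \<open>\<s>\<^sub>\<infinity>\<close> is the space of all functions
  \<open>A(x\<^sup>1,u\<^sub>1) + B(x\<^sup>2,u\<^sub>2) + C(x\<^sup>3,u\<^sub>3) + D(x\<^sup>4,u\<^sub>4)\<close>. The set below is the resulting kernel.\<close>

definition constant_relations :: "nat list \<Rightarrow> (nat \<Rightarrow> nat \<Rightarrow> real \<times> real \<Rightarrow> real) set" where
  "constant_relations ms = {A \<in> graded_sum ms. \<exists>c :: nat \<Rightarrow> nat \<Rightarrow> real.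
     (\<forall>(b, i)\<in>pieces ms. A b i = (\<lambda>_. c b i)) \<and> (\<Sum>b<length ms. c b (ms ! b)) = 0}"

definition is_graded_sum :: "nat list \<Rightarrow> (jet1 \<Rightarrow> real) set \<Rightarrow> bool" where
  "is_graded_sum ms S \<longleftrightarrow> (\<exists>\<Phi>. lie_hom_on (graded_sum ms) (graded_bracket ms) jacobi_bracket \<Phi> \<and>
     \<Phi> ` graded_sum ms = S \<and> {A \<in> graded_sum ms. \<Phi> A = 0} = constant_relations ms)"

end

theory Submission
  imports Defs
begin

text \<open>The generating functions of the symmetries of an equation form a space cut out, at each point of
    \<open>J\<^sup>1\<close>, by
  the vanishing of a polynomial in the second derivatives \<open>u\<^sub>i\<^sub>j\<close> on the hypersurface given by the
      equation.
  Evaluating it at finitely many symmetric matrices yields linear equations for the derivatives of \<open>f\<close>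
  of order at most two. Commuting momentum derivatives past total derivatives shows that \<open>f\<^sub>u\<close> is a
  constant \<open>c\<close>, so that \<open>f = g + c u\<close> with \<open>g\<close> independent of \<open>u\<close>, and the equations become equations for
  the second partial derivatives of \<open>g\<close>: vanishing mixed derivatives split \<open>g\<close> into functions of fewer
  variables, and vanishing divergences give potentials on a plane. In this way every symmetry is the sum
  of a function \<open>\<Phi> A\<close> linear in an element \<open>A\<close> of the graded sum and of a combination \<open>E a\<close> of finitely
  many scalings. The image of \<open>\<Phi>\<close> is an ideal, and it is perfect because every function on the plane is
      the
  Poisson bracket of a coordinate with an antiderivative; hence the derived algebras can be read
  off from the brackets of the functions \<open>E a\<close>.\<close>

section \<open>Calculus of smooth functions\<close>

text \<open>The elimination of u rests on a commutator: \<open>DP k\<close> and \<open>dx j\<close>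
  commute unless j = k, and then they differ by \<open>DU\<close> (\<open>pd_ep_dx\<close>). A
  momentum derivative of a relation between total derivatives of f therefore turns into a relation
  for f_u. For I, D, III and II enough total derivatives vanish for this to settle the matter at
  once. For N they do not, and the total derivatives of f_u have to be eliminated from a linear
  system formed by derivatives of the determining equations. The scalings are chosen so that
  \<open>E\<close> respects the bracket of the quotient. That a nonzero \<open>E a\<close> never
  lies in the image of \<open>\<Phi>\<close> is detected by f_u, which vanishes on that image, by
  divergences, which vanish for Hamiltonian fields, and for N also by mixed derivatives at the
  origin. Everything is global: potentials exist because all functions live on a whole vector space,
  where vanishing derivatives force constancy.\<close>

definition pd :: "'a::euclidean_space \<Rightarrow> ('a \<Rightarrow> real) \<Rightarrow> 'a \<Rightarrow> real" where
  "pd v f = (\<lambda>z. frechet_derivative f (at z) v)"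

lemma pd_eqI: "(f has_derivative f') (at z) \<Longrightarrow> pd v f z = f' v"
  by (metis pd_def frechet_derivative_at)

lemma Ck_Suc_iff: "Ck (Suc k) f \<longleftrightarrow> (\<forall>x. f differentiable at x) \<and> (\<forall>b\<in>Basis. Ck k (pd b f))"
  by (simp add: pd_def)

declare Ck.simps(2) [simp del]

lemma Ck_SucD: "Ck (Suc k) f \<Longrightarrow> Ck k f"
proof (induction k arbitrary: f)
  case 0
  then show ?case
    by (auto simp: Ck_Suc_iff differentiable_imp_continuous_within continuous_on_eq_continuous_within)
next
  case (Suc k)
  then show ?case
    by (subst Ck_Suc_iff) (auto simp: Ck_Suc_iff[of "Suc k"])
qed

lemma smooth_differentiable: "smooth f \<Longrightarrow> f differentiable at z"
  unfolding smooth_def using Ck_Suc_iff by blast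

lemma smooth_has_derivative: "smooth f \<Longrightarrow> (f has_derivative (\<lambda>v. pd v f z)) (at z)"
  unfolding pd_def using smooth_differentiable frechet_derivative_works by blast

lemma linear_pd: "smooth f \<Longrightarrow> linear (\<lambda>v. pd v f z)"
  using smooth_has_derivative has_derivative_linear by blast

lemma pd_scaleR_dir: "smooth f \<Longrightarrow> pd (c *\<^sub>R v) f = (\<lambda>z. c * pd v f z)"
  using linear_scale[OF linear_pd] by (auto simp: fun_eq_iff)

lemma pd_sum_dir:
  assumes "smooth f" shows "pd (\<Sum>i\<in>I. c i *\<^sub>R v i) f z = (\<Sum>i\<in>I. c i * pd (v i) f z)"
  by (simp add: linear_sum[OF linear_pd[OF assms]] pd_scaleR_dir[OF assms])

lemma pd_expand: "smooth f \<Longrightarrow> pd v f z = (\<Sum>b\<in>Basis. (v \<bullet> b) * pd b f z)"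
  using pd_sum_dir[of f "\<lambda>b. v \<bullet> b" "\<lambda>b. b" Basis z] by (simp add: euclidean_representation)

lemma smooth_continuous_on: "smooth f \<Longrightarrow> continuous_on S f"
  by (meson smooth_differentiable differentiable_imp_continuous_on differentiable_on_def
      differentiable_at_withinI)

lemma smooth_pd_Basis: "smooth f \<Longrightarrow> b \<in> Basis \<Longrightarrow> smooth (pd b f)"
  unfolding smooth_def using Ck_Suc_iff by blast

lemma pd_const [simp]: "pd v (\<lambda>z. c) = (\<lambda>z. 0)"
  by (simp add: pd_def)

lemma Ck_const [simp]: "Ck k (\<lambda>z. c)"
  by (induction k arbitrary: c) (auto simp: Ck_Suc_iff)

lemma smooth_const [simp, intro]: "smooth (\<lambda>z. c)"
  by (simp add: smooth_def)

text \<open>Stated under differentiability at one point, because the inductions for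
  \<open>Ck_add\<close> and \<open>Ck_mult\<close> have only finitely many derivatives
  available.\<close>

lemma pd_add_at:
  "f differentiable at z \<Longrightarrow> g differentiable at z \<Longrightarrow> pd v (\<lambda>z. f z + g z) z = pd v f z + pd v g z"
  by (rule pd_eqI) (auto simp: pd_def frechet_derivative_works[symmetric] intro!: derivative_eq_intros)

lemma pd_mult_at:
  assumes "f differentiable at z" "g differentiable at z"
  shows "pd v (\<lambda>z. f z * g z) z = f z * pd v g z + pd v f z * g z"
  by (rule pd_eqI) (use assms in \<open>auto simp: pd_def frechet_derivative_works[symmetric] intro!:
      derivative_eq_intros\<close>)

lemma Ck_add: "Ck k f \<Longrightarrow> Ck k g \<Longrightarrow> Ck k (\<lambda>z. f z + g z)"
proof (induction k arbitrary: f g)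
  case 0 then show ?case by (simp add: continuous_intros)
next
  case (Suc k)
  have "pd b (\<lambda>z. f z + g z) = (\<lambda>z. pd b f z + pd b g z)" for b
    using Suc.prems by (auto simp: Ck_Suc_iff pd_add_at)
  with Suc show ?case by (simp add: Ck_Suc_iff)
qed

lemma Ck_mult: "Ck k f \<Longrightarrow> Ck k g \<Longrightarrow> Ck k (\<lambda>z. f z * g z)"
proof (induction k arbitrary: f g)
  case 0 then show ?case by (simp add: continuous_intros)
next
  case (Suc k)
  have "pd b (\<lambda>z. f z * g z) = (\<lambda>z. f z * pd b g z + pd b f z * g z)" for b
    using Suc.prems by (auto simp: Ck_Suc_iff pd_mult_at)
  \<comment> \<open>The product rule leaves an undifferentiated factor, which must be lowered from
    \<open>Ck (Suc k)\<close> to \<open>Ck k\<close>.\<close>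
  with Suc show ?case using Ck_SucD[OF Suc.prems(1)] Ck_SucD[OF Suc.prems(2)]
    by (simp add: Ck_Suc_iff Ck_add)
qed

lemma smooth_add [simp, intro]: "smooth f \<Longrightarrow> smooth g \<Longrightarrow> smooth (\<lambda>z. f z + g z)"
  by (simp add: smooth_def Ck_add)

lemma smooth_mult [simp, intro]: "smooth f \<Longrightarrow> smooth g \<Longrightarrow> smooth (\<lambda>z. f z * g z)"
  by (simp add: smooth_def Ck_mult)

lemma smooth_cmult [simp]: "smooth f \<Longrightarrow> smooth (\<lambda>z. c * f z)"
  by (rule smooth_mult) auto

lemma smooth_minus [simp, intro]: "smooth f \<Longrightarrow> smooth (\<lambda>z. - f z)"
  using smooth_cmult[of f "-1"] by simp

lemma smooth_diff [simp, intro]: "smooth f \<Longrightarrow> smooth g \<Longrightarrow> smooth (\<lambda>z. f z - g z)"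
  using smooth_add[of f "\<lambda>z. - g z"] by simp

lemma smooth_power [simp, intro]: "smooth f \<Longrightarrow> smooth (\<lambda>z. f z ^ n)"
  by (induction n) auto

lemma smooth_divide [simp, intro]: "smooth f \<Longrightarrow> smooth (\<lambda>z. f z / c)"
  using smooth_cmult[of f "1/c"] by simp

lemma smooth_sum [simp, intro]: "(\<And>i. i \<in> I \<Longrightarrow> smooth (f i)) \<Longrightarrow> smooth (\<lambda>z. \<Sum>i\<in>I. f i z)"
  by (induction I rule: infinite_finite_induct) auto

lemma pd_add [simp]: "smooth f \<Longrightarrow> smooth g \<Longrightarrow> pd v (\<lambda>z. f z + g z) = (\<lambda>z. pd v f z + pd v g z)"
  by (auto simp: pd_add_at smooth_differentiable)

lemma pd_mult [simp]:
  "smooth f \<Longrightarrow> smooth g \<Longrightarrow> pd v (\<lambda>z. f z * g z) = (\<lambda>z. f z * pd v g z + pd v f z * g z)"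
  by (auto simp: pd_mult_at smooth_differentiable)

lemma pd_cmult [simp]: "smooth f \<Longrightarrow> pd v (\<lambda>z. c * f z) = (\<lambda>z. c * pd v f z)"
  by (subst pd_mult) auto

lemma pd_minus [simp]: "smooth f \<Longrightarrow> pd v (\<lambda>z. - f z) = (\<lambda>z. - pd v f z)"
  using pd_cmult[of f v "-1"] by simp

lemma pd_diff [simp]: "smooth f \<Longrightarrow> smooth g \<Longrightarrow> pd v (\<lambda>z. f z - g z) = (\<lambda>z. pd v f z - pd v g z)"
  using pd_add[of f "\<lambda>z. - g z"] by simp

lemma pd_divide [simp]: "smooth f \<Longrightarrow> pd v (\<lambda>z. f z / c) = (\<lambda>z. pd v f z / c)"
  using pd_cmult[of f v "1/c"] by simp

lemma pd_power [simp]: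
  assumes "smooth f"
  shows "pd v (\<lambda>z. f z ^ n) = (\<lambda>z. of_nat n * f z ^ (n - 1) * pd v f z)"
proof (induction n)
  case (Suc n) then show ?case using assms by (cases n) (auto simp: fun_eq_iff algebra_simps)
qed simp

lemma pd_sum [simp]:
  "(\<And>i. i \<in> I \<Longrightarrow> smooth (f i)) \<Longrightarrow> pd v (\<lambda>z. \<Sum>i\<in>I. f i z) = (\<lambda>z. \<Sum>i\<in>I. pd v (f i) z)"
  by (induction I rule: infinite_finite_induct) auto

lemma smooth_pd [simp, intro]: "smooth f \<Longrightarrow> smooth (pd v f)"
  by (subst ext[OF pd_expand]) (auto simp: smooth_pd_Basis)

section \<open>Composition with linear maps\<close>

lemma has_derivative_linear_comp:
  fixes L :: "'b::euclidean_space \<Rightarrow> 'a::euclidean_space"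
  assumes "smooth f" "linear L"
  shows "((\<lambda>z. f (L z)) has_derivative (\<lambda>v. pd (L v) f (L z))) (at z)"
  using diff_chain_at[OF bounded_linear_imp_has_derivative smooth_has_derivative[OF assms(1)], of L]
    assms(2) by (simp add: o_def linear_conv_bounded_linear)

lemma pd_linear_comp:
  fixes L :: "'b::euclidean_space \<Rightarrow> 'a::euclidean_space"
  shows "smooth f \<Longrightarrow> linear L \<Longrightarrow> pd v (\<lambda>z. f (L z)) = (\<lambda>z. pd (L v) f (L z))"
  using pd_eqI[OF has_derivative_linear_comp] by blast

text \<open>The induction runs over all smooth functions at once: the derivative of the composite
  along b is again a composite with \<open>L\<close>, namely of \<open>pd (L b) f\<close>, and
  \<open>L b\<close> is in general not a basis vector.\<close>

lemma smooth_linear_comp: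
  fixes L :: "'b::euclidean_space \<Rightarrow> 'a::euclidean_space"
  assumes "smooth f" "linear L" shows "smooth (\<lambda>z. f (L z))"
proof -
  have "Ck k (\<lambda>z. f (L z))" if "smooth f" for k f
    using that
  proof (induction k arbitrary: f)
    case 0
    then show ?case
      using continuous_on_compose2[OF smooth_continuous_on linear_continuous_on[of L UNIV]] assms(2)
      by (auto simp: linear_conv_bounded_linear)
  next
    case (Suc k)
    then show ?case
      using has_derivative_linear_comp[OF Suc.prems assms(2)]
      by (auto simp: Ck_Suc_iff pd_linear_comp[OF _ assms(2)] differentiable_def)
  qed
  with assms(1) show ?thesis by (simp add: smooth_def)
qed

lemma pd_inner [simp]: "pd v (\<lambda>z. z \<bullet> w) = (\<lambda>z. v \<bullet> w)"
  by (auto intro!: pd_eqI derivative_eq_intros)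

lemma smooth_inner [simp, intro]: "smooth (\<lambda>z. z \<bullet> w)"
proof -
  have "Ck k (\<lambda>z. z \<bullet> w)" for k
    by (cases k) (auto simp: Ck_Suc_iff intro!: continuous_intros derivative_intros)
  then show ?thesis by (simp add: smooth_def)
qed

section \<open>Symmetry of second derivatives, and functions constant in given directions\<close>

lemma has_real_derivative_line:
  "smooth f \<Longrightarrow> ((\<lambda>t. f (z + t *\<^sub>R v)) has_real_derivative pd v f (z + t *\<^sub>R v)) (at t within T)"
proof -
  assume f: "smooth f"
  have "((\<lambda>t. z + t *\<^sub>R v) has_derivative (\<lambda>t. t *\<^sub>R v)) (at t within T)"
    by (auto intro!: derivative_eq_intros)
  from diff_chain_within[OF this, of f "\<lambda>v'. pd v' f (z + t *\<^sub>R v)"]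
  have "((\<lambda>t. f (z + t *\<^sub>R v)) has_derivative (\<lambda>s. pd (s *\<^sub>R v) f (z + t *\<^sub>R v))) (at t within T)"
    using has_derivative_at_withinI[OF smooth_has_derivative[OF f]] by (simp add: o_def)
  then show ?thesis
    by (simp add: has_field_derivative_def pd_scaleR_dir[OF f] mult_commute_abs)
qed

text \<open>The mean value theorem is applied twice, first along v to the difference of f in the
  direction w, then along w. The left side is symmetric under exchanging (v, s) with (w, t), which
  is what \<open>pd_commute\<close> exploits.\<close>

lemma second_difference:
  assumes "smooth f" "s > 0" "t > 0"
  obtains a b where "0 < a" "a < s" "0 < b" "b < t"
    "f (z + s *\<^sub>R v + t *\<^sub>R w) - f (z + s *\<^sub>R v) - f (z + t *\<^sub>R w) + f z
      = s * t * pd w (pd v f) (z + a *\<^sub>R v + b *\<^sub>R w)"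
proof -
  define g where "g r = f (z + t *\<^sub>R w + r *\<^sub>R v) - f (z + r *\<^sub>R v)" for r
  have g: "DERIV g r :> pd v f (z + t *\<^sub>R w + r *\<^sub>R v) - pd v f (z + r *\<^sub>R v)" for r
    unfolding g_def by (intro DERIV_diff has_real_derivative_line assms)
  obtain a where a: "0 < a" "a < s"
    "g s - g 0 = (s - 0) * (pd v f (z + t *\<^sub>R w + a *\<^sub>R v) - pd v f (z + a *\<^sub>R v))"
    using MVT2[of 0 s g, OF assms(2) g] by blast
  obtain b where b: "0 < b" "b < t"
    "pd v f (z + a *\<^sub>R v + t *\<^sub>R w) - pd v f (z + a *\<^sub>R v + 0 *\<^sub>R w)
      = (t - 0) * pd w (pd v f) (z + a *\<^sub>R v + b *\<^sub>R w)"
    using MVT2[of 0 t "\<lambda>r. pd v f (z + a *\<^sub>R v + r *\<^sub>R w)", OF assms(3)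
        has_real_derivative_line[OF smooth_pd[OF assms(1)]]] by blast
  show ?thesis
    by (rule that[OF a(1,2) b(1,2)]) (use a(3) b(3) in \<open>simp add: g_def algebra_simps\<close>)
qed

text \<open>The second difference over a parallelogram with side factor s is s times s times either
  mixed derivative, each taken at some point at distance O(s) from z. So the two mixed derivatives
  agree at pairs of points tending to z, and continuity carries the equality to z itself.\<close>

lemma pd_commute:
  assumes "smooth f" shows "pd v (pd w f) = pd w (pd v f)"
proof
  fix z
  define A where "A = pd w (pd v f)"
  define B where "B = pd v (pd w f)"
  have cont: "isCont A z" "isCont B z"
    unfolding A_def B_def
    by (intro differentiable_imp_continuous_within smooth_differentiable smooth_pd assms)+
  have "\<exists>y y'. norm (y - z) \<le> s * (norm v + norm w) \<and> norm (y' - z) \<le> s * (norm v + norm w) \<and> A y = B y'"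
    if s: "s > 0" for s
  proof -
    obtain a b where ab: "0 < a" "a < s" "0 < b" "b < s"
      "f (z + s *\<^sub>R v + s *\<^sub>R w) - f (z + s *\<^sub>R v) - f (z + s *\<^sub>R w) + f z
        = s * s * A (z + a *\<^sub>R v + b *\<^sub>R w)"
      unfolding A_def using second_difference[OF assms s s] by metis
    obtain c d where cd: "0 < c" "c < s" "0 < d" "d < s"
      "f (z + s *\<^sub>R w + s *\<^sub>R v) - f (z + s *\<^sub>R w) - f (z + s *\<^sub>R v) + f z
        = s * s * B (z + c *\<^sub>R w + d *\<^sub>R v)"
      unfolding B_def using second_difference[OF assms s s] by metis
    have bound: "norm (x *\<^sub>R p + y *\<^sub>R q) \<le> s * (norm p + norm q)"
      if "0 < x" "x < s" "0 < y" "y < s" for x y and p q :: 'a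
    proof -
      have "norm (x *\<^sub>R p + y *\<^sub>R q) \<le> x * norm p + y * norm q"
        using that norm_triangle_ineq[of "x *\<^sub>R p" "y *\<^sub>R q"] by simp
      also have "\<dots> \<le> s * norm p + s * norm q"
        using that by (intro add_mono mult_right_mono) auto
      finally show ?thesis by (simp add: distrib_left)
    qed
    have "s * s * A (z + a *\<^sub>R v + b *\<^sub>R w) = s * s * B (z + c *\<^sub>R w + d *\<^sub>R v)"
      using ab(5) cd(5) by (simp add: algebra_simps)
    then have "A (z + a *\<^sub>R v + b *\<^sub>R w) = B (z + c *\<^sub>R w + d *\<^sub>R v)" using s by simp
    moreover have "norm (z + a *\<^sub>R v + b *\<^sub>R w - z) \<le> s * (norm v + norm w)"
      using bound[OF ab(1-4), of v w] by (simp add: algebra_simps)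
    moreover have "norm (z + c *\<^sub>R w + d *\<^sub>R v - z) \<le> s * (norm v + norm w)"
      using bound[OF cd(1-4), of w v] by (simp add: algebra_simps)
    ultimately show ?thesis by blast
  qed
  then have "\<forall>n. \<exists>y y'. norm (y - z) \<le> inverse (Suc n) * (norm v + norm w) \<and>
      norm (y' - z) \<le> inverse (Suc n) * (norm v + norm w) \<and> A y = B y'"
    using positive_imp_inverse_positive of_nat_0_less_iff zero_less_Suc by metis
  then obtain y y' where y: "\<And>n. norm (y n - z) \<le> inverse (Suc n) * (norm v + norm w)"
    "\<And>n. norm (y' n - z) \<le> inverse (Suc n) * (norm v + norm w)" "\<And>n. A (y n) = B (y' n)"
    by metis
  have lim: "(\<lambda>n. inverse (real (Suc n)) * (norm v + norm w)) \<longlonglongrightarrow> 0"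
    using tendsto_mult_left_zero[OF LIMSEQ_inverse_real_of_nat] by simp
  have "(\<lambda>n. y n - z) \<longlonglongrightarrow> 0" "(\<lambda>n. y' n - z) \<longlonglongrightarrow> 0"
    using y by (auto intro!: Lim_null_comparison[OF _ lim] always_eventually)
  then have "y \<longlonglongrightarrow> z" "y' \<longlonglongrightarrow> z" by (simp_all add: LIM_zero_iff)
  then have "(\<lambda>n. A (y n)) \<longlonglongrightarrow> A z" "(\<lambda>n. B (y' n)) \<longlonglongrightarrow> B z"
    using cont isCont_tendsto_compose by blast+
  with y(3) show "pd v (pd w f) z = pd w (pd v f) z"
    using LIMSEQ_unique unfolding A_def B_def by (metis (no_types, lifting) ext)
qed

lemma constant_direction:
  assumes "smooth f" "pd v f = (\<lambda>z. 0)" shows "f (z + t *\<^sub>R v) = f z"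
  using DERIV_isconst_all[of "\<lambda>t. f (z + t *\<^sub>R v)" t 0] has_real_derivative_line[OF assms(1), of z v]
  by (simp add: assms(2))

text \<open>The increment is a finite combination of vectors of \<open>B\<close>, and it is walked
  through one summand at a time.\<close>

lemma constant_directions:
  assumes "smooth f" "\<And>b. b \<in> B \<Longrightarrow> pd b f = (\<lambda>z. 0)" "y - z \<in> span B"
  shows "f y = f z"
proof -
  obtain T c where T: "finite T" "T \<subseteq> B" and c: "y - z = (\<Sum>b\<in>T. c b *\<^sub>R b)"
    using assms(3) unfolding span_explicit by blast
  have "f (z + (\<Sum>b\<in>T. c b *\<^sub>R b)) = f z" if "finite T" "T \<subseteq> B" for T
    using that
  proof (induction T)
    case (insert b T)
    have "f (z + (\<Sum>b\<in>T. c b *\<^sub>R b) + c b *\<^sub>R b) = f (z + (\<Sum>b\<in>T. c b *\<^sub>R b))"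
      using insert assms by (intro constant_direction) auto
    with insert show ?case by (simp add: algebra_simps)
  qed simp
  from this[OF T] show ?thesis by (simp flip: c)
qed

section \<open>Potentials on the plane\<close>

abbreviation D1 :: "(real \<times> real \<Rightarrow> real) \<Rightarrow> real \<times> real \<Rightarrow> real" where "D1 \<equiv> pd (1, 0)"
abbreviation D2 :: "(real \<times> real \<Rightarrow> real) \<Rightarrow> real \<times> real \<Rightarrow> real" where "D2 \<equiv> pd (0, 1)"

lemma Basis_plane: "(Basis :: (real \<times> real) set) = {(1, 0), (0, 1)}"
  by (auto simp: Basis_prod_def)

lemma pd_plane: "smooth A \<Longrightarrow> pd (a, b) A = (\<lambda>z. a * D1 A z + b * D2 A z)"
  by (subst ext[OF pd_expand]) (auto simp: Basis_plane)

lemma pd_zero_pair [simp]: "smooth f \<Longrightarrow> pd (0, 0) f = (\<lambda>z. 0)"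
  using pd_scaleR_dir[of f 0 "(0, 0)"] by simp

text \<open>The antiderivative of \<open>A\<close> in the second variable is \<open>p\<close> times the integral of \<open>A (q, t p)\<close> over \<open>0
    \<le> t \<le> 1\<close>,
  whose limits are fixed. The weights \<open>t\<^sup>n\<close> make this family of integrals closed under differentiation.\<close>

definition radial :: "nat \<Rightarrow> (real \<times> real \<Rightarrow> real) \<Rightarrow> real \<times> real \<Rightarrow> real" where
  "radial n A = (\<lambda>z. integral {0..1} (\<lambda>t. t ^ n * A (fst z, t * snd z)))"

lemma smooth_continuous_on_comp:
  "smooth A \<Longrightarrow> continuous_on S g \<Longrightarrow> continuous_on S (\<lambda>x. A (g x))"
  by (rule continuous_on_compose2[OF smooth_continuous_on]) auto

lemma continuous_on_radial:
  assumes "smooth A" shows "continuous_on UNIV (radial n A)"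
proof -
  have "continuous_on (UNIV \<times> cbox 0 1) (\<lambda>(z, t). t ^ n * A (fst z, t * snd z))"
    unfolding split_beta by (intro continuous_intros smooth_continuous_on_comp[OF assms])
  from integral_continuous_on_param[OF this] show ?thesis by (simp add: radial_def)
qed

lemma radial_has_derivative:
  assumes "smooth A"
  shows "(radial n A has_derivative
    (\<lambda>v. fst v * radial n (D1 A) z + snd v * radial (Suc n) (D2 A) z)) (at z)"
proof -
  \<comment> \<open>\<open>G x t\<close> is the gradient in x of the integrand, kept as a vector so
    that the derivative is the functional \<open>blinfun_inner_left (G x t)\<close>, the form that
    \<open>leibniz_rule\<close> expects. The inner derivative of \<open>t * snd x\<close> raises the
    weight in the second component.\<close>
  define G where "G x t = (t ^ n * D1 A (fst x, t * snd x), t ^ Suc n * D2 A (fst x, t * snd x))"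
    for x :: "real \<times> real" and t
  have contG: "continuous_on S (\<lambda>p. G (f p) (g p))" if "continuous_on S f" "continuous_on S g"
    for S :: "'z::t2_space set" and f g
    unfolding G_def by (intro continuous_intros smooth_continuous_on_comp[OF assms]
        smooth_continuous_on_comp[OF smooth_pd[OF assms]] that)
  have "((\<lambda>x. integral (cbox 0 1) (\<lambda>t. t ^ n * A (fst x, t * snd x))) has_derivative
      blinfun_apply (integral (cbox 0 1) (\<lambda>t. blinfun_inner_left (G z t)))) (at z within UNIV)"
  proof (rule leibniz_rule)
    fix x :: "real \<times> real" and t :: real
    have "linear (\<lambda>x :: real \<times> real. (fst x, t * snd x))"
      by (auto intro!: linearI simp: algebra_simps)
    from has_derivative_linear_comp[OF assms this, of x]
    have "((\<lambda>x. A (fst x, t * snd x)) has_derivative (\<lambda>v. pd (fst v, t * snd v) A (fst x, t * snd x)))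
        (at x)" .
    then have "((\<lambda>x. t ^ n * A (fst x, t * snd x)) has_derivative
        (\<lambda>v. t ^ n * pd (fst v, t * snd v) A (fst x, t * snd x))) (at x)"
      by (rule has_derivative_mult_right)
    then show "((\<lambda>x. t ^ n * A (fst x, t * snd x)) has_derivative
        blinfun_apply (blinfun_inner_left (G x t))) (at x within UNIV)"
      by (rule has_derivative_eq_rhs)
        (auto simp: G_def fun_eq_iff pd_plane[OF assms, of "fst v" "t * snd v" for v] inner_prod_def
            algebra_simps)
  next
    show "(\<lambda>t. t ^ n * A (fst x, t * snd x)) integrable_on cbox 0 1" for x
      by (intro integrable_continuous continuous_intros smooth_continuous_on_comp[OF assms])
    show "continuous_on (UNIV \<times> cbox 0 1) (\<lambda>(x, t). blinfun_inner_left (G x t))"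
      unfolding split_beta
      by (intro bounded_linear.continuous_on[OF bounded_linear_blinfun_inner_left] contG
          continuous_intros)
  qed auto
  moreover have "blinfun_apply (integral (cbox 0 1) (\<lambda>t. blinfun_inner_left (G z t))) =
      (\<lambda>v. fst v * radial n (D1 A) z + snd v * radial (Suc n) (D2 A) z)"
  proof
    fix v
    have "(\<lambda>t. blinfun_inner_left (G z t)) integrable_on cbox 0 1"
      by (intro integrable_continuous bounded_linear.continuous_on[OF bounded_linear_blinfun_inner_left]
          contG continuous_intros)
    from integral_linear[OF this blinfun.bounded_linear_left, of v]
    have "blinfun_apply (integral (cbox 0 1) (\<lambda>t. blinfun_inner_left (G z t))) v
        = integral (cbox 0 1) (\<lambda>t. v \<bullet> G z t)"
      by (simp add: o_def)
    also have "\<dots> = integral (cbox 0 1) (\<lambda>t. fst v * (t ^ n * D1 A (fst z, t * snd z))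
        + snd v * (t ^ Suc n * D2 A (fst z, t * snd z)))"
      by (simp add: G_def inner_prod_def)
    also have "\<dots> = integral (cbox 0 1) (\<lambda>t. fst v * (t ^ n * D1 A (fst z, t * snd z)))
        + integral (cbox 0 1) (\<lambda>t. snd v * (t ^ Suc n * D2 A (fst z, t * snd z)))"
      by (intro Henstock_Kurzweil_Integration.integral_add integrable_continuous continuous_intros
          smooth_continuous_on_comp[OF assms] smooth_continuous_on_comp[OF smooth_pd[OF assms]])
    finally show "blinfun_apply (integral (cbox 0 1) (\<lambda>t. blinfun_inner_left (G z t))) v =
      fst v * radial n (D1 A) z + snd v * radial (Suc n) (D2 A) z" by (simp add: radial_def)
  qed
  ultimately show ?thesis by (simp add: radial_def [of n A])
qed

lemma smooth_radial:
  assumes "smooth A" shows "smooth (radial n A)"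
proof -
  have "Ck k (radial n A)" if "smooth A" for k n A
    using that
  proof (induction k arbitrary: n A)
    case 0 then show ?case by (simp add: continuous_on_radial)
  next
    case (Suc k)
    have "pd v (radial n A) = (\<lambda>z. fst v * radial n (D1 A) z + snd v * radial (Suc n) (D2 A) z)" for v
      using pd_eqI[OF radial_has_derivative[OF Suc.prems]] by blast
    moreover have "radial n A differentiable at z" for z
      using radial_has_derivative[OF Suc.prems] differentiable_def by blast
    ultimately show ?case
      using Suc by (auto simp: Ck_Suc_iff intro!: Ck_add Ck_mult)
  qed
  with assms show ?thesis by (simp add: smooth_def)
qed

lemma pd_radial:
  "smooth A \<Longrightarrow> pd v (radial n A) = (\<lambda>z. fst v * radial n (D1 A) z + snd v * radial (Suc n) (D2 A) z)"
  using pd_eqI[OF radial_has_derivative] by blast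

lemma smooth_fst [simp, intro]: "smooth (fst :: real \<times> real \<Rightarrow> real)"
  using smooth_inner[of "(1, 0) :: real \<times> real"] by (simp add: inner_prod_def)

lemma smooth_snd [simp, intro]: "smooth (snd :: real \<times> real \<Rightarrow> real)"
  using smooth_inner[of "(0, 1) :: real \<times> real"] by (simp add: inner_prod_def)

lemma pd_fst [simp]: "pd v (fst :: real \<times> real \<Rightarrow> real) = (\<lambda>z. fst v)"
  using pd_inner[of v "(1, 0)"] by (simp add: inner_prod_def)

lemma pd_snd [simp]: "pd v (snd :: real \<times> real \<Rightarrow> real) = (\<lambda>z. snd v)"
  using pd_inner[of v "(0, 1)"] by (simp add: inner_prod_def)

definition antiderivative :: "(real \<times> real \<Rightarrow> real) \<Rightarrow> real \<times> real \<Rightarrow> real" where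
  "antiderivative A = (\<lambda>z. snd z * radial 0 A z)"

lemma smooth_antiderivative [simp, intro]: "smooth A \<Longrightarrow> smooth (antiderivative A)"
  unfolding antiderivative_def by (simp add: smooth_radial)

lemma D1_antiderivative: "smooth A \<Longrightarrow> D1 (antiderivative A) = antiderivative (D1 A)"
  unfolding antiderivative_def by (simp add: smooth_radial pd_radial)

text \<open>The product rule gives two integrals over 0..1, and their sum is the integral of the
  t-derivative of \<open>t * A (fst z, t * snd z)\<close>. Its boundary values are
  \<open>A z\<close> and 0.\<close>

lemma D2_antiderivative:
  assumes "smooth A" shows "D2 (antiderivative A) = A"
proof
  fix z :: "real \<times> real"
  have "((\<lambda>t. A (fst z, t * snd z)) has_real_derivative snd z * D2 A (fst z, t * snd z)) (at t within
      {0..1})" for t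
    using has_real_derivative_line[OF assms, of "(fst z, 0)" "(0, snd z)" t]
    by (simp add: pd_plane[OF assms, of 0 "snd z"])
  then have "((\<lambda>t. t * A (fst z, t * snd z)) has_real_derivative
      A (fst z, t * snd z) + snd z * (t * D2 A (fst z, t * snd z))) (at t within {0..1})" for t
    by (rule DERIV_cong[OF DERIV_mult[OF DERIV_ident]]) (simp add: algebra_simps)
  then have "((\<lambda>t. t * A (fst z, t * snd z)) has_vector_derivative
      A (fst z, t * snd z) + snd z * (t * D2 A (fst z, t * snd z))) (at t within {0..1})" for t
    by (simp only: has_real_derivative_iff_has_vector_derivative)
  note deriv = this
  have "((\<lambda>t. A (fst z, t * snd z) + snd z * (t * D2 A (fst z, t * snd z))) has_integral
      (\<lambda>t. t * A (fst z, t * snd z)) 1 - (\<lambda>t. t * A (fst z, t * snd z)) 0) {0..1}"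
    by (rule fundamental_theorem_of_calculus[OF zero_le_one]) (rule deriv)
  moreover have "integral {0..1} (\<lambda>t. A (fst z, t * snd z) + snd z * (t * D2 A (fst z, t * snd z))) =
     integral {0..1} (\<lambda>t. A (fst z, t * snd z)) + integral {0..1} (\<lambda>t. snd z * (t * D2 A (fst z, t * snd
         z)))"
    by (intro Henstock_Kurzweil_Integration.integral_add integrable_continuous_real continuous_intros
          smooth_continuous_on_comp[OF assms] smooth_continuous_on_comp[OF smooth_pd[OF assms]])
  ultimately have "radial 0 A z + snd z * radial (Suc 0) (D2 A) z = A z"
    by (simp add: radial_def integral_unique)
  then show "D2 (antiderivative A) z = A z"
    unfolding antiderivative_def using assms by (simp add: smooth_radial pd_radial algebra_simps)
qed

lemma all_partials_zero_const:
  assumes "smooth f" "\<And>b. b \<in> Basis \<Longrightarrow> pd b f = (\<lambda>z. 0)" shows "f z = f y"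
  using constant_directions[OF assms, where y = z and z = y] by simp

text \<open>The Poincare lemma on the plane. The antiderivative of \<open>a\<close> in the second
  variable has the right \<open>D2\<close>, and subtracting a function of the first variable alone
  repairs \<open>D1\<close> without disturbing \<open>D2\<close>.\<close>

lemma plane_potential:
  assumes "smooth a" "smooth b" "\<And>z. D1 a z + D2 b z = 0"
  obtains A where "smooth A" "D2 A = a" "D1 A = (\<lambda>z. - b z)"
proof -
  \<comment> \<open>The coordinates are swapped so that the same one-variable antiderivative can be
    reused: \<open>c (0, x)\<close> is the integral of \<open>b (s, 0)\<close> for s from 0 to
    x.\<close>
  define c where "c = antiderivative (\<lambda>z. b (snd z, 0))"
  have lin: "linear (\<lambda>z :: real \<times> real. (snd z, 0 :: real))"
    "linear (\<lambda>z :: real \<times> real. (0 :: real, fst z))"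
    by (auto intro!: linearI)
  have sb: "smooth (\<lambda>z :: real \<times> real. b (snd z, 0))" by (rule smooth_linear_comp[OF assms(2) lin(1)])
  define A where "A z = antiderivative a z - c (0, fst z)" for z
  have sc: "smooth c" unfolding c_def using sb by blast
  have sc': "smooth (\<lambda>z :: real \<times> real. c (0, fst z))" by (rule smooth_linear_comp[OF sc lin(2)])
  have sA: "smooth A" unfolding A_def using sc sc' assms by simp
  have d2: "D2 A = a"
    unfolding A_def using sc sc' assms
    by (simp add: D2_antiderivative pd_linear_comp[OF _ lin(2)])
  have d2c: "D2 c = (\<lambda>z :: real \<times> real. b (snd z, 0))" unfolding c_def by (rule D2_antiderivative[OF sb])
  \<comment> \<open>The defect \<open>e\<close> does not depend on the second variable, by the
    divergence condition, and it vanishes on the first axis by the choice of \<open>c\<close>; the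
    factor \<open>snd z\<close> in the antiderivative is 0 there.\<close>
  define e where "e z = D1 A z + b z" for z
  have se: "smooth e" unfolding e_def using sA assms by simp
  have "D2 e = (\<lambda>z. 0)"
    unfolding e_def using sA assms by (simp add: pd_commute[OF sA, of "(0,1)" "(1,0)"] d2)
  then have "e z = e (fst z, 0)" for z
    using constant_direction[OF se, of "(0,1)" "(fst z, 0)" "snd z"] by simp
  moreover have "e (q, 0) = 0" for q
    unfolding e_def A_def using sc sc' assms
    by (simp add: D1_antiderivative pd_linear_comp[OF _ lin(2)] d2c)
      (simp add: antiderivative_def)
  ultimately have "e z = 0" for z by metis
  then have "D1 A = (\<lambda>z. - b z)" by (auto simp: e_def fun_eq_iff eq_neg_iff_add_eq_0)
  with sA d2 show ?thesis by (rule that)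
qed

section \<open>Coordinates on the jet space\<close>

definition ex :: "4 \<Rightarrow> jet1" where "ex i = (axis i 1, 0, 0)"
definition eu :: jet1 where "eu = (0, 1, 0)"
definition ep :: "4 \<Rightarrow> jet1" where "ep i = (0, 0, axis i 1)"

abbreviation DX :: "4 \<Rightarrow> (jet1 \<Rightarrow> real) \<Rightarrow> jet1 \<Rightarrow> real" where "DX i \<equiv> pd (ex i)"
abbreviation DU :: "(jet1 \<Rightarrow> real) \<Rightarrow> jet1 \<Rightarrow> real" where "DU \<equiv> pd eu"
abbreviation DP :: "4 \<Rightarrow> (jet1 \<Rightarrow> real) \<Rightarrow> jet1 \<Rightarrow> real" where "DP i \<equiv> pd (ep i)"

abbreviation xc :: "4 \<Rightarrow> jet1 \<Rightarrow> real" where "xc i z \<equiv> z \<bullet> ex i"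
abbreviation uc :: "jet1 \<Rightarrow> real" where "uc z \<equiv> z \<bullet> eu"
abbreviation pc :: "4 \<Rightarrow> jet1 \<Rightarrow> real" where "pc i z \<equiv> z \<bullet> ep i"

lemma inner_jet [simp]:
  "ex i \<bullet> ex j = (if i = j then 1 else 0)" "ep i \<bullet> ep j = (if i = j then 1 else 0)" "eu \<bullet> eu = 1"
  "ex i \<bullet> eu = 0" "eu \<bullet> ex i = 0" "ex i \<bullet> ep j = 0" "ep j \<bullet> ex i = 0" "ep i \<bullet> eu = 0" "eu \<bullet> ep i = 0"
  by (simp_all add: ex_def eu_def ep_def inner_prod_def inner_axis_axis)

lemma Basis_jet: "(Basis :: jet1 set) = range ex \<union> {eu} \<union> range ep"
proof -
  have vec: "(Basis :: (real ^ 4) set) = range (\<lambda>i. axis i 1)" by (auto simp: Basis_vec_def)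
  show ?thesis
    by (simp add: vec Basis_prod_def image_Un image_image zero_prod_def Un_assoc ex_def [abs_def]
        eu_def ep_def [abs_def])
qed

lemma jet_components:
  "(x, u, p) \<bullet> ex i = x $ i" "(x, u, p) \<bullet> eu = u" "(x, u, p) \<bullet> ep i = p $ i"
  by (simp_all add: ex_def eu_def ep_def inner_prod_def inner_axis)

lemma jet_expand: "z = (\<Sum>i\<in>UNIV. (xc i z) *\<^sub>R ex i) + uc z *\<^sub>R eu + (\<Sum>i\<in>UNIV. (pc i z) *\<^sub>R ep i)"
proof -
  have vec: "(\<Sum>i\<in>UNIV. x $ i *\<^sub>R axis i 1) = x" for x :: "real ^ 4"
    by (simp add: vec_eq_iff axis_def if_distrib[of "\<lambda>c. _ * c"] cong: if_cong)
  obtain x u p where z: "z = (x, u, p)" by (cases z)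
  show ?thesis unfolding z
    by (simp add: jet_components prod_eq_iff fst_sum snd_sum)
      (simp add: ex_def eu_def ep_def vec)
qed

lemma pd_jet_expand:
  assumes "smooth f"
  shows "pd v f z = (\<Sum>i\<in>UNIV. (v \<bullet> ex i) * DX i f z) + (v \<bullet> eu) * DU f z
    + (\<Sum>i\<in>UNIV. (v \<bullet> ep i) * DP i f z)"
  by (subst jet_expand[of v])
    (simp only: linear_add[OF linear_pd[OF assms]] linear_sum[OF linear_pd[OF assms]] pd_scaleR_dir[OF
        assms])

lemma D_eq_pd: "Dx i f = DX i f" "Du f = DU f" "Dp i f = DP i f"
  by (auto simp: Dx_def Du_def Dp_def pd_def ex_def eu_def ep_def)

lemma jacobi_bracket_eq:
  assumes "smooth f" "smooth g"
  shows "jacobi_bracket f g = (\<lambda>z.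
    (\<Sum>i\<in>UNIV. (DX i f z + pc i z * DU f z) * DP i g z - DP i f z * DX i g z)
    + (f z - (\<Sum>i\<in>UNIV. (pc i z) * DP i f z)) * DU g z - DU f z * g z)"
proof
  fix z :: jet1
  obtain x u p where z: "z = (x, u, p)" by (cases z)
  have "frechet_derivative g (at z) (contact_field f z) = pd (contact_field f z) g z"
    by (simp add: pd_def)
  then show "jacobi_bracket f g z = (\<Sum>i\<in>UNIV. (DX i f z + pc i z * DU f z) * DP i g z
      - DP i f z * DX i g z)
    + (f z - (\<Sum>i\<in>UNIV. (pc i z) * DP i f z)) * DU g z - DU f z * g z"
    unfolding jacobi_bracket_def pd_jet_expand[OF assms(2), of "contact_field f z"]
    by (simp add: contact_field_def Let_def z jet_components D_eq_pd sum_subtractf sum_negf)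
qed

text \<open>The total derivative at \<open>h = 0\<close>.\<close>

definition dx :: "4 \<Rightarrow> (jet1 \<Rightarrow> real) \<Rightarrow> jet1 \<Rightarrow> real" where
  "dx i f = (\<lambda>z. DX i f z + pc i z * DU f z)"

lemma smooth_dx [simp, intro]: "smooth f \<Longrightarrow> smooth (dx i f)"
  unfolding dx_def by simp

lemma dx_add [simp]: "smooth f \<Longrightarrow> smooth g \<Longrightarrow> dx i (\<lambda>z. f z + g z) = (\<lambda>z. dx i f z + dx i g z)"
  unfolding dx_def by (simp add: algebra_simps)

lemma dx_cmult [simp]: "smooth f \<Longrightarrow> dx i (\<lambda>z. c * f z) = (\<lambda>z. c * dx i f z)"
  unfolding dx_def by (simp add: algebra_simps)

lemma dx_const [simp]: "dx i (\<lambda>z. c) = (\<lambda>z. 0)"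
  unfolding dx_def by simp

lemma dx_sum [simp]:
  "(\<And>i. i \<in> I \<Longrightarrow> smooth (f i)) \<Longrightarrow> dx j (\<lambda>z. \<Sum>i\<in>I. f i z) = (\<lambda>z. \<Sum>i\<in>I. dx j (f i) z)"
  by (induction I rule: infinite_finite_induct) auto

text \<open>The coefficient \<open>pc j\<close> of \<open>DU\<close> in \<open>dx j\<close> has
  derivative 1 along \<open>ep j\<close>. This commutator is the source of all information on
  \<open>DU f\<close>.\<close>

lemma pd_ep_dx:
  "smooth f \<Longrightarrow> DP k (dx j f) = (\<lambda>z. dx j (DP k f) z + (if j = k then DU f z else 0))"
  unfolding dx_def
  by (auto simp: fun_eq_iff pd_commute[of f "ep k" "ex j"] pd_commute[of f "ep k" eu])

lemma total_deriv_eq: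
  assumes "smooth f"
  shows "total_deriv h i f = (\<lambda>z. dx i f z + (\<Sum>k\<in>UNIV. h $ i $ k * DP k f z))"
proof
  fix z :: jet1
  obtain x u p where z: "z = (x, u, p)" by (cases z)
  have ax: "axis i (1::real) $ k = (if k = i then 1 else 0)" for k :: 4 by (simp add: axis_def)
  have "(\<Sum>k\<in>UNIV. (axis i 1 $ k) * DX k f z) = DX i f z"
    by (simp add: ax if_distrib[of "\<lambda>x. x * _"] sum.delta cong: if_cong)
  then show "total_deriv h i f z = dx i f z + (\<Sum>k\<in>UNIV. h $ i $ k * DP k f z)"
    unfolding total_deriv_def dx_def z split_conv pd_def[of _ f, symmetric, THEN fun_cong]
      pd_jet_expand[OF assms, of "(axis i 1, p $ i, h $ i)"]
    by (simp add: jet_components z)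
qed

text \<open>The iterated total derivative as a polynomial in the entries of h. The term with
  \<open>DU f\<close> comes from moving a momentum derivative past \<open>dx\<close>.\<close>

definition D2f :: "(jet1 \<Rightarrow> real) \<Rightarrow> real ^ 4 ^ 4 \<Rightarrow> 4 \<Rightarrow> 4 \<Rightarrow> jet1 \<Rightarrow> real" where
  "D2f f h i j z = dx i (dx j f) z + h $ i $ j * DU f z
    + (\<Sum>k\<in>UNIV. h $ j $ k * dx i (DP k f) z) + (\<Sum>k\<in>UNIV. h $ i $ k * dx j (DP k f) z)
    + (\<Sum>k\<in>UNIV. \<Sum>l\<in>UNIV. h $ i $ k * h $ j $ l * DP k (DP l f) z)"

lemma total_deriv_total_deriv:
  assumes "smooth f"
  shows "total_deriv h i (total_deriv h j f) z = D2f f h i j z"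
proof -
  define g where "g = (\<lambda>z. dx j f z + (\<Sum>l\<in>UNIV. h $ j $ l * DP l f z))"
  have g: "smooth g" unfolding g_def using assms by simp
  have 1: "dx i g z = dx i (dx j f) z + (\<Sum>k\<in>UNIV. h $ j $ k * dx i (DP k f) z)"
    unfolding g_def using assms by simp
  have 2: "DP k g z = dx j (DP k f) z + (if j = k then DU f z else 0)
      + (\<Sum>l\<in>UNIV. h $ j $ l * DP k (DP l f) z)" for k
    unfolding g_def using assms by (simp add: pd_ep_dx)
  have 3: "(\<Sum>k\<in>UNIV. h $ i $ k * (if j = k then DU f z else 0)) = h $ i $ j * DU f z"
    by (simp add: if_distrib[of "\<lambda>x. _ * x"] cong: if_cong)
  show ?thesis
    unfolding total_deriv_eq[OF assms] g_def[symmetric] total_deriv_eq[OF g] 1 2 D2f_def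
      distrib_left sum.distrib sum_distrib_left 3 by (simp only: ac_simps)
qed

lemma prolongation_eq: "smooth f \<Longrightarrow> snd (prolongation f (z, h)) $ i $ j = D2f f h i j z"
  by (simp add: prolongation_def total_deriv_total_deriv)

text \<open>Two arbitrary directions are allowed because both kinds of planes occur: a conjugate
  pair of a position and its momentum, or two positions.\<close>

definition pull :: "'a::euclidean_space \<Rightarrow> 'a \<Rightarrow> (real \<times> real \<Rightarrow> real) \<Rightarrow> 'a \<Rightarrow> real" where
  "pull v w A = (\<lambda>z. A (z \<bullet> v, z \<bullet> w))"

abbreviation pullx :: "4 \<Rightarrow> 4 \<Rightarrow> (real \<times> real \<Rightarrow> real) \<Rightarrow> jet1 \<Rightarrow> real" where
  "pullx i j \<equiv> pull (ex i) (ex j)"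

lemma linear_pull: "linear (\<lambda>z. (z \<bullet> v, z \<bullet> w))"
  by (auto intro!: linearI simp: inner_simps)

lemma smooth_pull [simp, intro]: "smooth A \<Longrightarrow> smooth (pull v w A)"
  unfolding pull_def by (rule smooth_linear_comp[OF _ linear_pull])

lemma pd_pull [simp]:
  "smooth A \<Longrightarrow> pd b (pull v w A) = (\<lambda>z. (b \<bullet> v) * pull v w (D1 A) z + (b \<bullet> w) * pull v w (D2 A) z)"
  unfolding pull_def by (subst pd_linear_comp[OF _ linear_pull]) (auto simp: pd_plane[of A "b \<bullet> v" "b \<bullet>
      w"])

lemma pull_cong_inj:
  assumes "v \<bullet> v = 1" "w \<bullet> w = 1" "v \<bullet> w = 0" "pull v w A = pull v w B" shows "A = B"
proof
  fix z :: "real \<times> real"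
  have "w \<bullet> v = 0" using assms(3) by (simp add: inner_commute)
  then have "pull v w F (fst z *\<^sub>R v + snd z *\<^sub>R w) = F z" for F
    using assms(1-3) by (simp add: pull_def inner_simps)
  then show "A z = B z" using assms(4) by metis
qed

text \<open>\<open>A\<close> is the restriction of h to the plane spanned by v and w. Each point
  differs from its projection to this plane by a combination of the remaining basis vectors, along
  which h is constant.\<close>

lemma factor_pull:
  assumes "smooth h" "v \<in> Basis" "w \<in> Basis" "v \<noteq> w" "\<forall>b\<in>Basis. b = v \<or> b = w \<or> pd b h = (\<lambda>z. 0)"
  shows "\<exists>A. smooth A \<and> h = pull v w A"
proof -
  define A where "A = (\<lambda>y :: real \<times> real. h (fst y *\<^sub>R v + snd y *\<^sub>R w))"
  have "linear (\<lambda>y :: real \<times> real. fst y *\<^sub>R v + snd y *\<^sub>R w)"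
    by (auto intro!: linearI simp: algebra_simps)
  then have "smooth A" unfolding A_def by (rule smooth_linear_comp[OF assms(1)])
  moreover have "h z = pull v w A z" for z
    unfolding pull_def A_def
  proof (rule constant_directions[OF assms(1), of "Basis - {v, w}"])
    have "z = (\<Sum>b\<in>Basis. (z \<bullet> b) *\<^sub>R b)" by (simp add: euclidean_representation)
    also have "\<dots> = (z \<bullet> v) *\<^sub>R v + (z \<bullet> w) *\<^sub>R w + (\<Sum>b\<in>Basis - {v, w}. (z \<bullet> b) *\<^sub>R b)"
      using assms(2-4) by (simp add: sum.remove[of Basis v] sum.remove[of "Basis - {v}" w]
          Diff_insert2[symmetric]
        insert_commute algebra_simps)
    finally have "z - (fst (z \<bullet> v, z \<bullet> w) *\<^sub>R v + snd (z \<bullet> v, z \<bullet> w) *\<^sub>R w) = (\<Sum>b\<in>Basis - {v, w}. (z \<bullet> b)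
        *\<^sub>R b)"
      by (simp add: algebra_simps)
    then show "z - (fst (z \<bullet> v, z \<bullet> w) *\<^sub>R v + snd (z \<bullet> v, z \<bullet> w) *\<^sub>R w) \<in> span (Basis - {v, w})"
      by (simp only:) (intro span_sum span_scale span_base)
  qed (use assms in auto)
  ultimately show ?thesis by blast
qed

section \<open>Determining equations\<close>

text \<open>Below \<open>S i j\<close>, \<open>C i k\<close>, \<open>Q k l\<close> and \<open>w\<close> stand for the values at a point of \<open>dx i (dx j f)\<close>, \<open>dx i
    f\<^sub>k\<close>, \<open>f\<^sub>k\<^sub>l\<close> and
  \<open>f\<^sub>u\<close>, where the subscripts of \<open>f\<close> denote derivatives in the momenta \<open>p\<close>. The matrices at which the
      symmetry condition is
  evaluated were found by computer; they span all linear consequences of the condition.\<close>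

definition second_jet :: "(4 \<Rightarrow> 4 \<Rightarrow> real) \<Rightarrow> (4 \<Rightarrow> 4 \<Rightarrow> real) \<Rightarrow> (4 \<Rightarrow> 4 \<Rightarrow> real) \<Rightarrow> real \<Rightarrow>
    real ^ 4 ^ 4 \<Rightarrow> 4 \<Rightarrow> 4 \<Rightarrow> real" where
  "second_jet S C Q w h i j = S i j + h $ i $ j * w + (\<Sum>k\<in>UNIV. h $ j $ k * C i k) + (\<Sum>k\<in>UNIV. h $ i $ k
      * C j k)
    + (\<Sum>k\<in>UNIV. \<Sum>l\<in>UNIV. h $ i $ k * h $ j $ l * Q k l)"

definition symm :: "real \<Rightarrow> real \<Rightarrow> real \<Rightarrow> real \<Rightarrow> real \<Rightarrow> real \<Rightarrow> real \<Rightarrow> real \<Rightarrow> real \<Rightarrow> real \<Rightarrow> real ^ 4 ^ 4"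
    where
  "symm a11 a12 a13 a14 a22 a23 a24 a33 a34 a44 = vector [vector [a11, a12, a13, a14],
     vector [a12, a22, a23, a24], vector [a13, a23, a33, a34], vector [a14, a24, a34, a44]]"

lemma vector4_nth:
  "(vector [x1, x2, x3, x4] :: 'a::zero ^ 4) $ 1 = x1" "(vector [x1, x2, x3, x4] :: 'a::zero ^ 4) $ 2 =
      x2"
  "(vector [x1, x2, x3, x4] :: 'a::zero ^ 4) $ 3 = x3" "(vector [x1, x2, x3, x4] :: 'a::zero ^ 4) $ 4 =
      x4"
  by (simp_all add: vector_def)

lemmas symm_nth = symm_def vector4_nth

lemma transpose_symm: "transpose (symm a11 a12 a13 a14 a22 a23 a24 a33 a34 a44) = symm a11 a12 a13 a14
    a22 a23 a24 a33 a34 a44"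
  by (simp add: vec_eq_iff forall_4 transpose_def symm_nth)

lemma transpose_entries:
  assumes "transpose (h :: real ^ 4 ^ 4) = h"
  shows "h $ 2 $ 1 = h $ 1 $ 2" "h $ 3 $ 1 = h $ 1 $ 3" "h $ 4 $ 1 = h $ 1 $ 4"
    "h $ 3 $ 2 = h $ 2 $ 3" "h $ 4 $ 2 = h $ 2 $ 4" "h $ 4 $ 3 = h $ 3 $ 4"
proof -
  have "h $ i $ j = h $ j $ i" for i j
    using arg_cong[OF assms, of "\<lambda>h. h $ j $ i"] by (simp add: transpose_def)
  then show "h $ 2 $ 1 = h $ 1 $ 2" "h $ 3 $ 1 = h $ 1 $ 3" "h $ 4 $ 1 = h $ 1 $ 4"
    "h $ 3 $ 2 = h $ 2 $ 3" "h $ 4 $ 2 = h $ 2 $ 4" "h $ 4 $ 3 = h $ 3 $ 4" by this+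
qed

text \<open>The equations are in solved form: no left side recurs on a right side. In the converse
  direction of \<open>determining_N_iff\<close> they serve as rewrite rules.\<close>

definition determining_N ::
  "(4 \<Rightarrow> 4 \<Rightarrow> real) \<Rightarrow> (4 \<Rightarrow> 4 \<Rightarrow> real) \<Rightarrow> (4 \<Rightarrow> 4 \<Rightarrow> real) \<Rightarrow> real \<Rightarrow> bool" where
  "determining_N S C Q w \<longleftrightarrow>
     Q 1 1 = 0 \<and> Q 1 2 = 0 \<and> Q 1 3 = 0 \<and> Q 1 4 = 0 \<and> Q 2 2 = 0 \<and>
     Q 2 3 = 0 \<and> Q 2 4 = 0 \<and> Q 3 3 = 0 \<and> Q 3 4 = 0 \<and> Q 4 4 = 0 \<and>
     C 2 4 = 0 \<and> C 1 3 = 0 \<and> C 2 3 = 0 \<and> C 1 4 = 0 \<and>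
     C 2 1 = C 3 4 \<and> C 1 2 = C 4 3 \<and> S 1 3 = S 2 4 \<and>
     C 3 3 = C 2 2 + C 4 4 - C 1 1 \<and> w = C 4 4 - 2 * C 1 1 - C 2 2 \<and>
     C 3 2 = C 4 1 - 2 * S 1 2 \<and> S 1 1 = - C 4 2 \<and> S 2 2 = C 3 1"

lemma determining_N_iff:
  fixes S C Q :: "4 \<Rightarrow> 4 \<Rightarrow> real" and w :: real
  defines "E \<equiv> second_jet S C Q w"
  assumes sym: "\<And>i j. Q i j = Q j i"
  shows "(\<forall>h. transpose h = h \<longrightarrow> h $ 2 $ 4 - h $ 1 $ 3 + h $ 1 $ 1 * h $ 2 $ 2 - (h $ 1 $ 2)\<^sup>2 = 0 \<longrightarrow>
     E h 2 4 - E h 1 3 + (E h 1 1 * h $ 2 $ 2 + h $ 1 $ 1 * E h 2 2) - 2 * h $ 1 $ 2 * E h 1 2 = 0) \<longleftrightarrow>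
     determining_N S C Q w"
    (is "?L \<longleftrightarrow> ?R")
proof
  note sym4 = sym[of 2 1] sym[of 3 1] sym[of 4 1] sym[of 3 2] sym[of 4 2] sym[of 4 3]
  assume L: ?L
  note H = spec[OF L, of "symm h11 h12 h13 h14 h22 h23 h24 h33 h34 h44" for h11 h12 h13 h14 h22 h23 h24
      h33 h34 h44,
      THEN mp, OF transpose_symm, THEN mp]
  note unf = E_def second_jet_def sum_4 sym4 symm_nth
  \<comment> \<open>There are as many sample matrices on the hypersurface as there are conjuncts to
    be proved; each conjunct is a linear combination of the sampled equations.\<close>
  note eqs =
    H[of 0 0 0 0 0 0 0 0 0 0] H[of 0 0 0 0 0 0 0 1 0 0] H[of 0 0 0 0 0 0 0 0 0 1]
    H[of 1 0 0 0 0 0 0 0 0 0] H[of 1 0 0 0 0 0 0 1 0 0] H[of 0 0 0 1 0 0 0 0 0 0]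
    H[of 0 0 0 1 0 0 0 1 0 0] H[of 0 0 0 0 1 0 0 0 0 0] H[of 0 0 0 0 1 0 0 0 0 1]
    H[of 0 0 0 0 0 1 0 0 0 0] H[of 0 0 0 0 0 0 0 0 1 0] H[of 1 0 0 0 0 0 0 0 1 0]
    H[of 0 0 0 1 0 0 0 0 1 0] H[of 0 0 0 0 1 0 0 0 1 0] H[of 0 0 0 0 0 1 0 0 1 0]
    H[of 1 0 0 0 0 1 0 0 0 0] H[of 0 0 0 1 1 0 0 0 0 0] H[of 1 1 0 0 1 0 0 0 0 0]
    H[of 1 1 0 1 1 0 0 0 0 0] H[of 1 1 0 0 1 1 0 0 0 0] H[of 0 0 1 0 0 0 1 0 0 0]
    H[of 0 1 0 0 0 0 1 0 0 0]
  show ?R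
    unfolding determining_N_def by (intro conjI; use eqs[unfolded unf, simplified] in linarith)
next
  assume R: ?R
  show ?L
  proof (intro allI impI)
    fix h :: "real ^ 4 ^ 4"
    assume t: "transpose h = h" and F: "h $ 2 $ 4 - h $ 1 $ 3 + h $ 1 $ 1 * h $ 2 $ 2 - (h $ 1 $ 2)\<^sup>2 =
        0"
    note entries = transpose_entries[OF t]
    \<comment> \<open>The equation is linear in this entry. Once it is eliminated, the condition is
      a polynomial identity in the other entries.\<close>
    have F': "h $ 2 $ 4 = h $ 1 $ 3 - h $ 1 $ 1 * h $ 2 $ 2 + (h $ 1 $ 2)\<^sup>2" using F by simp
    show "E h 2 4 - E h 1 3 + (E h 1 1 * h $ 2 $ 2 + h $ 1 $ 1 * E h 2 2) - 2 * h $ 1 $ 2 * E h 1 2 = 0"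
      by (simp add: E_def second_jet_def sum_4 entries sym[of 2 1] sym[of 3 1] sym[of 4 1] sym[of 3 2]
          sym[of 4 2] sym[of 4 3] R[unfolded determining_N_def])
        (simp add: F' algebra_simps power2_eq_square)
  qed
qed

text \<open>The last equation is the only one that involves \<open>w\<close>. The constant 1 in
  equation D cannot be rescaled, so the total weight
  \<open>2 * w + C 1 1 + C 2 2 + C 3 3 + C 4 4\<close> of the quadratic part must vanish.
  \<open>determining_I\<close> has no counterpart, because equation I is homogeneous.\<close>

definition determining_D ::
  "(4 \<Rightarrow> 4 \<Rightarrow> real) \<Rightarrow> (4 \<Rightarrow> 4 \<Rightarrow> real) \<Rightarrow> (4 \<Rightarrow> 4 \<Rightarrow> real) \<Rightarrow> real \<Rightarrow> bool" where
  "determining_D S C Q w \<longleftrightarrow>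
     Q 1 1 = 0 \<and> Q 1 2 = 0 \<and> Q 1 3 = 0 \<and> Q 1 4 = 0 \<and> Q 2 2 = 0 \<and>
     Q 2 3 = 0 \<and> Q 2 4 = 0 \<and> Q 3 3 = 0 \<and> Q 3 4 = 0 \<and> Q 4 4 = 0 \<and>
     C 3 1 = 0 \<and> C 4 1 = 0 \<and> C 3 2 = 0 \<and> C 4 2 = 0 \<and> C 1 3 = 0 \<and>
     C 2 3 = 0 \<and> C 1 4 = 0 \<and> C 2 4 = 0 \<and> S 1 3 = 0 \<and> S 1 4 = 0 \<and>
     S 2 3 = 0 \<and> S 2 4 = 0 \<and> C 4 4 = - 2 * w - C 1 1 - C 2 2 - C 3 3"

lemma determining_D_iff:
  fixes S C Q :: "4 \<Rightarrow> 4 \<Rightarrow> real" and w :: real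
  defines "E \<equiv> second_jet S C Q w"
  assumes sym: "\<And>i j. Q i j = Q j i"
  shows "(\<forall>h. transpose h = h \<longrightarrow> h $ 1 $ 4 * h $ 2 $ 3 - h $ 1 $ 3 * h $ 2 $ 4 - 1 = 0 \<longrightarrow>
     E h 1 4 * h $ 2 $ 3 + h $ 1 $ 4 * E h 2 3 - (E h 1 3 * h $ 2 $ 4 + h $ 1 $ 3 * E h 2 4) = 0) \<longleftrightarrow>
     determining_D S C Q w"
    (is "?L \<longleftrightarrow> ?R")
proof
  note sym4 = sym[of 2 1] sym[of 3 1] sym[of 4 1] sym[of 3 2] sym[of 4 2] sym[of 4 3]
  assume L: ?L
  note H = spec[OF L, of "symm h11 h12 h13 h14 h22 h23 h24 h33 h34 h44" for h11 h12 h13 h14 h22 h23 h24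
      h33 h34 h44,
      THEN mp, OF transpose_symm, THEN mp]
  note unf = E_def second_jet_def sum_4 sym4 symm_nth
  \<comment> \<open>The zero matrix violates equation D, so the samples start from h14 = h23 = 1 or
    from h13 = 1, h24 = -1. Each line adds one matrix and solves for one unknown modulo the lines
    before it.\<close>
  have e0: "Q 1 4 = - S 1 4 - 2 * w - C 1 1 - C 4 4 - S 2 3 - C 2 2 - C 3 3 - Q 2 3" using H[of 0 0 0 1 0
      1 0 0 0 0, unfolded unf, simplified] by linarith
  have e1: "Q 1 1 = - C 4 1" using H[of 1 0 0 1 0 1 0 0 0 0, unfolded unf, simplified] e0 by linarith
  have e2: "Q 1 3 = S 2 4" using H[of 0 0 1 1 0 1 0 0 0 0, unfolded unf, simplified] e0 by linarith
  have e3: "Q 2 2 = - C 3 2" using H[of 0 0 0 1 1 1 0 0 0 0, unfolded unf, simplified] e0 by linarith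
  have e4: "C 4 2 = 0" using H[of 0 0 1 1 1 1 0 0 0 0, unfolded unf, simplified] e0 e2 e3 by linarith
  have e5: "Q 2 4 = S 1 3" using H[of 0 0 0 1 0 1 1 0 0 0, unfolded unf, simplified] e0 by linarith
  have e6: "C 3 1 = 0" using H[of 1 0 0 1 0 1 1 0 0 0, unfolded unf, simplified] e0 e1 e5 by linarith
  have e7: "Q 1 2 = 0" using H[of 0 1 0 1 0 1 0 0 0 0, unfolded unf, simplified] e0 e4 e6 by linarith
  have e8: "C 4 1 = 0" using H[of 0 1 1 1 0 1 0 0 0 0, unfolded unf, simplified] e0 e2 e4 e6 e7 by
      linarith
  have e9: "C 3 2 = 0" using H[of 0 1 0 1 0 1 1 0 0 0, unfolded unf, simplified] e0 e4 e5 e6 e7 by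
      linarith
  have e10: "Q 3 3 = - C 2 3" using H[of 0 0 0 1 0 1 0 1 0 0, unfolded unf, simplified] e0 by linarith
  have e11: "C 1 3 = 0" using H[of 0 0 0 1 0 1 1 1 0 0, unfolded unf, simplified] e0 e5 e10 by linarith
  have e12: "Q 2 3 = 0" using H[of 0 0 0 1 1 1 0 1 0 0, unfolded unf, simplified] e0 e3 e9 e10 by
      linarith
  have e13: "S 1 4 = 0" using H[of 0 0 1 1 0 0 "-1" 0 0 0, unfolded unf, simplified] e0 e2 e5 e12 by
      linarith
  have e14: "S 2 4 = 0" using H[of 0 1 0 1 0 1 0 1 0 0, unfolded unf, simplified] e0 e2 e4 e6 e7 e10 e12
      e13 by linarith
  have e15: "Q 4 4 = - C 1 4" using H[of 0 0 0 1 0 1 0 0 0 1, unfolded unf, simplified] e0 e12 e13 by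
      linarith
  have e16: "C 2 4 = 0" using H[of 0 0 1 1 0 1 0 0 0 1, unfolded unf, simplified] e0 e2 e12 e13 e14 e15
      by linarith
  have e17: "Q 3 4 = 0" using H[of 0 0 0 1 0 1 0 0 1 0, unfolded unf, simplified] e0 e11 e12 e13 e16 by
      linarith
  have e18: "C 1 4 = 0" using H[of 0 0 0 1 0 1 1 0 1 0, unfolded unf, simplified] e0 e5 e11 e12 e13 e16
      e17 by linarith
  have e19: "C 2 3 = 0" using H[of 0 0 1 1 0 1 0 0 1 0, unfolded unf, simplified] e0 e2 e11 e12 e13 e14
      e16 e17 by linarith
  have e20: "S 1 3 = 0" using H[of 0 1 0 1 0 1 0 0 0 1, unfolded unf, simplified] e0 e4 e5 e6 e7 e12 e13
      e15 e18 by linarith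
  have e21: "S 2 3 = 0" using H[of 1 0 1 0 0 0 "-1" 0 1 0, unfolded unf, simplified] e0 e1 e2 e5 e6 e8
      e12 e13 e14 e17 e18 e19 e20 by linarith
  have e22: "C 1 1 = - 2 * w - C 3 3 - C 2 2 - C 4 4" using H[of 0 0 1 0 0 0 "-1" 0 0 0, unfolded unf,
      simplified] e2 e5 e14 e20 by linarith
  show ?R
    unfolding determining_D_def by (intro conjI; use e0 e1 e2 e3 e4 e5 e6 e7 e8 e9 e10 e11 e12 e13 e14
        e15 e16 e17 e18 e19 e20 e21 e22 in linarith)
next
  assume R: ?R
  show ?L
  proof (intro allI impI)
    fix h :: "real ^ 4 ^ 4"
    assume t: "transpose h = h" and F: "h $ 1 $ 4 * h $ 2 $ 3 - h $ 1 $ 3 * h $ 2 $ 4 - 1 = 0"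
    note entries = transpose_entries[OF t]
    have "E h 1 4 * h $ 2 $ 3 + h $ 1 $ 4 * E h 2 3 - (E h 1 3 * h $ 2 $ 4 + h $ 1 $ 3 * E h 2 4) =
        (2 * w + C 1 1 + C 2 2 + C 3 3 + C 4 4) * (h $ 1 $ 4 * h $ 2 $ 3 - h $ 1 $ 3 * h $ 2 $ 4 - 1)"
      by (simp add: E_def second_jet_def sum_4 entries sym[of 2 1] sym[of 3 1] sym[of 4 1] sym[of 3 2]
          sym[of 4 2] sym[of 4 3] R[unfolded determining_D_def]) (simp add: algebra_simps)
    then show "E h 1 4 * h $ 2 $ 3 + h $ 1 $ 4 * E h 2 3 - (E h 1 3 * h $ 2 $ 4 + h $ 1 $ 3 * E h 2 4) =
        0" by (simp add: F)
  qed
qed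

text \<open>The relations for \<open>Q 3 3\<close> and \<open>S 3 3\<close> tie the quadratic part
  of f in \<open>pc 3\<close> and \<open>xc 3\<close> to the first derivatives of the field in the
  plane of x1 and x2. They are the origin of the quadratic terms in \<open>III0\<close>.\<close>

definition determining_III ::
  "(4 \<Rightarrow> 4 \<Rightarrow> real) \<Rightarrow> (4 \<Rightarrow> 4 \<Rightarrow> real) \<Rightarrow> (4 \<Rightarrow> 4 \<Rightarrow> real) \<Rightarrow> real \<Rightarrow> bool" where
  "determining_III S C Q w \<longleftrightarrow>
     Q 1 1 = 0 \<and> Q 1 2 = 0 \<and> Q 1 3 = 0 \<and> Q 1 4 = 0 \<and> Q 2 2 = 0 \<and>
     Q 2 3 = 0 \<and> Q 2 4 = 0 \<and> Q 3 4 = 0 \<and> C 4 1 = 0 \<and> C 4 2 = 0 \<and>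
     C 4 3 = 0 \<and> C 3 1 = 0 \<and> C 3 2 = 0 \<and> C 1 4 = 0 \<and> C 2 4 = 0 \<and>
     C 3 4 = 0 \<and> S 1 4 = 0 \<and> S 2 4 = 0 \<and> S 3 4 = 0 \<and>
     Q 3 3 = - C 1 2 \<and> S 3 3 = C 2 1 \<and> S 1 3 = - C 2 3 \<and>
     w = C 2 2 - C 1 1 - 2 * C 3 3"

lemma determining_III_iff:
  fixes S C Q :: "4 \<Rightarrow> 4 \<Rightarrow> real" and w :: real
  defines "E \<equiv> second_jet S C Q w"
  assumes sym: "\<And>i j. Q i j = Q j i"
  shows "(\<forall>h. transpose h = h \<longrightarrow> h $ 2 $ 4 - (h $ 1 $ 4 * h $ 3 $ 3 - h $ 1 $ 3 * h $ 3 $ 4) = 0 \<longrightarrow>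
     E h 2 4 - (E h 1 4 * h $ 3 $ 3 + h $ 1 $ 4 * E h 3 3 - (E h 1 3 * h $ 3 $ 4 + h $ 1 $ 3 * E h 3 4))
         = 0) \<longleftrightarrow>
     determining_III S C Q w"
    (is "?L \<longleftrightarrow> ?R")
proof
  note sym4 = sym[of 2 1] sym[of 3 1] sym[of 4 1] sym[of 3 2] sym[of 4 2] sym[of 4 3]
  assume L: ?L
  note H = spec[OF L, of "symm h11 h12 h13 h14 h22 h23 h24 h33 h34 h44" for h11 h12 h13 h14 h22 h23 h24
      h33 h34 h44,
      THEN mp, OF transpose_symm, THEN mp]
  note unf = E_def second_jet_def sum_4 sym4 symm_nth
  have e0: "S 2 4 = 0" using H[of 0 0 0 0 0 0 0 0 0 0, unfolded unf, simplified] by linarith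
  have e1: "C 4 1 = 0" using H[of 0 1 0 0 0 0 0 0 0 0, unfolded unf, simplified] e0 by linarith
  have e2: "C 4 2 = 0" using H[of 0 0 0 0 1 0 0 0 0 0, unfolded unf, simplified] e0 by linarith
  have e3: "C 4 3 = 0" using H[of 0 0 0 0 0 1 0 0 0 0, unfolded unf, simplified] e0 by linarith
  have e4: "S 1 4 = 0" using H[of 0 0 0 0 0 0 0 1 0 0, unfolded unf, simplified] e0 by linarith
  have e5: "C 2 4 = 0" using H[of 0 0 0 0 0 0 0 0 0 1, unfolded unf, simplified] e0 by linarith
  have e6: "S 3 4 = 0" using H[of 0 0 1 0 0 0 0 0 0 0, unfolded unf, simplified] e0 e1 by linarith
  have e7: "Q 1 4 = 0" using H[of 0 1 0 0 0 0 0 0 0 1, unfolded unf, simplified] e0 e1 e5 by linarith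
  have e8: "Q 2 4 = 0" using H[of 0 0 0 0 1 0 0 0 0 1, unfolded unf, simplified] e0 e2 e5 by linarith
  have e9: "Q 3 4 = 0" using H[of 0 0 0 0 0 1 0 0 0 1, unfolded unf, simplified] e0 e3 e5 by linarith
  have e10: "C 1 4 = 0" using H[of 0 0 0 0 0 0 0 1 0 1, unfolded unf, simplified] e0 e4 e5 by linarith
  have e11: "C 3 4 = 0" using H[of 0 0 1 0 0 0 0 0 0 1, unfolded unf, simplified] e0 e1 e5 e6 e7 by
      linarith
  have e12: "C 2 1 = S 3 3" using H[of 0 0 0 1 0 0 0 0 0 0, unfolded unf, simplified] e0 by linarith
  have e13: "Q 1 1 = 0" using H[of 0 1 0 1 0 0 0 0 0 0, unfolded unf, simplified] e0 e1 e12 by linarith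
  have e14: "Q 1 2 = 0" using H[of 0 0 0 1 1 0 0 0 0 0, unfolded unf, simplified] e0 e2 e12 by linarith
  have e15: "C 3 1 = 0" using H[of 0 0 1 1 0 0 0 0 0 0, unfolded unf, simplified] e0 e1 e6 e12 by
      linarith
  have e16: "C 2 3 = - S 1 3" using H[of 0 0 0 0 0 0 0 0 1 0, unfolded unf, simplified] e0 e10 by
      linarith
  have e17: "Q 2 3 = 0" using H[of 0 0 0 0 1 0 0 0 1 0, unfolded unf, simplified] e0 e2 e10 e16 by
      linarith
  have e18: "Q 3 3 = - C 1 2" using H[of 0 0 0 0 0 1 0 0 1 0, unfolded unf, simplified] e0 e3 e10 e16 by
      linarith
  have e19: "Q 1 3 = - C 3 2" using H[of 0 1 0 0 0 0 0 0 1 0, unfolded unf, simplified] e0 e1 e8 e10 e16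
      by linarith
  have e20: "Q 2 2 = 0" using H[of 0 1 0 0 0 1 0 0 1 0, unfolded unf, simplified] e0 e1 e3 e8 e10 e16 e18
      e19 by linarith
  have e21: "C 3 2 = 0" using H[of 0 0 0 1 0 1 0 0 0 0, unfolded unf, simplified] e0 e3 e12 e19 e20 by
      linarith
  have e22: "C 1 1 = - w + C 2 2 - 2 * C 3 3" using H[of 0 0 0 1 0 0 1 1 0 0, unfolded unf, simplified]
      e0 e4 e12 e18 by linarith
  show ?R
    unfolding determining_III_def by (intro conjI; use e0 e1 e2 e3 e4 e5 e6 e7 e8 e9 e10 e11 e12 e13 e14
        e15 e16 e17 e18 e19 e20 e21 e22 in linarith)
next
  assume R: ?R
  show ?L
  proof (intro allI impI)
    fix h :: "real ^ 4 ^ 4"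
    assume t: "transpose h = h" and F: "h $ 2 $ 4 - (h $ 1 $ 4 * h $ 3 $ 3 - h $ 1 $ 3 * h $ 3 $ 4) = 0"
    note entries = transpose_entries[OF t]
    have F': "h $ 2 $ 4 = h $ 1 $ 4 * h $ 3 $ 3 - h $ 1 $ 3 * h $ 3 $ 4" using F by simp
    show "E h 2 4 - (E h 1 4 * h $ 3 $ 3 + h $ 1 $ 4 * E h 3 3 - (E h 1 3 * h $ 3 $ 4 + h $ 1 $ 3 * E h 3
        4)) = 0"
      by (simp add: E_def second_jet_def sum_4 entries sym[of 2 1] sym[of 3 1] sym[of 4 1] sym[of 3 2]
          sym[of 4 2] sym[of 4 3] R[unfolded determining_III_def])
        (simp add: F' algebra_simps power2_eq_square)
  qed
qed

definition determining_II ::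
  "(4 \<Rightarrow> 4 \<Rightarrow> real) \<Rightarrow> (4 \<Rightarrow> 4 \<Rightarrow> real) \<Rightarrow> (4 \<Rightarrow> 4 \<Rightarrow> real) \<Rightarrow> real \<Rightarrow> bool" where
  "determining_II S C Q w \<longleftrightarrow>
     Q 1 2 = 0 \<and> Q 1 3 = 0 \<and> Q 1 4 = 0 \<and> Q 2 2 = 0 \<and> Q 2 3 = 0 \<and>
     Q 2 4 = 0 \<and> Q 3 3 = 0 \<and> Q 3 4 = 0 \<and> C 1 2 = 0 \<and> C 1 3 = 0 \<and>
     C 1 4 = 0 \<and> C 2 1 = 0 \<and> C 2 4 = 0 \<and> C 3 1 = 0 \<and> C 3 4 = 0 \<and>
     C 4 1 = 0 \<and> C 4 2 = 0 \<and> C 4 3 = 0 \<and> S 1 2 = 0 \<and> S 1 3 = 0 \<and>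
     S 1 4 = 0 \<and> S 2 4 = 0 \<and> S 3 4 = 0 \<and> w = - C 2 2 - C 3 3"

lemma determining_II_iff:
  fixes S C Q :: "4 \<Rightarrow> 4 \<Rightarrow> real" and w :: real
  defines "E \<equiv> second_jet S C Q w"
  assumes sym: "\<And>i j. Q i j = Q j i"
  shows "(\<forall>h. transpose h = h \<longrightarrow> h $ 1 $ 4 - (h $ 1 $ 3 * h $ 2 $ 4 - h $ 1 $ 2 * h $ 3 $ 4) = 0 \<longrightarrow>
     E h 1 4 - (E h 1 3 * h $ 2 $ 4 + h $ 1 $ 3 * E h 2 4 - (E h 1 2 * h $ 3 $ 4 + h $ 1 $ 2 * E h 3 4))
         = 0) \<longleftrightarrow>
     determining_II S C Q w"
    (is "?L \<longleftrightarrow> ?R")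
proof
  note sym4 = sym[of 2 1] sym[of 3 1] sym[of 4 1] sym[of 3 2] sym[of 4 2] sym[of 4 3]
  assume L: ?L
  note H = spec[OF L, of "symm h11 h12 h13 h14 h22 h23 h24 h33 h34 h44" for h11 h12 h13 h14 h22 h23 h24
      h33 h34 h44,
      THEN mp, OF transpose_symm, THEN mp]
  note unf = E_def second_jet_def sum_4 sym4 symm_nth
  have e0: "S 1 4 = 0" using H[of 0 0 0 0 0 0 0 0 0 0, unfolded unf, simplified] by linarith
  have e1: "C 4 1 = 0" using H[of 1 0 0 0 0 0 0 0 0 0, unfolded unf, simplified] e0 by linarith
  have e2: "C 1 4 = 0" using H[of 0 0 0 0 0 0 0 0 0 1, unfolded unf, simplified] e0 by linarith
  have e3: "S 2 4 = 0" using H[of 0 0 1 0 0 1 0 0 0 0, unfolded unf, simplified] e0 by linarith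
  have e4: "C 4 3 = 0" using H[of 0 0 1 0 0 0 0 0 0 0, unfolded unf, simplified] e0 e3 by linarith
  have e5: "S 1 3 = 0" using H[of 0 0 0 0 0 1 1 0 0 0, unfolded unf, simplified] e0 by linarith
  have e6: "C 1 2 = 0" using H[of 0 0 0 0 0 0 1 0 0 0, unfolded unf, simplified] e0 e5 by linarith
  have e7: "Q 1 4 = 0" using H[of 1 0 0 0 0 0 0 0 0 1, unfolded unf, simplified] e0 e1 e2 by linarith
  have e8: "C 4 2 = 0" using H[of 0 0 1 0 1 0 0 0 0 0, unfolded unf, simplified] e0 e3 e4 by linarith
  have e9: "S 3 4 = 0" using H[of 0 1 0 0 0 0 0 0 0 0, unfolded unf, simplified] e0 e8 by linarith
  have e10: "C 1 3 = 0" using H[of 0 0 0 0 0 0 1 1 0 0, unfolded unf, simplified] e0 e5 e6 by linarith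
  have e11: "S 1 2 = 0" using H[of 0 0 0 0 0 0 0 0 1 0, unfolded unf, simplified] e0 e10 by linarith
  have e12: "Q 2 2 = 0" using H[of 0 1 0 0 0 0 1 0 0 0, unfolded unf, simplified] e0 e5 e6 e8 e9 by
      linarith
  have e13: "Q 3 3 = 0" using H[of 0 0 1 0 0 0 0 0 1 0, unfolded unf, simplified] e0 e3 e4 e10 e11 by
      linarith
  have e14: "C 3 1 = 0" using H[of 1 0 0 0 0 1 1 0 0 0, unfolded unf, simplified] e0 e1 e5 by linarith
  have e15: "Q 1 2 = 0" using H[of 1 0 0 0 0 0 1 0 0 0, unfolded unf, simplified] e0 e1 e5 e6 e14 by
      linarith
  have e16: "C 2 4 = 0" using H[of 0 0 1 0 0 1 0 0 0 1, unfolded unf, simplified] e0 e2 e3 by linarith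
  have e17: "Q 3 4 = 0" using H[of 0 0 1 0 0 0 0 0 0 1, unfolded unf, simplified] e0 e2 e3 e4 e16 by
      linarith
  have e18: "Q 1 3 = 0" using H[of 1 0 0 0 0 0 1 1 0 0, unfolded unf, simplified] e0 e1 e5 e6 e10 e14 e15
      by linarith
  have e19: "C 2 1 = 0" using H[of 1 0 0 0 0 0 0 0 1 0, unfolded unf, simplified] e0 e1 e10 e11 e18 by
      linarith
  have e20: "Q 2 4 = 0" using H[of 0 0 1 0 1 0 0 0 0 1, unfolded unf, simplified] e0 e2 e3 e4 e8 e16 e17
      by linarith
  have e21: "C 3 4 = 0" using H[of 0 1 0 0 0 0 0 0 0 1, unfolded unf, simplified] e0 e2 e8 e9 e20 by
      linarith
  have e22: "Q 2 3 = 0" using H[of 0 1 1 0 0 0 1 0 1 0, unfolded unf, simplified] e0 e3 e4 e5 e6 e8 e9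
      e10 e11 e12 e13 by linarith
  have e23: "C 2 2 = - w - C 3 3" using H[of 0 0 1 1 0 0 1 0 0 0, unfolded unf, simplified] e0 e3 e4 e5
      e6 e7 e19 e21 e22 by linarith
  show ?R
    unfolding determining_II_def by (intro conjI; use e0 e1 e2 e3 e4 e5 e6 e7 e8 e9 e10 e11 e12 e13 e14
        e15 e16 e17 e18 e19 e20 e21 e22 e23 in linarith)
next
  assume R: ?R
  show ?L
  proof (intro allI impI)
    fix h :: "real ^ 4 ^ 4"
    assume t: "transpose h = h" and F: "h $ 1 $ 4 - (h $ 1 $ 3 * h $ 2 $ 4 - h $ 1 $ 2 * h $ 3 $ 4) = 0"
    note entries = transpose_entries[OF t]
    have F': "h $ 1 $ 4 = h $ 1 $ 3 * h $ 2 $ 4 - h $ 1 $ 2 * h $ 3 $ 4" using F by simp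
    show "E h 1 4 - (E h 1 3 * h $ 2 $ 4 + h $ 1 $ 3 * E h 2 4 - (E h 1 2 * h $ 3 $ 4 + h $ 1 $ 2 * E h 3
        4)) = 0"
      by (simp add: E_def second_jet_def sum_4 entries sym[of 2 1] sym[of 3 1] sym[of 4 1] sym[of 3 2]
          sym[of 4 2] sym[of 4 3] R[unfolded determining_II_def])
        (simp add: F' algebra_simps power2_eq_square)
  qed
qed

definition determining_I ::
  "(4 \<Rightarrow> 4 \<Rightarrow> real) \<Rightarrow> (4 \<Rightarrow> 4 \<Rightarrow> real) \<Rightarrow> (4 \<Rightarrow> 4 \<Rightarrow> real) \<Rightarrow> real \<Rightarrow> bool" where
  "determining_I S C Q w \<longleftrightarrow>
     Q 1 2 = 0 \<and> Q 1 3 = 0 \<and> Q 1 4 = 0 \<and> Q 2 3 = 0 \<and> Q 2 4 = 0 \<and>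
     Q 3 4 = 0 \<and> C 1 2 = 0 \<and> C 1 3 = 0 \<and> C 1 4 = 0 \<and> C 2 1 = 0 \<and>
     C 2 3 = 0 \<and> C 2 4 = 0 \<and> C 3 1 = 0 \<and> C 3 2 = 0 \<and> C 3 4 = 0 \<and>
     C 4 1 = 0 \<and> C 4 2 = 0 \<and> C 4 3 = 0 \<and> S 1 2 = 0 \<and> S 1 3 = 0 \<and>
     S 1 4 = 0 \<and> S 2 3 = 0 \<and> S 2 4 = 0 \<and> S 3 4 = 0"

lemma determining_I_iff:
  fixes S C Q :: "4 \<Rightarrow> 4 \<Rightarrow> real" and w :: real and \<alpha> \<beta> :: real
  defines "E \<equiv> second_jet S C Q w"
  assumes sym: "\<And>i j. Q i j = Q j i"
    and nz: "\<alpha> \<noteq> 0" "\<beta> \<noteq> 0" "\<alpha> + \<beta> \<noteq> 0"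
  shows "(\<forall>h. transpose h = h \<longrightarrow> \<alpha> * h $ 1 $ 2 * h $ 3 $ 4 + \<beta> * h $ 1 $ 3 * h $ 2 $ 4
     - (\<alpha> + \<beta>) * h $ 1 $ 4 * h $ 2 $ 3 = 0 \<longrightarrow>
     \<alpha> * (E h 1 2 * h $ 3 $ 4 + h $ 1 $ 2 * E h 3 4) + \<beta> * (E h 1 3 * h $ 2 $ 4 + h $ 1 $ 3 * E h 2 4)
     - (\<alpha> + \<beta>) * (E h 1 4 * h $ 2 $ 3 + h $ 1 $ 4 * E h 2 3) = 0) \<longleftrightarrow>
     determining_I S C Q w"
    (is "?L \<longleftrightarrow> ?R")
proof
  note sym4 = sym[of 2 1] sym[of 3 1] sym[of 4 1] sym[of 3 2] sym[of 4 2] sym[of 4 3]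
  assume L: ?L
  note H = spec[OF L, of "symm h11 h12 h13 h14 h22 h23 h24 h33 h34 h44" for h11 h12 h13 h14 h22 h23 h24
      h33 h34 h44,
      THEN mp, OF transpose_symm, THEN mp]
  note unf = E_def second_jet_def sum_4 sym4 symm_nth
  \<comment> \<open>A single off-diagonal entry makes all three products vanish and isolates one
    \<open>S\<close>, with coefficient \<alpha>, \<beta> or their sum up to sign. Adding one
    diagonal entry isolates a \<open>C\<close>, adding two a \<open>Q\<close>.\<close>
  have e0: "S 3 4 = 0" using H[of 0 1 0 0 0 0 0 0 0 0, unfolded unf] nz by simp
  have e1: "S 2 4 = 0" using H[of 0 0 1 0 0 0 0 0 0 0, unfolded unf] nz by simp
  have e2: "S 2 3 = 0" using H[of 0 0 0 1 0 0 0 0 0 0, unfolded unf] nz by simp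
  have e3: "S 1 4 = 0" using H[of 0 0 0 0 0 1 0 0 0 0, unfolded unf] nz by simp
  have e4: "S 1 3 = 0" using H[of 0 0 0 0 0 0 1 0 0 0, unfolded unf] nz by simp
  have e5: "S 1 2 = 0" using H[of 0 0 0 0 0 0 0 0 1 0, unfolded unf] nz by simp
  have e6: "C 4 1 = 0" using H[of 1 0 0 0 0 1 0 0 0 0, unfolded unf] nz e3 by simp
  have e7: "C 3 1 = 0" using H[of 1 0 0 0 0 0 1 0 0 0, unfolded unf] nz e4 by simp
  have e8: "C 2 1 = 0" using H[of 1 0 0 0 0 0 0 0 1 0, unfolded unf] nz e5 by simp
  have e9: "C 4 3 = 0" using H[of 0 1 0 0 0 0 0 1 0 0, unfolded unf] nz e0 by simp
  have e10: "C 3 4 = 0" using H[of 0 1 0 0 0 0 0 0 0 1, unfolded unf] nz e0 by simp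
  have e11: "C 4 2 = 0" using H[of 0 0 1 0 1 0 0 0 0 0, unfolded unf] nz e1 by simp
  have e12: "C 2 4 = 0" using H[of 0 0 1 0 0 0 0 0 0 1, unfolded unf] nz e1 by simp
  have e13: "C 3 2 = 0" using H[of 0 0 0 1 1 0 0 0 0 0, unfolded unf] nz e2 by simp
  have e14: "C 2 3 = 0" using H[of 0 0 0 1 0 0 0 1 0 0, unfolded unf] nz e2 by simp
  have e15: "C 1 2 = 0" using H[of 0 0 0 0 1 0 0 0 1 0, unfolded unf] nz e5 by simp
  have e16: "C 1 4 = 0" using H[of 0 0 0 0 0 1 0 0 0 1, unfolded unf] nz e3 by simp
  have e17: "C 1 3 = 0" using H[of 0 0 0 0 0 0 1 1 0 0, unfolded unf] nz e4 by simp
  have e18: "Q 1 2 = 0" using H[of 1 0 0 0 1 0 0 0 1 0, unfolded unf] nz e5 e8 e15 by simp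
  have e19: "Q 1 4 = 0" using H[of 1 0 0 0 0 1 0 0 0 1, unfolded unf] nz e3 e6 e16 by simp
  have e20: "Q 1 3 = 0" using H[of 1 0 0 0 0 0 1 1 0 0, unfolded unf] nz e4 e7 e17 by simp
  have e21: "Q 3 4 = 0" using H[of 0 1 0 0 0 0 0 1 0 1, unfolded unf] nz e0 e9 e10 by simp
  have e22: "Q 2 4 = 0" using H[of 0 0 1 0 1 0 0 0 0 1, unfolded unf] nz e1 e11 e12 by simp
  have e23: "Q 2 3 = 0" using H[of 0 0 0 1 1 0 0 1 0 0, unfolded unf] nz e2 e13 e14 by simp
  show ?R
    unfolding determining_I_def by (simp add: e0 e1 e2 e3 e4 e5 e6 e7 e8 e9 e10 e11 e12 e13 e14 e15 e16
        e17 e18 e19 e20 e21 e22 e23)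
next
  assume R: ?R
  show ?L
  proof (intro allI impI)
    fix h :: "real ^ 4 ^ 4"
    assume t: "transpose h = h" and F: "\<alpha> * h $ 1 $ 2 * h $ 3 $ 4 + \<beta> * h $ 1 $ 3 * h $ 2 $ 4
     - (\<alpha> + \<beta>) * h $ 1 $ 4 * h $ 2 $ 3 = 0"
    note entries = transpose_entries[OF t]
    \<comment> \<open>Off the hypersurface the condition is a multiple of the equation. The diagonal
      \<open>Q i i\<close> only enter the multiplier and stay free, which is why symmetries of I may
      depend nonlinearly on each momentum.\<close>
    have "\<alpha> * (E h 1 2 * h $ 3 $ 4 + h $ 1 $ 2 * E h 3 4) + \<beta> * (E h 1 3 * h $ 2 $ 4 + h $ 1 $ 3 * E h 2
        4)
     - (\<alpha> + \<beta>) * (E h 1 4 * h $ 2 $ 3 + h $ 1 $ 4 * E h 2 3) =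
        (2 * w + C 1 1 + C 2 2 + C 3 3 + C 4 4 + h $ 1 $ 1 * Q 1 1
        + h $ 2 $ 2 * Q 2 2 + h $ 3 $ 3 * Q 3 3 + h $ 4 $ 4 * Q 4 4) * (\<alpha> * h $ 1 $ 2 * h $ 3 $ 4 + \<beta> * h
            $ 1 $ 3 * h $ 2 $ 4
     - (\<alpha> + \<beta>) * h $ 1 $ 4 * h $ 2 $ 3)"
      by (simp add: E_def second_jet_def sum_4 entries sym[of 2 1] sym[of 3 1] sym[of 4 1] sym[of 3 2]
          sym[of 4 2] sym[of 4 3] R[unfolded determining_I_def]) (simp add: algebra_simps)
    then show "\<alpha> * (E h 1 2 * h $ 3 $ 4 + h $ 1 $ 2 * E h 3 4) + \<beta> * (E h 1 3 * h $ 2 $ 4 + h $ 1 $ 3 * E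
        h 2 4)
     - (\<alpha> + \<beta>) * (E h 1 4 * h $ 2 $ 3 + h $ 1 $ 4 * E h 2 3) = 0" by (simp add: F)
  qed
qed

lemma D2f_second_jet: "D2f f h i j z = second_jet (\<lambda>i j. dx i (dx j f) z) (\<lambda>i k. dx i (DP k f) z)
    (\<lambda>k l. DP k (DP l f) z) (DU f z) h i j"
  by (simp add: D2f_def second_jet_def)

text \<open>The five functions depend on the second derivatives only, so only the \<open>h\<close>
  part of the prolongation contributes; \<open>L h\<close> is the differential at
  \<open>h\<close>.\<close>

lemma cont_iff:
  assumes "\<And>z h. (F has_derivative (\<lambda>v. L h (snd v))) (at (z, h))"
  shows "f \<in> cont F \<longleftrightarrow> smooth f \<and> (\<forall>z h. transpose h = h \<longrightarrow> F (z, h) = 0 \<longrightarrow>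
    L h (snd (prolongation f (z, h))) = 0)"
proof -
  have "frechet_derivative F (at (z, h)) = (\<lambda>v. L h (snd v))" for z h
    using frechet_derivative_at[OF assms] by simp
  then show ?thesis unfolding cont_def equation_def by auto
qed

lemma entry_has_derivative [derivative_intros]:
  "((\<lambda>\<theta> :: jet2. snd \<theta> $ i $ j) has_derivative (\<lambda>v. snd v $ i $ j)) F"
proof -
  have "linear (\<lambda>\<theta> :: jet2. snd \<theta> $ i $ j)" by (auto intro!: linearI)
  then show ?thesis by (simp add: linear_conv_bounded_linear bounded_linear_imp_has_derivative)
qed

lemma cont_eq_N_iff:
  shows "f \<in> cont eq_N \<longleftrightarrow> smooth f \<and> (\<forall>z. determining_N (\<lambda>i j. dx i (dx j f) z)
     (\<lambda>i k. dx i (DP k f) z) (\<lambda>k l. DP k (DP l f) z) (DU f z))"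
proof (cases "smooth f")
  case True
  have eqn: "eq_N = (\<lambda>\<theta>. snd \<theta> $ 2 $ 4 - snd \<theta> $ 1 $ 3 + snd \<theta> $ 1 $ 1 * snd \<theta> $ 2 $ 2 - (snd \<theta> $ 1 $
      2)\<^sup>2)"
    by (auto simp: eq_N_def)
  have deriv: "(eq_N has_derivative (\<lambda>v. (\<lambda>h k. k $ 2 $ 4 - k $ 1 $ 3 + (k $ 1 $ 1 * h $ 2 $ 2 + h $ 1 $
      1 * k $ 2 $ 2) - 2 * h $ 1 $ 2 * k $ 1 $ 2) h (snd v))) (at (z, h))" for z h
    unfolding eqn by (auto intro!: derivative_eq_intros simp: algebra_simps)
  have "DP k (DP l f) z = DP l (DP k f) z" for k l z
    using pd_commute[OF True] by metis
  note det = determining_N_iff[where Q = "\<lambda>k l. DP k (DP l f) z" and S = "\<lambda>i j. dx i (dx j f) z"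
      and C = "\<lambda>i k. dx i (DP k f) z" and w = "DU f z" for z, OF this]
  show ?thesis
    unfolding cont_iff[OF deriv] using True
    by (simp only: prolongation_eq[OF True] D2f_second_jet det eq_N_def prod.case simp_thms)
qed (simp add: cont_def)

lemma cont_eq_D_iff:
  shows "f \<in> cont eq_D \<longleftrightarrow> smooth f \<and> (\<forall>z. determining_D (\<lambda>i j. dx i (dx j f) z)
     (\<lambda>i k. dx i (DP k f) z) (\<lambda>k l. DP k (DP l f) z) (DU f z))"
proof (cases "smooth f")
  case True
  have eqn: "eq_D = (\<lambda>\<theta>. snd \<theta> $ 1 $ 4 * snd \<theta> $ 2 $ 3 - snd \<theta> $ 1 $ 3 * snd \<theta> $ 2 $ 4 - 1)"
    by (auto simp: eq_D_def)
  have deriv: "(eq_D has_derivative (\<lambda>v. (\<lambda>h k. k $ 1 $ 4 * h $ 2 $ 3 + h $ 1 $ 4 * k $ 2 $ 3 - (k $ 1 $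
      3 * h $ 2 $ 4 + h $ 1 $ 3 * k $ 2 $ 4)) h (snd v))) (at (z, h))" for z h
    unfolding eqn by (auto intro!: derivative_eq_intros simp: algebra_simps)
  have "DP k (DP l f) z = DP l (DP k f) z" for k l z
    using pd_commute[OF True] by metis
  note det = determining_D_iff[where Q = "\<lambda>k l. DP k (DP l f) z" and S = "\<lambda>i j. dx i (dx j f) z"
      and C = "\<lambda>i k. dx i (DP k f) z" and w = "DU f z" for z, OF this]
  show ?thesis
    unfolding cont_iff[OF deriv] using True
    by (simp only: prolongation_eq[OF True] D2f_second_jet det eq_D_def prod.case simp_thms)
qed (simp add: cont_def)

lemma cont_eq_III_iff:
  shows "f \<in> cont eq_III \<longleftrightarrow> smooth f \<and> (\<forall>z. determining_III (\<lambda>i j. dx i (dx j f) z)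
     (\<lambda>i k. dx i (DP k f) z) (\<lambda>k l. DP k (DP l f) z) (DU f z))"
proof (cases "smooth f")
  case True
  have eqn: "eq_III = (\<lambda>\<theta>. snd \<theta> $ 2 $ 4 - (snd \<theta> $ 1 $ 4 * snd \<theta> $ 3 $ 3 - snd \<theta> $ 1 $ 3 * snd \<theta> $ 3 $
      4))"
    by (auto simp: eq_III_def)
  have deriv: "(eq_III has_derivative (\<lambda>v. (\<lambda>h k. k $ 2 $ 4 - (k $ 1 $ 4 * h $ 3 $ 3 + h $ 1 $ 4 * k $ 3
      $ 3 - (k $ 1 $ 3 * h $ 3 $ 4 + h $ 1 $ 3 * k $ 3 $ 4))) h (snd v))) (at (z, h))" for z h
    unfolding eqn by (auto intro!: derivative_eq_intros simp: algebra_simps)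
  have "DP k (DP l f) z = DP l (DP k f) z" for k l z
    using pd_commute[OF True] by metis
  note det = determining_III_iff[where Q = "\<lambda>k l. DP k (DP l f) z" and S = "\<lambda>i j. dx i (dx j f) z"
      and C = "\<lambda>i k. dx i (DP k f) z" and w = "DU f z" for z, OF this]
  show ?thesis
    unfolding cont_iff[OF deriv] using True
    by (simp only: prolongation_eq[OF True] D2f_second_jet det eq_III_def prod.case simp_thms)
qed (simp add: cont_def)

lemma cont_eq_II_iff:
  shows "f \<in> cont eq_II \<longleftrightarrow> smooth f \<and> (\<forall>z. determining_II (\<lambda>i j. dx i (dx j f) z)
     (\<lambda>i k. dx i (DP k f) z) (\<lambda>k l. DP k (DP l f) z) (DU f z))"
proof (cases "smooth f")
  case True
  have eqn: "eq_II = (\<lambda>\<theta>. snd \<theta> $ 1 $ 4 - (snd \<theta> $ 1 $ 3 * snd \<theta> $ 2 $ 4 - snd \<theta> $ 1 $ 2 * snd \<theta> $ 3 $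
      4))"
    by (auto simp: eq_II_def)
  have deriv: "(eq_II has_derivative (\<lambda>v. (\<lambda>h k. k $ 1 $ 4 - (k $ 1 $ 3 * h $ 2 $ 4 + h $ 1 $ 3 * k $ 2 $
      4 - (k $ 1 $ 2 * h $ 3 $ 4 + h $ 1 $ 2 * k $ 3 $ 4))) h (snd v))) (at (z, h))" for z h
    unfolding eqn by (auto intro!: derivative_eq_intros simp: algebra_simps)
  have "DP k (DP l f) z = DP l (DP k f) z" for k l z
    using pd_commute[OF True] by metis
  note det = determining_II_iff[where Q = "\<lambda>k l. DP k (DP l f) z" and S = "\<lambda>i j. dx i (dx j f) z"
      and C = "\<lambda>i k. dx i (DP k f) z" and w = "DU f z" for z, OF this]
  show ?thesis
    unfolding cont_iff[OF deriv] using True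
    by (simp only: prolongation_eq[OF True] D2f_second_jet det eq_II_def prod.case simp_thms)
qed (simp add: cont_def)

lemma cont_eq_I_iff:
  assumes nz: "\<alpha> \<noteq> 0" "\<beta> \<noteq> 0" "\<alpha> + \<beta> \<noteq> 0"
  shows "f \<in> cont (eq_I \<alpha> \<beta>) \<longleftrightarrow> smooth f \<and> (\<forall>z. determining_I (\<lambda>i j. dx i (dx j f) z)
     (\<lambda>i k. dx i (DP k f) z) (\<lambda>k l. DP k (DP l f) z) (DU f z))"
proof (cases "smooth f")
  case True
  have eqn: "eq_I \<alpha> \<beta> = (\<lambda>\<theta>. \<alpha> * snd \<theta> $ 1 $ 2 * snd \<theta> $ 3 $ 4 + \<beta> * snd \<theta> $ 1 $ 3 * snd \<theta> $ 2 $ 4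
     - (\<alpha> + \<beta>) * snd \<theta> $ 1 $ 4 * snd \<theta> $ 2 $ 3)"
    by (auto simp: eq_I_def)
  have deriv: "(eq_I \<alpha> \<beta> has_derivative (\<lambda>v. (\<lambda>h k. \<alpha> * (k $ 1 $ 2 * h $ 3 $ 4 + h $ 1 $ 2 * k $ 3 $ 4) +
      \<beta> * (k $ 1 $ 3 * h $ 2 $ 4 + h $ 1 $ 3 * k $ 2 $ 4)
     - (\<alpha> + \<beta>) * (k $ 1 $ 4 * h $ 2 $ 3 + h $ 1 $ 4 * k $ 2 $ 3)) h (snd v))) (at (z, h))" for z h
    unfolding eqn by (auto intro!: derivative_eq_intros simp: algebra_simps)
  have "DP k (DP l f) z = DP l (DP k f) z" for k l z
    using pd_commute[OF True] by metis
  note det = determining_I_iff[where Q = "\<lambda>k l. DP k (DP l f) z" and S = "\<lambda>i j. dx i (dx j f) z"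
      and C = "\<lambda>i k. dx i (DP k f) z" and w = "DU f z" for z, OF this nz]
  show ?thesis
    unfolding cont_iff[OF deriv] using True
    by (simp only: prolongation_eq[OF True] D2f_second_jet det eq_I_def prod.case simp_thms)
qed (simp add: cont_def)

section \<open>Separation of variables\<close>

lemma Basis_jet_explicit:
  "(Basis :: jet1 set) = {ex 1, ex 2, ex 3, ex 4, eu, ep 1, ep 2, ep 3, ep 4}"
  by (auto simp: Basis_jet UNIV_4)

lemma jet_basis_eq_iff [simp]:
  "ex i = ex j \<longleftrightarrow> i = j" "ep i = ep j \<longleftrightarrow> i = j" "ex i \<noteq> ep j" "ep j \<noteq> ex i"
  "ex i \<noteq> eu" "eu \<noteq> ex i" "ep i \<noteq> eu" "eu \<noteq> ep i"
  by (auto simp: ex_def eu_def ep_def axis_eq_axis)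

lemma jet_basis_mem [simp]: "ex i \<in> Basis" "ep i \<in> Basis" "eu \<in> Basis"
  by (auto simp: Basis_jet)

lemma pd_ex_dx: "smooth f \<Longrightarrow> DX i (dx j f) = dx j (DX i f)"
  unfolding dx_def by (auto simp: fun_eq_iff pd_commute[of f "ex i" "ex j"] pd_commute[of f "ex i" eu])

lemma pd_eu_dx: "smooth f \<Longrightarrow> DU (dx j f) = dx j (DU f)"
  unfolding dx_def by (auto simp: fun_eq_iff pd_commute[of f eu "ex j"])

lemma dx_commute: "smooth f \<Longrightarrow> dx i (dx j f) = dx j (dx i f)"
  by (simp add: dx_def[of i] dx_def[of j "\<lambda>z. DX i f z + pc i z * DU f z"] pd_ex_dx pd_eu_dx)
    (simp add: dx_def algebra_simps)

lemma dx_normal: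
  assumes "smooth f"
  shows "dx 2 (dx 1 f) = dx 1 (dx 2 f)" "dx 3 (dx 1 f) = dx 1 (dx 3 f)" "dx 4 (dx 1 f) = dx 1 (dx 4 f)"
    "dx 3 (dx 2 f) = dx 2 (dx 3 f)" "dx 4 (dx 2 f) = dx 2 (dx 4 f)" "dx 4 (dx 3 f) = dx 3 (dx 4 f)"
  by (rule dx_commute[OF assms])+

lemma dx_eq_pd: "DU f = (\<lambda>z. 0) \<Longrightarrow> dx i f = DX i f"
  by (simp add: dx_def)

lemma pd_normal:
  assumes "smooth f"
  shows "DP k (DX i f) = DX i (DP k f)"
    "DU (pd b f) = pd b (DU f)"
    "DX 2 (DX 1 f) = DX 1 (DX 2 f)" "DX 3 (DX 1 f) = DX 1 (DX 3 f)"
    "DX 4 (DX 1 f) = DX 1 (DX 4 f)" "DX 3 (DX 2 f) = DX 2 (DX 3 f)"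
    "DX 4 (DX 2 f) = DX 2 (DX 4 f)" "DX 4 (DX 3 f) = DX 3 (DX 4 f)"
    "DP 2 (DP 1 f) = DP 1 (DP 2 f)" "DP 3 (DP 1 f) = DP 1 (DP 3 f)"
    "DP 4 (DP 1 f) = DP 1 (DP 4 f)" "DP 3 (DP 2 f) = DP 2 (DP 3 f)"
    "DP 4 (DP 2 f) = DP 2 (DP 4 f)" "DP 4 (DP 3 f) = DP 3 (DP 4 f)"
  by (rule pd_commute[OF assms])+

text \<open>In the commutator \<open>pd_ep_dx\<close> with equal indices both other terms
  vanish.\<close>

lemma dx_zero_imp_pd_eu:
  assumes "smooth f" "dx i f = (\<lambda>z. 0)" "dx i (DP i f) = (\<lambda>z. 0)"
  shows "DU f = (\<lambda>z. 0)"
  using pd_ep_dx[OF assms(1), of i i] assms(2,3) by (simp add: fun_eq_iff)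

text \<open>This turns total derivatives into plain partial derivatives: once
  \<open>c * uc z\<close> is split off, nothing depends on u. Its contribution
  \<open>c * pc j z\<close> to \<open>dx j f\<close> is annihilated by the next
  \<open>dx i\<close>.\<close>

lemma reduce_u:
  assumes f: "smooth f" and fk: "\<forall>k. DU (DP k f) = (\<lambda>z. 0)"
    and fi: "\<forall>i. dx i (DU f) = (\<lambda>z. 0)"
  obtains c g where "smooth g" "f = (\<lambda>z. g z + c * uc z)" "DU f = (\<lambda>z. c)"
    "DU g = (\<lambda>z. 0)" "\<forall>k. DP k f = DP k g"
    "\<forall>i j. dx i (dx j f) = DX i (DX j g)"
    "\<forall>i k. dx i (DP k f) = DX i (DP k g)"
proof -
  define h where "h = DU f"
  have h: "smooth h" unfolding h_def using f by simp
  have hp: "DP k h = (\<lambda>z. 0)" for k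
    unfolding h_def using fk pd_commute[OF f] by simp
  have hu: "DU h = (\<lambda>z. 0)"
    \<comment> \<open>\<open>dx 1 h\<close> vanishes by \<open>fi\<close> and
      \<open>dx 1 (DP 1 h)\<close> by \<open>hp\<close>. Only then does \<open>dx i h = 0\<close>
      say that \<open>DX i h = 0\<close>.\<close>
    by (rule dx_zero_imp_pd_eu[OF h, of 1]) (use fi in \<open>simp_all add: hp flip: h_def\<close>)
  have hx: "DX i h = (\<lambda>z. 0)" for i
    using fi hu by (simp add: dx_eq_pd flip: h_def)
  have "pd b h = (\<lambda>z. 0)" if "b \<in> Basis" for b
    using that hp hu hx by (auto simp: Basis_jet)
  then have hc: "h = (\<lambda>z. h 0)" using all_partials_zero_const[OF h] by blast
  define c where "c = h 0"
  define g where "g = (\<lambda>z. f z - c * uc z)"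
  have g: "smooth g" unfolding g_def using f by simp
  have fg: "f = (\<lambda>z. g z + c * uc z)" by (simp add: g_def)
  have fu: "DU f = (\<lambda>z. c)" using hc by (simp add: h_def c_def)
  have gu: "DU g = (\<lambda>z. 0)" unfolding g_def using f fu by simp
  have fp: "DP k f = DP k g" for k unfolding g_def using f by simp
  have fx: "dx j f = (\<lambda>z. DX j g z + c * pc j z)" for j
    unfolding dx_def fu unfolding fg using g by (simp add: algebra_simps)
  have gxu: "DU (pd b g) = (\<lambda>z. 0)" for b using pd_commute[OF g, of eu] gu by simp
  have "dx i (\<lambda>z. pc j z) = (\<lambda>z. 0)" for i j by (simp add: dx_def)
  then have 1: "dx i (dx j f) = DX i (DX j g)" for i j
    using g by (simp add: fx dx_eq_pd gxu)
  have 2: "dx i (DP k f) = DX i (DP k g)" for i k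
    by (simp add: fp dx_eq_pd gxu)
  show ?thesis using that[OF g fg fu gu] fp 1 2 by blast
qed

text \<open>\<open>a\<close> is g restricted to the span of \<open>V\<close> and extended constantly
  in the other basis directions. Vanishing mixed derivatives say that \<open>pd v g\<close> with v
  in \<open>V\<close> is unchanged by this extension, so that the remainder \<open>b\<close> is
  constant along \<open>V\<close>.\<close>

lemma split_smooth:
  fixes g :: "'a::euclidean_space \<Rightarrow> real"
  assumes g: "smooth g" and V: "V \<subseteq> Basis"
    and mixed: "\<forall>v\<in>V. \<forall>w\<in>Basis - V. pd v (pd w g) = (\<lambda>z. 0)"
  obtains a b where "smooth a" "smooth b" "g = (\<lambda>z. a z + b z)"
    "\<forall>w\<in>Basis - V. pd w a = (\<lambda>z. 0) \<and> pd w b = pd w g"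
    "\<forall>v\<in>V. pd v b = (\<lambda>z. 0) \<and> pd v a = pd v g"
proof -
  have finV: "finite V" using V by (rule finite_subset) simp
  define \<pi> where "\<pi> z = (\<Sum>b\<in>V. (z \<bullet> b) *\<^sub>R b)" for z :: 'a
  have lin: "linear \<pi>"
    unfolding \<pi>_def
    by (rule linearI) (simp_all add: inner_add_left scaleR_add_left sum.distrib scaleR_sum_right)
  have \<pi>V: "\<pi> v = v" if "v \<in> V" for v
  proof -
    have "\<pi> v = (\<Sum>b\<in>V. if b = v then v else 0)"
      unfolding \<pi>_def using that V by (intro sum.cong) (auto simp: inner_Basis subset_iff)
    then show ?thesis using that finV by simp
  qed
  have \<pi>W: "\<pi> w = 0" if "w \<in> Basis" "w \<notin> V" for w
    unfolding \<pi>_def using that V by (intro sum.neutral) (auto simp: inner_Basis subset_iff)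
  have span: "z - \<pi> z \<in> span (Basis - V)" for z
  proof -
    have "z = (\<Sum>b\<in>Basis. (z \<bullet> b) *\<^sub>R b)" by (simp add: euclidean_representation)
    also have "\<dots> = (\<Sum>b\<in>Basis - V. (z \<bullet> b) *\<^sub>R b) + \<pi> z"
      unfolding \<pi>_def using V by (simp add: sum.subset_diff)
    finally have "z - \<pi> z = (\<Sum>b\<in>Basis - V. (z \<bullet> b) *\<^sub>R b)" by (simp add: algebra_simps)
    then show ?thesis by (simp only:) (intro span_sum span_scale span_base)
  qed
  define a where "a = (\<lambda>z. g (\<pi> z))"
  define b where "b = (\<lambda>z. g z - a z)"
  have a: "smooth a" unfolding a_def by (rule smooth_linear_comp[OF g lin])
  have b: "smooth b" unfolding b_def using a g by simp
  have ab: "g = (\<lambda>z. a z + b z)" by (simp add: b_def)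
  have pda: "pd v a = (\<lambda>z. pd (\<pi> v) g (\<pi> z))" for v
    unfolding a_def by (rule pd_linear_comp[OF g lin])
  have 1: "pd w a = (\<lambda>z. 0)" if "w \<in> Basis" "w \<notin> V" for w
    using pd_scaleR_dir[OF g, of 0 0] by (simp add: pda \<pi>W that)
  have 2: "pd v b = (\<lambda>z. 0)" if "v \<in> V" for v
  proof
    fix z
    have "pd v g z = pd v g (\<pi> z)"
    proof (rule constant_directions[OF _ _ span])
      show "pd w (pd v g) = (\<lambda>z. 0)" if "w \<in> Basis - V" for w
        using mixed \<open>v \<in> V\<close> that pd_commute[OF g, of w v] by simp
    qed (use g in simp)
    then show "pd v b z = 0" unfolding b_def using a g by (simp add: pda \<pi>V that)
  qed
  have 3: "pd v a = pd v g" if "v \<in> V" for v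
    using fun_cong[OF 2[OF that]] a g by (simp add: b_def fun_eq_iff)
  have 4: "pd w b = pd w g" if "w \<in> Basis" "w \<notin> V" for w
    using 1[OF that] a g by (simp add: b_def)
  show ?thesis by (rule that[OF a b ab]) (auto simp: 1 2 3 4)
qed

lemma pull_at:
  "v \<bullet> v = 1 \<Longrightarrow> w \<bullet> w = 1 \<Longrightarrow> v \<bullet> w = 0 \<Longrightarrow> pull v w F (fst y *\<^sub>R v + snd y *\<^sub>R w) = F y"
  by (simp add: pull_def inner_simps inner_commute[of w v])

text \<open>The generating function of the Hamiltonian field of \<open>A(x\<^sup>i, x\<^sup>j)\<close>.\<close>

definition ham :: "4 \<Rightarrow> 4 \<Rightarrow> (real \<times> real \<Rightarrow> real) \<Rightarrow> jet1 \<Rightarrow> real" where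
  "ham i j A = (\<lambda>z. pullx i j (D2 A) z * pc i z - pullx i j (D1 A) z * pc j z)"

lemma jet_plane_potential:
  assumes "smooth a" "smooth b" and ij: "i \<noteq> j"
    and "\<forall>v\<in>Basis. v = ex i \<or> v = ex j \<or> pd v a = (\<lambda>z. 0)"
    and "\<forall>v\<in>Basis. v = ex i \<or> v = ex j \<or> pd v b = (\<lambda>z. 0)"
    and div: "\<forall>z. DX i a z + DX j b z = 0"
  shows "\<exists>A. smooth A \<and> pullx i j (D2 A) = a \<and> pullx i j (D1 A) = (\<lambda>z. - b z)"
proof -
  have neq: "ex i \<noteq> ex j" using ij by simp
  obtain a' where a': "smooth a'" "a = pullx i j a'"
    using factor_pull[OF assms(1) jet_basis_mem(1) jet_basis_mem(1) neq assms(4)] by blast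
  obtain b' where b': "smooth b'" "b = pullx i j b'"
    using factor_pull[OF assms(2) jet_basis_mem(1) jet_basis_mem(1) neq assms(5)] by blast
  have "D1 a' y + D2 b' y = 0" for y
  proof -
    have "pullx i j (D1 a') z + pullx i j (D2 b') z = 0" for z
      using div[rule_format, of z] a' b' ij by simp
    from this[of "fst y *\<^sub>R ex i + snd y *\<^sub>R ex j"] show ?thesis
      using ij by (simp add: pull_at)
  qed
  then obtain A where A: "smooth A" "D2 A = a'" "D1 A = (\<lambda>z. - b' z)"
    using plane_potential[OF a'(1) b'(1)] by blast
  show ?thesis by (rule exI[of _ A]) (simp add: A a' b' pull_def)
qed

text \<open>h is affine in the two momenta, with coefficients depending on two positions. The
  constant divergence m is put entirely into the term with \<open>xc i z * pc i z\<close>; what is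
  left of the linear part is divergence-free, hence Hamiltonian.\<close>

lemma block:
  assumes h: "smooth h" and ij: "i \<noteq> j"
    and h0: "\<forall>b\<in>Basis. b \<in> {ex i, ex j, ep i, ep j} \<or> pd b h = (\<lambda>z. 0)"
    and lin: "DP i (DP i h) = (\<lambda>z. 0)" "DP i (DP j h) = (\<lambda>z. 0)"
      "DP j (DP j h) = (\<lambda>z. 0)"
    and div: "\<forall>z. DX i (DP i h) z + DX j (DP j h) z = m"
  shows "\<exists>A K. smooth A \<and> smooth K \<and>
    h = (\<lambda>z. ham i j A z + pullx i j K z + m * xc i z * pc i z)"
proof -
  define a where "a = (\<lambda>z. DP i h z - m * xc i z)"
  define b where "b = DP j h"
  have ab: "smooth a" "smooth b" unfolding a_def b_def using h by simp_all
  have lin': "DP j (DP i h) = (\<lambda>z. 0)" using lin(2) pd_commute[OF h] by simp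
  have h00: "pd b (pd v h) = (\<lambda>z. 0)" if "b \<in> Basis" "b \<notin> {ex i, ex j, ep i, ep j}" for b v
    using h0 that pd_commute[OF h, of b v] by auto
  have inner: "b \<bullet> ex i = 0" if "b \<in> Basis" "b \<noteq> ex i" for b
    using that by (simp add: inner_Basis)
  have "pd v a = (\<lambda>z. 0)" if "v \<in> Basis" "v \<noteq> ex i" "v \<noteq> ex j" for v
    unfolding a_def using that h lin lin' h00[of v] inner[of v]
    by (cases "v = ep i \<or> v = ep j") auto
  then have a0: "\<forall>v\<in>Basis. v = ex i \<or> v = ex j \<or> pd v a = (\<lambda>z. 0)" by blast
  have "pd v b = (\<lambda>z. 0)" if "v \<in> Basis" "v \<noteq> ex i" "v \<noteq> ex j" for v
    unfolding b_def using that h lin lin' h00[of v]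
    by (cases "v = ep i \<or> v = ep j") auto
  then have b0: "\<forall>v\<in>Basis. v = ex i \<or> v = ex j \<or> pd v b = (\<lambda>z. 0)" by blast
  have "DX i a z + DX j b z = 0" for z
    unfolding a_def b_def using div[rule_format, of z] h by simp
  then have "\<forall>z. DX i a z + DX j b z = 0" by blast
  then obtain A where A: "smooth A" "pullx i j (D2 A) = a" "pullx i j (D1 A) = (\<lambda>z. - b z)"
    using jet_plane_potential[OF ab ij a0 b0] by blast
  define k where "k = (\<lambda>z. h z - ham i j A z - m * xc i z * pc i z)"
  \<comment> \<open>In this form k is h without its part linear in the momenta, so its momentum
    derivatives vanish.\<close>
  have k_eq: "k = (\<lambda>z. h z - pc i z * DP i h z - pc j z * DP j h z)"
    unfolding k_def ham_def A(2,3) by (simp add: a_def b_def fun_eq_iff algebra_simps)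
  have k: "smooth k" unfolding k_eq using h by simp
  have "pd v k = (\<lambda>z. 0)" if "v \<in> Basis" "v \<noteq> ex i" "v \<noteq> ex j" for v
  proof (cases "v = ep i \<or> v = ep j")
    case True
    then show ?thesis unfolding k_eq using h lin lin' ij by auto
  next
    case False
    then have "v \<bullet> ep i = 0" "v \<bullet> ep j = 0" using that by (simp_all add: inner_Basis)
    with False show ?thesis unfolding k_eq using that h h0 h00[of v] by auto
  qed
  then have k0: "\<forall>v\<in>Basis. v = ex i \<or> v = ex j \<or> pd v k = (\<lambda>z. 0)" by blast
  have "ex i \<noteq> ex j" using ij by simp
  from factor_pull[OF k jet_basis_mem(1) jet_basis_mem(1) this k0]
  obtain K where K: "smooth K" "k = pullx i j K" by blast
  have "h = (\<lambda>z. ham i j A z + pullx i j K z + m * xc i z * pc i z)"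
    by (simp add: fun_eq_iff flip: K(2)) (simp add: k_def)
  with A(1) K(1) show ?thesis by blast
qed

section \<open>Extensions of graded sums\<close>

lemma jacobi_antisym:
  "smooth f \<Longrightarrow> smooth g \<Longrightarrow> jacobi_bracket g f = (\<lambda>z. - jacobi_bracket f g z)"
  by (simp add: jacobi_bracket_eq sum_4 fun_eq_iff algebra_simps)

lemma jacobi_add_left:
  "smooth f \<Longrightarrow> smooth f' \<Longrightarrow> smooth g \<Longrightarrow>
   jacobi_bracket (\<lambda>z. f z + f' z) g = (\<lambda>z. jacobi_bracket f g z + jacobi_bracket f' g z)"
  by (simp add: jacobi_bracket_eq sum_4 fun_eq_iff algebra_simps)

lemma jacobi_add_right:
  "smooth f \<Longrightarrow> smooth f' \<Longrightarrow> smooth g \<Longrightarrow>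
   jacobi_bracket g (\<lambda>z. f z + f' z) = (\<lambda>z. jacobi_bracket g f z + jacobi_bracket g f' z)"
  by (simp add: jacobi_bracket_eq sum_4 fun_eq_iff algebra_simps)

lemma jacobi_cmult_left:
  "smooth f \<Longrightarrow> smooth g \<Longrightarrow> jacobi_bracket (\<lambda>z. c * f z) g = (\<lambda>z. c * jacobi_bracket f g z)"
  by (simp add: jacobi_bracket_eq sum_4 fun_eq_iff algebra_simps)

lemma poisson_eq: "poisson A B = (\<lambda>z. D1 A z * D2 B z - D2 A z * D1 B z)"
  by (simp add: poisson_def pd_def)

lemma smooth_poisson [simp, intro]: "smooth A \<Longrightarrow> smooth B \<Longrightarrow> smooth (poisson A B)"
  by (simp add: poisson_eq)

lemma poisson_zero [simp]: "poisson (\<lambda>z. 0) B = (\<lambda>z. 0)" "poisson B (\<lambda>z. 0) = (\<lambda>z. 0)"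
  by (simp_all add: poisson_eq)

lemma zero_fun_eq: "(0 :: 'a \<Rightarrow> real) = (\<lambda>z. 0)"
  by (simp add: fun_eq_iff)

lemma graded_sum_smooth: "A \<in> graded_sum ms \<Longrightarrow> smooth (A b i)"
  by (cases "(b, i) \<in> pieces ms") (auto simp: graded_sum_def zero_fun_eq)

lemma subspace_graded_sum: "subspace (graded_sum ms)"
  unfolding subspace_def graded_sum_def
  by (auto simp: plus_fun_def scaleR_fun_def zero_fun_def)

lemma sum_fun_eq: "(\<Sum>i\<in>I. (f i :: 'a \<Rightarrow> real)) = (\<lambda>z. \<Sum>i\<in>I. f i z)"
  by (induction I rule: infinite_finite_induct) (auto simp: fun_eq_iff)

lemma graded_bracket_closed:
  assumes "A \<in> graded_sum ms" "B \<in> graded_sum ms" shows "graded_bracket ms A B \<in> graded_sum ms"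
proof -
  have "smooth (\<lambda>z. \<Sum>i\<le>k. poisson (A b i) (B b (k - i)) z)" for b k
    using graded_sum_smooth[OF assms(1)] graded_sum_smooth[OF assms(2)] by simp
  then show ?thesis
    unfolding graded_bracket_def graded_sum_def by (auto simp: sum_fun_eq)
qed

text \<open>The bracket with the function \<open>q\<close> in the piece of grading 0 of every branch is \<open>\<partial>/\<partial>p\<close>.\<close>

lemma graded_sum_perfect:
  assumes "A \<in> graded_sum ms"
  obtains P B where "P \<in> graded_sum ms" "B \<in> graded_sum ms" "A = graded_bracket ms P B"
proof -
  define P where "P b i = (if (b, i) \<in> pieces ms \<and> i = 0 then fst else (\<lambda>z :: real \<times> real. 0 :: real))"
    for b i
  define B where "B b i = (if (b, i) \<in> pieces ms then antiderivative (A b i) else 0)" for b i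
  have P: "P \<in> graded_sum ms" unfolding graded_sum_def P_def by (auto simp: zero_fun_eq)
  have B: "B \<in> graded_sum ms"
    using graded_sum_smooth[OF assms] unfolding graded_sum_def B_def by auto
  have "(\<Sum>i\<le>k. poisson (P b i) (B b (k - i))) = A b k" if bk: "(b, k) \<in> pieces ms" for b k
  proof -
    have "(\<Sum>i\<le>k. poisson (P b i) (B b (k - i))) = (\<Sum>i\<le>k. if i = 0 then A b k else 0)"
    proof (rule sum.cong)
      fix i
      have "poisson (P b 0) (B b k) = A b k"
        using bk graded_sum_smooth[OF assms] unfolding P_def B_def
        by (simp add: pieces_def poisson_eq D2_antiderivative)
      then show "poisson (P b i) (B b (k - i)) = (if i = 0 then A b k else 0)"
        by (cases "i = 0") (auto simp: P_def zero_fun_eq)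
    qed simp
    then show ?thesis by simp
  qed
  moreover have "A b k = 0" if "(b, k) \<notin> pieces ms" for b k
    using assms that by (auto simp: graded_sum_def)
  ultimately have "A = graded_bracket ms P B"
    unfolding graded_bracket_def by (auto simp: fun_eq_iff)
  with P B show ?thesis by (rule that)
qed

lemma derived_algebra_mono: "L \<subseteq> L' \<Longrightarrow> derived_algebra br L \<subseteq> derived_algebra br L'"
  unfolding derived_algebra_def by (intro span_mono) auto

lemma derived_algebra_subset:
  "subspace S \<Longrightarrow> (\<And>x y. x \<in> L \<Longrightarrow> y \<in> L \<Longrightarrow> br x y \<in> S) \<Longrightarrow> derived_algebra br L \<subseteq> S"
  unfolding derived_algebra_def by (intro span_minimal) auto

text \<open>These data yield all that the theorem asserts about one equation. The image of
  \<open>\<Phi>\<close> is an ideal, and \<open>E\<close> embeds the quotient as a complementary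
  subalgebra, so the extension is split.\<close>

locale symmetry_structure =
  fixes ms :: "nat list" and \<Phi> :: "(nat \<Rightarrow> nat \<Rightarrow> real \<times> real \<Rightarrow> real) \<Rightarrow> jet1 \<Rightarrow> real"
    and E :: "'b::euclidean_space \<Rightarrow> jet1 \<Rightarrow> real" and br :: "'b \<Rightarrow> 'b \<Rightarrow> 'b"
    and G :: "(jet1 \<Rightarrow> real) set"
  assumes \<Phi>_smooth: "A \<in> graded_sum ms \<Longrightarrow> smooth (\<Phi> A)"
    and \<Phi>_add: "A \<in> graded_sum ms \<Longrightarrow> B \<in> graded_sum ms \<Longrightarrow> \<Phi> (A + B) = \<Phi> A + \<Phi> B"
    and \<Phi>_scale: "A \<in> graded_sum ms \<Longrightarrow> \<Phi> (c *\<^sub>R A) = c *\<^sub>R \<Phi> A"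
    and \<Phi>_bracket: "A \<in> graded_sum ms \<Longrightarrow> B \<in> graded_sum ms \<Longrightarrow>
      jacobi_bracket (\<Phi> A) (\<Phi> B) = \<Phi> (graded_bracket ms A B)"
    and \<Phi>_kernel: "A \<in> graded_sum ms \<Longrightarrow> \<Phi> A = (\<lambda>z. 0) \<longleftrightarrow> A \<in> constant_relations ms"
    and E_smooth: "smooth (E a)"
    and E_linear: "linear E"
    and E_bracket: "jacobi_bracket (E a) (E b) = E (br a b)"
    and E_\<Phi>: "A \<in> graded_sum ms \<Longrightarrow> \<exists>B\<in>graded_sum ms. jacobi_bracket (E a) (\<Phi> A) = \<Phi> B"
    and G_eq: "f \<in> G \<longleftrightarrow> (\<exists>a. \<exists>A\<in>graded_sum ms. f = (\<lambda>z. E a z + \<Phi> A z))"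
    and indep: "A \<in> graded_sum ms \<Longrightarrow> E a = \<Phi> A \<Longrightarrow> a = 0"
begin

definition "S = \<Phi> ` graded_sum ms"

lemma G_eq': "f \<in> G \<longleftrightarrow> (\<exists>a. \<exists>s\<in>S. f = E a + s)"
  unfolding G_eq S_def by (auto simp: plus_fun_def)

lemma subspace_S: "subspace S"
proof -
  note gs = subspace_graded_sum[of ms]
  have "0 = \<Phi> 0" using \<Phi>_scale[OF subspace_0[OF gs], of 0] by simp
  then show ?thesis
    unfolding S_def subspace_def
    using \<Phi>_add \<Phi>_scale subspace_add[OF gs] subspace_scale[OF gs] subspace_0[OF gs]
    by (auto simp flip: \<Phi>_add \<Phi>_scale intro!: imageI)
qed

lemma is_graded_sum_S: "is_graded_sum ms S"
proof -
  have "{A \<in> graded_sum ms. \<Phi> A = 0} = constant_relations ms"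
    using \<Phi>_kernel by (auto simp: zero_fun_eq constant_relations_def)
  then show ?thesis
    unfolding is_graded_sum_def lie_hom_on_def S_def
    using \<Phi>_add \<Phi>_bracket \<Phi>_scale by (intro exI[of _ \<Phi>]) auto
qed

text \<open>Of the four terms of the expanded bracket only the one of \<open>E a\<close> with
  \<open>E b\<close> leaves \<open>S\<close>.\<close>

lemma bracket_G:
  assumes "s \<in> S" "t \<in> S"
  shows "\<exists>r\<in>S. jacobi_bracket (E a + s) (E b + t) = E (br a b) + r"
proof -
  obtain A B where A: "A \<in> graded_sum ms" "s = \<Phi> A" and B: "B \<in> graded_sum ms" "t = \<Phi> B"
    using assms by (auto simp: S_def)
  obtain A' where A': "A' \<in> graded_sum ms" "jacobi_bracket (E b) s = \<Phi> A'" using E_\<Phi>[OF A(1)] A by metis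
  obtain B' where B': "B' \<in> graded_sum ms" "jacobi_bracket (E a) t = \<Phi> B'" using E_\<Phi>[OF B(1)] B by metis
  have s: "smooth s" "smooth t" using A B \<Phi>_smooth by auto
  have "jacobi_bracket (E a + s) (E b + t) = jacobi_bracket (E a) (E b) + jacobi_bracket (E a) t
      + (jacobi_bracket s (E b) + jacobi_bracket s t)"
    using s by (simp add: plus_fun_def jacobi_add_left jacobi_add_right E_smooth add_ac)
  also have "jacobi_bracket s (E b) = - \<Phi> A'"
    using jacobi_antisym[OF E_smooth s(1), of b] A' by (simp add: fun_eq_iff)
  also have "jacobi_bracket s t = \<Phi> (graded_bracket ms A B)" using A B by (simp add: \<Phi>_bracket)
  finally have "jacobi_bracket (E a + s) (E b + t) =
      E (br a b) + (\<Phi> B' - \<Phi> A' + \<Phi> (graded_bracket ms A B))"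
    unfolding E_bracket B'(2) by (simp only: algebra_simps) (simp add: fun_eq_iff)
  moreover have "\<Phi> B' - \<Phi> A' + \<Phi> (graded_bracket ms A B) \<in> S"
    using A' B' graded_bracket_closed[OF A(1) B(1)] subspace_S
    by (intro subspace_add subspace_diff) (auto simp: S_def)
  ultimately show ?thesis by blast
qed

lemma S_subset_G: "S \<subseteq> G"
  using linear_0[OF E_linear] by (auto simp: G_eq' intro!: exI[of _ 0])

lemma S_subset_derived: "S \<subseteq> derived_algebra jacobi_bracket S"
proof
  fix s assume "s \<in> S"
  then obtain A where A: "A \<in> graded_sum ms" "s = \<Phi> A" by (auto simp: S_def)
  obtain P B where "P \<in> graded_sum ms" "B \<in> graded_sum ms" "A = graded_bracket ms P B"
    using graded_sum_perfect[OF A(1)] .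
  then show "s \<in> derived_algebra jacobi_bracket S"
    unfolding derived_algebra_def A(2) by (intro span_base) (auto simp: S_def simp flip: \<Phi>_bracket)
qed

lemma subspace_sum_E:
  assumes "subspace T" shows "subspace {E a + s | a s. a \<in> T \<and> s \<in> S}"
proof -
  have "{E a + s | a s. a \<in> T \<and> s \<in> S} = {x + y | x y. x \<in> E ` T \<and> y \<in> S}" by blast
  then show ?thesis
    using subspace_sums[OF linear_subspace_image[OF E_linear assms] subspace_S] by simp
qed

lemma G_set: "G = {E a + s | a s. a \<in> UNIV \<and> s \<in> S}"
  using G_eq' by blast

lemma decomposition_unique:
  assumes "E a + s = E b + t" "s \<in> S" "t \<in> S" shows "a = b" "s = t"
proof -
  have "E (a - b) = t - s" using assms(1) by (simp add: linear_diff[OF E_linear] algebra_simps)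
  moreover have "t - s \<in> S" using assms subspace_diff[OF subspace_S] by blast
  then obtain A where "A \<in> graded_sum ms" "t - s = \<Phi> A" by (auto simp: S_def)
  ultimately have "a - b = 0" using indep[of A "a - b"] by simp
  then show "a = b" by simp
  with assms(1) show "s = t" by simp
qed

lemma extension: "lie_extension jacobi_bracket S G br"
proof -
  \<comment> \<open>The projection along \<open>S\<close>; the description is well defined by
    \<open>decomposition_unique\<close>.\<close>
  define \<pi> where "\<pi> f = (THE a. \<exists>s\<in>S. f = E a + s)" for f
  have \<pi>: "\<pi> (E a + s) = a" if "s \<in> S" for a s
    unfolding \<pi>_def using that decomposition_unique by (intro the_equality) blast+
  have scale: "c *\<^sub>R (E a + s) = E (c *\<^sub>R a) + c *\<^sub>R s" for c a s
    by (simp add: linear_scale[OF E_linear] scaleR_add_right)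
  have add: "(E a + s) + (E b + t) = E (a + b) + (s + t)" for a b s t
    by (simp add: linear_add[OF E_linear] algebra_simps)
  have "lie_subalgebra jacobi_bracket G"
    unfolding lie_subalgebra_def
  proof (intro conjI ballI)
    show "subspace G" unfolding G_set by (rule subspace_sum_E) simp
    show "jacobi_bracket x y \<in> G" if "x \<in> G" "y \<in> G" for x y
      using that bracket_G unfolding G_eq' by blast
  qed
  moreover have "lie_hom_on G jacobi_bracket br \<pi>"
    unfolding lie_hom_on_def
  proof (intro conjI ballI allI)
    fix x y assume "x \<in> G" "y \<in> G"
    then obtain a s b t where x: "x = E a + s" "s \<in> S" and y: "y = E b + t" "t \<in> S"
      unfolding G_eq' by blast
    show "\<pi> (x + y) = \<pi> x + \<pi> y"
      using x y by (simp add: add \<pi> subspace_add[OF subspace_S])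
    show "\<pi> (jacobi_bracket x y) = br (\<pi> x) (\<pi> y)"
      using bracket_G[OF x(2) y(2), of a b] x y \<pi> by auto
  next
    fix c x assume "x \<in> G"
    then obtain a s where x: "x = E a + s" "s \<in> S" unfolding G_eq' by blast
    show "\<pi> (c *\<^sub>R x) = c *\<^sub>R \<pi> x"
      using x by (simp add: scale \<pi> subspace_scale[OF subspace_S])
  qed
  moreover have "\<pi> ` G = UNIV"
  proof -
    have "a \<in> \<pi> ` G" for a
    proof (rule image_eqI)
      show "a = \<pi> (E a + 0)" using \<pi>[OF subspace_0[OF subspace_S], of a] by simp
      show "E a + 0 \<in> G" using subspace_0[OF subspace_S] unfolding G_eq' by blast
    qed
    then show ?thesis by blast
  qed
  moreover have "{x \<in> G. \<pi> x = 0} = S"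
  proof -
    have E0: "E 0 + s = s" for s by (simp add: linear_0[OF E_linear])
    have "x \<in> S" if x: "x \<in> G" "\<pi> x = 0" for x
    proof -
      obtain a s where "x = E a + s" "s \<in> S" using x(1) unfolding G_eq' by blast
      then show ?thesis using x(2) \<pi>[of s a] E0[of s] by simp
    qed
    moreover have "\<pi> s = 0" if "s \<in> S" for s using \<pi>[OF that, of 0] E0[of s] by simp
    ultimately show ?thesis using S_subset_G by blast
  qed
  ultimately show ?thesis unfolding lie_extension_def by blast
qed

text \<open>With H the whole of \<open>G\<close> this computes the derived algebra. With H =
  \<open>S\<close> it says that \<open>S\<close> is perfect, which gives the second derivation for
  equation III.\<close>

lemma derived_abelian:
  assumes "\<And>a b. br a b = 0" "S \<subseteq> H" "H \<subseteq> G" shows "derived_algebra jacobi_bracket H = S"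
proof
  show "derived_algebra jacobi_bracket H \<subseteq> S"
  proof (rule derived_algebra_subset[OF subspace_S])
    fix x y assume "x \<in> H" "y \<in> H"
    then obtain a s b t where "x = E a + s" "s \<in> S" "y = E b + t" "t \<in> S"
      using assms(3) unfolding G_set by blast
    then show "jacobi_bracket x y \<in> S"
      using bracket_G[of s t a b] assms(1)[of a b] linear_0[OF E_linear] by auto
  qed
  show "S \<subseteq> derived_algebra jacobi_bracket H"
    using S_subset_derived derived_algebra_mono[OF assms(2)] by blast
qed

lemma second_derived:
  assumes T: "subspace T" "\<And>a b. br a b \<in> T" "\<And>a b. a \<in> T \<Longrightarrow> b \<in> T \<Longrightarrow> br a b = 0"
  shows "derived_algebra jacobi_bracket (derived_algebra jacobi_bracket G) = S"
proof
  define H where "H = {E a + s | a s. a \<in> T \<and> s \<in> S}"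
  have "derived_algebra jacobi_bracket G \<subseteq> H"
  proof (rule derived_algebra_subset)
    show "subspace H" unfolding H_def by (rule subspace_sum_E[OF T(1)])
    fix x y assume "x \<in> G" "y \<in> G"
    then show "jacobi_bracket x y \<in> H"
      using bracket_G T(2) unfolding G_eq' H_def by blast
  qed
  moreover have "derived_algebra jacobi_bracket H \<subseteq> S"
  proof (rule derived_algebra_subset[OF subspace_S])
    fix x y assume "x \<in> H" "y \<in> H"
    then obtain a s b t where "x = E a + s" "s \<in> S" "a \<in> T" "y = E b + t" "t \<in> S" "b \<in> T"
      unfolding H_def by blast
    then show "jacobi_bracket x y \<in> S"
      using bracket_G[of s t a b] T(3)[of a b] linear_0[OF E_linear] by auto
  qed
  ultimately show "derived_algebra jacobi_bracket (derived_algebra jacobi_bracket G) \<subseteq> S"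
    using derived_algebra_mono by blast
  show "S \<subseteq> derived_algebra jacobi_bracket (derived_algebra jacobi_bracket G)"
    using S_subset_derived derived_algebra_mono[OF S_subset_G]
      derived_algebra_mono[of S "derived_algebra jacobi_bracket G" jacobi_bracket] by blast
qed

end

section \<open>The equation I\<close>

text \<open>Induction on the number of classes of coordinates: \<open>split_smooth\<close> peels off
  the class with the highest label.\<close>

lemma split_labels:
  fixes g :: "'a::euclidean_space \<Rightarrow> real" and cl :: "'a \<Rightarrow> nat"
  assumes "smooth g" "\<forall>b\<in>Basis. cl b \<le> N"
    "\<forall>v\<in>Basis. \<forall>w\<in>Basis. cl v \<noteq> cl w \<longrightarrow> pd v (pd w g) = (\<lambda>z. 0)"
  shows "\<exists>a. (\<forall>n. smooth (a n)) \<and> g = (\<lambda>z. \<Sum>n\<le>N. a n z) \<and>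
    (\<forall>n\<le>N. \<forall>b\<in>Basis. pd b (a n) = (if cl b = n then pd b g else (\<lambda>z. 0)))"
  using assms
proof (induction N arbitrary: g cl)
  case 0
  then show ?case by (intro exI[of _ "\<lambda>_. g"]) auto
next
  case (Suc N)
  define V where "V = {b \<in> Basis. cl b = Suc N}"
  have V: "V \<subseteq> Basis" by (auto simp: V_def)
  have mixed: "\<forall>v\<in>V. \<forall>w\<in>Basis - V. pd v (pd w g) = (\<lambda>z. 0)"
    using Suc.prems(3) by (auto simp: V_def)
  obtain a b where ab: "smooth a" "smooth b" "g = (\<lambda>z. a z + b z)"
    "\<forall>w\<in>Basis - V. pd w a = (\<lambda>z. 0) \<and> pd w b = pd w g"
    "\<forall>v\<in>V. pd v b = (\<lambda>z. 0) \<and> pd v a = pd v g"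
    by (rule split_smooth[OF Suc.prems(1) V mixed])
  define cl' where "cl' v = (if cl v = Suc N then 0 else cl v)" for v
  have "\<forall>v\<in>Basis. cl' v \<le> N" using Suc.prems(2) by (auto simp: cl'_def le_Suc_eq)
  moreover
  have "pd v (pd w b) = (\<lambda>z. 0)" if vw: "v \<in> Basis" "w \<in> Basis" "cl' v \<noteq> cl' w" for v w
  proof -
    consider "w \<in> V" | "v \<in> V" | "v \<notin> V" "w \<notin> V" by blast
    then show ?thesis
    proof cases
      case 2
      then show ?thesis using ab(5) pd_commute[OF ab(2), of v w] by simp
    next
      case 3
      then show ?thesis using vw ab(4) Suc.prems(3) by (auto simp: cl'_def V_def)
    qed (simp add: ab(5))
  qed
  then have "\<forall>v\<in>Basis. \<forall>w\<in>Basis. cl' v \<noteq> cl' w \<longrightarrow> pd v (pd w b) = (\<lambda>z. 0)" by blast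
  ultimately obtain a' where a': "\<forall>n. smooth (a' n)" "b = (\<lambda>z. \<Sum>n\<le>N. a' n z)"
    "\<forall>n\<le>N. \<forall>v\<in>Basis. pd v (a' n) = (if cl' v = n then pd v b else (\<lambda>z. 0))"
    using Suc.IH[OF ab(2), of cl'] by blast
  define a'' where "a'' n = (if n = Suc N then a else a' n)" for n
  have "pd v (a'' n) = (if cl v = n then pd v g else (\<lambda>z. 0))" if "n \<le> Suc N" "v \<in> Basis" for n v
  proof (cases "n = Suc N")
    case True
    then show ?thesis using that ab(4,5) by (auto simp: a''_def V_def)
  next
    case False
    then show ?thesis using that a'(3) ab(4,5) by (auto simp: a''_def V_def cl'_def)
  qed
  moreover have "\<forall>n. smooth (a'' n)" using ab(1) a'(1) by (simp add: a''_def)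
  moreover have "g = (\<lambda>z. \<Sum>n\<le>Suc N. a'' n z)" using ab(3) a'(2) by (simp add: a''_def add.commute)
  ultimately show ?case by blast
qed

text \<open>Apply \<open>DP k\<close> to \<open>dx k (dx i f) = 0\<close>. Since i and k differ,
  \<open>DP k (dx i f)\<close> equals \<open>dx i (DP k f)\<close>, which is 0, and only the
  commutator term \<open>DU (dx i f)\<close> survives.\<close>

lemma dx_pd_eu_zero:
  assumes "smooth f" "i \<noteq> k" "dx k (dx i f) = (\<lambda>z. 0)" "dx i (DP k f) = (\<lambda>z. 0)"
  shows "dx i (DU f) = (\<lambda>z. 0)"
proof -
  have "DP k (dx k (dx i f)) = (\<lambda>z. dx k (DP k (dx i f)) z + DU (dx i f) z)"
    using assms(1) by (simp add: pd_ep_dx)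
  also have "DP k (dx i f) = (\<lambda>z. 0)" using assms by (simp add: pd_ep_dx)
  finally show ?thesis using assms by (simp add: pd_eu_dx fun_eq_iff)
qed

lemma constant_relations_iff:
  assumes "A \<in> graded_sum ms"
  shows "A \<in> constant_relations ms \<longleftrightarrow>
    (\<forall>(b, i)\<in>pieces ms. \<forall>y. A b i y = A b i 0) \<and> (\<Sum>b<length ms. A b (ms ! b) 0) = 0"
proof
  assume "A \<in> constant_relations ms"
  then obtain c where c: "\<forall>(b, i)\<in>pieces ms. A b i = (\<lambda>_. c b i)" "(\<Sum>b<length ms. c b (ms ! b)) = 0"
    by (auto simp: constant_relations_def)
  have "(\<Sum>b<length ms. A b (ms ! b) 0) = (\<Sum>b<length ms. c b (ms ! b))"
    using c(1) by (intro sum.cong) (auto simp: pieces_def)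
  with c show "(\<forall>(b, i)\<in>pieces ms. \<forall>y. A b i y = A b i 0) \<and> (\<Sum>b<length ms. A b (ms ! b) 0) = 0"
    by (auto split: prod.splits)
next
  assume *: "(\<forall>(b, i)\<in>pieces ms. \<forall>y. A b i y = A b i 0) \<and> (\<Sum>b<length ms. A b (ms ! b) 0) = 0"
  then have "\<forall>(b, i)\<in>pieces ms. A b i = (\<lambda>_. A b i 0)" by fast
  with * assms show "A \<in> constant_relations ms"
    unfolding constant_relations_def by (auto intro!: exI[of _ "\<lambda>b i. A b i 0"])
qed

lemma plane_const_iff:
  assumes "smooth A" shows "(\<forall>y. A y = A 0) \<longleftrightarrow> D1 A = (\<lambda>z. 0) \<and> D2 A = (\<lambda>z. 0)"
proof
  assume "\<forall>y. A y = A 0"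
  then have "A = (\<lambda>y. A 0)" by auto
  then show "D1 A = (\<lambda>z. 0) \<and> D2 A = (\<lambda>z. 0)" by (metis pd_const)
next
  assume "D1 A = (\<lambda>z. 0) \<and> D2 A = (\<lambda>z. 0)"
  then show "\<forall>y. A y = A 0"
    using all_partials_zero_const[OF assms, of _ 0] by (auto simp: Basis_plane)
qed

lemma pull_zero_iff:
  "v \<bullet> v = 1 \<Longrightarrow> w \<bullet> w = 1 \<Longrightarrow> v \<bullet> w = 0 \<Longrightarrow> (\<lambda>z. pull v w F z) = (\<lambda>z. 0) \<longleftrightarrow> F = (\<lambda>z. 0)"
  using pull_cong_inj[of v w F "\<lambda>z. 0"] by (auto simp: pull_def)

lemma pull_zero_arg: "pull v w F 0 = F 0"
  by (simp add: pull_def zero_prod_def)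

lemma pull_add [simp]: "pull v w (A + B) = (\<lambda>z. pull v w A z + pull v w B z)"
  by (simp add: pull_def)

lemma pull_scale [simp]: "pull v w (c *\<^sub>R A) = (\<lambda>z. c * pull v w A z)"
  by (simp add: pull_def scaleR_fun_def)

lemma pd_plus_fun [simp]: "smooth A \<Longrightarrow> smooth B \<Longrightarrow> pd v (A + B) = pd v A + pd v B"
  by (simp add: plus_fun_def)

lemma pd_scaleR_fun [simp]: "smooth A \<Longrightarrow> pd v (c *\<^sub>R A) = c *\<^sub>R pd v A"
  by (simp add: scaleR_fun_def)

lemma smooth_plus_fun [simp]: "smooth A \<Longrightarrow> smooth B \<Longrightarrow> smooth (A + B)"
  by (simp add: plus_fun_def)

lemma smooth_scaleR_fun [simp]: "smooth A \<Longrightarrow> smooth (c *\<^sub>R A)"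
  by (simp add: scaleR_fun_def)

lemma D2_D1: "smooth A \<Longrightarrow> D2 (D1 A) = D1 (D2 A)"
  by (rule pd_commute)

lemma scaleR_apply2: "(c *\<^sub>R A) b i = c *\<^sub>R A b i" for A :: "nat \<Rightarrow> nat \<Rightarrow> real \<times> real \<Rightarrow> real"
  by (simp add: scaleR_fun_def)

lemma pieces_I: "pieces [0, 0, 0, 0] = {(0, 0), (1, 0), (2, 0), (3, 0)}"
  by (auto simp: pieces_def numeral_eq_Suc less_Suc_eq)

text \<open>The position is the first argument of each pair, which makes the Jacobi bracket restrict
  to \<open>poisson\<close> with the correct sign.\<close>

definition \<Phi>_I :: "(nat \<Rightarrow> nat \<Rightarrow> real \<times> real \<Rightarrow> real) \<Rightarrow> jet1 \<Rightarrow> real" where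
  "\<Phi>_I A = (\<lambda>z. pull (ex 1) (ep 1) (A 0 0) z + pull (ex 2) (ep 2) (A 1 0) z
     + pull (ex 3) (ep 3) (A 2 0) z + pull (ex 4) (ep 4) (A 3 0) z)"

definition E_I :: "real ^ 1 \<Rightarrow> jet1 \<Rightarrow> real" where
  "E_I a = (\<lambda>z. a $ 1 * uc z)"

lemma cont_eq_I_solve:
  assumes nz: "\<alpha> \<noteq> 0" "\<beta> \<noteq> 0" "\<alpha> + \<beta> \<noteq> 0" and "f \<in> cont (eq_I \<alpha> \<beta>)"
  obtains a A where "A \<in> graded_sum [0, 0, 0, 0]" "f = (\<lambda>z. E_I a z + \<Phi>_I A z)"
proof -
  have f: "smooth f" using assms(4) by (simp add: cont_def)
  note conds = assms(4)[unfolded cont_eq_I_iff[OF nz] determining_I_def, THEN conjunct2, unfolded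
      all_conj_distrib fun_eq_iff[symmetric]]
  \<comment> \<open>An index i other than k is sought for which \<open>dx i (DP k f)\<close> and
    \<open>DP i (DP k f)\<close> vanish: i = 1 serves k = 2, 3, 4 and i = 2 serves k = 1. The other
    equations are treated in the same way.\<close>
  have fk: "DU (DP k f) = (\<lambda>z. 0)" for k
    using exhaust_4[of k] dx_zero_imp_pd_eu[of "DP k f" 1] dx_zero_imp_pd_eu[of "DP k f" 2] f conds
    by (auto simp: pd_normal[OF f])
  have fi: "dx i (DU f) = (\<lambda>z. 0)" for i
    using exhaust_4[of i] dx_pd_eu_zero[OF f, of i 1] dx_pd_eu_zero[OF f, of i 2] conds
    by (auto simp: dx_normal[OF f])
  obtain c g where g: "smooth g" "f = (\<lambda>z. g z + c * uc z)" "DU f = (\<lambda>z. c)"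
    "DU g = (\<lambda>z. 0)" "\<forall>k. DP k f = DP k g"
    "\<forall>i j. dx i (dx j f) = DX i (DX j g)"
    "\<forall>i k. dx i (DP k f) = DX i (DP k g)"
    by (rule reduce_u[OF f]) (use fk fi in blast)+
  note conds' = conds[unfolded g(6,7)[rule_format], unfolded g(5)[rule_format]]
  \<comment> \<open>One label for each conjugate pair. The direction \<open>eu\<close> falls into
    the last class, where \<open>DU g = 0\<close> keeps it from appearing.\<close>
  define cl where "cl v = (if v \<in> {ex 1, ep 1} then 0 else if v \<in> {ex 2, ep 2} then 1
    else if v \<in> {ex 3, ep 3} then 2 else 3 :: nat)" for v
  have "\<forall>v\<in>Basis. \<forall>w\<in>Basis. cl v \<noteq> cl w \<longrightarrow> pd v (pd w g) = (\<lambda>z. 0)"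
    using conds' unfolding Basis_jet_explicit
    by (auto simp: cl_def g(1,4) pd_normal)
  moreover have "\<forall>b\<in>Basis. cl b \<le> 3" by (simp add: cl_def)
  ultimately obtain a where a: "\<forall>n. smooth (a n)" "g = (\<lambda>z. \<Sum>n\<le>3. a n z)"
    "\<forall>n\<le>3. \<forall>b\<in>Basis. pd b (a n) = (if cl b = n then pd b g else (\<lambda>z. 0))"
    using split_labels[OF g(1), of cl 3] by blast
  have "\<exists>A. smooth A \<and> a 0 = pull (ex 1) (ep 1) A"
    using a(3)[THEN spec, of 0] a(1) g(4) by (intro factor_pull; simp add: Basis_jet_explicit cl_def)
  moreover have "\<exists>A. smooth A \<and> a 1 = pull (ex 2) (ep 2) A"
    using a(3)[THEN spec, of 1] a(1) g(4) by (intro factor_pull; simp add: Basis_jet_explicit cl_def)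
  moreover have "\<exists>A. smooth A \<and> a 2 = pull (ex 3) (ep 3) A"
    using a(3)[THEN spec, of 2] a(1) g(4) by (intro factor_pull; simp add: Basis_jet_explicit cl_def)
  moreover have "\<exists>A. smooth A \<and> a 3 = pull (ex 4) (ep 4) A"
    using a(3)[THEN spec, of 3] a(1) g(4) by (intro factor_pull; simp add: Basis_jet_explicit cl_def)
  ultimately obtain A0 A1 A2 A3 where A: "smooth A0" "a 0 = pull (ex 1) (ep 1) A0" "smooth A1" "a 1 =
      pull (ex 2) (ep 2) A1"
    "smooth A2" "a 2 = pull (ex 3) (ep 3) A2" "smooth A3" "a 3 = pull (ex 4) (ep 4) A3"
    by blast
  define A where "A = (\<lambda>(b :: nat) (i :: nat). if i = 0 then (if b = 0 then A0 else if b = 1 then A1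
    else if b = 2 then A2 else if b = 3 then A3 else 0) else 0)"
  have "A \<in> graded_sum [0, 0, 0, 0]"
    using A by (auto simp: graded_sum_def pieces_def A_def nth_Cons split: nat.splits if_splits)
  moreover have "(\<Sum>n\<le>3. a n z) = a 0 z + a 1 z + a 2 z + a 3 z" for z by (simp add: numeral_eq_Suc)
  then have "f = (\<lambda>z. E_I (vec c) z + \<Phi>_I A z)"
    unfolding g(2) a(2) by (simp add: E_I_def \<Phi>_I_def A_def A A(4)[unfolded One_nat_def] fun_eq_iff)
  ultimately show ?thesis by (rule that)
qed

lemma cont_eq_I_mem:
  assumes nz: "\<alpha> \<noteq> 0" "\<beta> \<noteq> 0" "\<alpha> + \<beta> \<noteq> 0" and A: "A \<in> graded_sum [0, 0, 0, 0]"
  shows "(\<lambda>z. E_I a z + \<Phi>_I A z) \<in> cont (eq_I \<alpha> \<beta>)"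
  unfolding cont_eq_I_iff[OF nz] determining_I_def E_I_def \<Phi>_I_def dx_def
  using graded_sum_smooth[OF A] by simp

lemma \<Phi>_I_bracket:
  assumes A: "A \<in> graded_sum [0, 0, 0, 0]" and B: "B \<in> graded_sum [0, 0, 0, 0]"
  shows "jacobi_bracket (\<Phi>_I A) (\<Phi>_I B) = \<Phi>_I (graded_bracket [0, 0, 0, 0] A B)"
proof -
  note sm = graded_sum_smooth[OF A] graded_sum_smooth[OF B]
  have "graded_bracket [0, 0, 0, 0] A B b 0 = poisson (A b 0) (B b 0)" if "b < 4" for b
    using that by (auto simp: graded_bracket_def pieces_def numeral_eq_Suc less_Suc_eq nth_Cons split:
        nat.splits)
  then show ?thesis
    unfolding \<Phi>_I_def using sm
    by (simp add: jacobi_bracket_eq sum_4 poisson_eq) (simp add: pull_def fun_eq_iff algebra_simps)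
qed

lemma structure_I:
  assumes nz: "\<alpha> \<noteq> 0" "\<beta> \<noteq> 0" "\<alpha> + \<beta> \<noteq> 0"
  shows "symmetry_structure [0, 0, 0, 0] \<Phi>_I E_I abelian_bracket (cont (eq_I \<alpha> \<beta>))"
proof (rule symmetry_structure.intro)
  fix A B :: "nat \<Rightarrow> nat \<Rightarrow> real \<times> real \<Rightarrow> real" and c :: real and a b :: "real ^ 1" and f
  show "smooth (E_I a)" by (simp add: E_I_def)
  show "linear E_I" by (rule linearI) (simp_all add: E_I_def fun_eq_iff algebra_simps scaleR_fun_def)
  show "jacobi_bracket (E_I a) (E_I b) = E_I (abelian_bracket a b)"
    by (simp add: E_I_def jacobi_bracket_eq sum_4 abelian_bracket_def)
  show "f \<in> cont (eq_I \<alpha> \<beta>) \<longleftrightarrow> (\<exists>a. \<exists>A\<in>graded_sum [0, 0, 0, 0]. f = (\<lambda>z. E_I a z + \<Phi>_I A z))"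
    by (blast elim: cont_eq_I_solve[OF nz] intro: cont_eq_I_mem[OF nz])
  assume A: "A \<in> graded_sum [0, 0, 0, 0]"
  note sm = graded_sum_smooth[OF A]
  show "smooth (\<Phi>_I A)" using sm by (simp add: \<Phi>_I_def)
  show "\<Phi>_I (c *\<^sub>R A) = c *\<^sub>R \<Phi>_I A"
    by (simp add: \<Phi>_I_def scaleR_apply2 scaleR_fun_def pull_def fun_eq_iff algebra_simps)
  show "\<Phi>_I A = (\<lambda>z. 0) \<longleftrightarrow> A \<in> constant_relations [0, 0, 0, 0]"
  proof
    assume 0: "\<Phi>_I A = (\<lambda>z. 0)"
    have d: "pd v (\<Phi>_I A) = (\<lambda>z. 0)" for v by (simp add: 0)
    have "D1 (A 0 0) = (\<lambda>z. 0)" "D2 (A 0 0) = (\<lambda>z. 0)" "D1 (A 1 0) = (\<lambda>z. 0)" "D2 (A 1 0) = (\<lambda>z. 0)"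
      "D1 (A 2 0) = (\<lambda>z. 0)" "D2 (A 2 0) = (\<lambda>z. 0)" "D1 (A 3 0) = (\<lambda>z. 0)" "D2 (A 3 0) = (\<lambda>z. 0)"
      using d[of "ex 1"] d[of "ep 1"] d[of "ex 2"] d[of "ep 2"] d[of "ex 3"] d[of "ep 3"] d[of "ex 4"]
          d[of "ep 4"] sm
      by (simp_all add: \<Phi>_I_def pull_zero_iff)
    then have "\<forall>(b, i)\<in>pieces [0, 0, 0, 0]. \<forall>y. A b i y = A b i 0"
      using plane_const_iff[OF sm] by (simp add: pieces_I)
    moreover have "A 0 0 0 + A 1 0 0 + A 2 0 0 + A 3 0 0 = 0"
      using fun_cong[OF 0, of 0] by (simp add: \<Phi>_I_def pull_zero_arg)
    then have "(\<Sum>b<length [0, 0, 0, 0 :: nat]. A b ([0, 0, 0, 0] ! b) 0) = 0" by (simp add: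
        numeral_eq_Suc)
    ultimately show "A \<in> constant_relations [0, 0, 0, 0]" unfolding constant_relations_iff[OF A] by blast
  next
    assume "A \<in> constant_relations [0, 0, 0, 0]"
    then have "\<forall>y. A 0 0 y = A 0 0 0" "\<forall>y. A 1 0 y = A 1 0 0" "\<forall>y. A 2 0 y = A 2 0 0" "\<forall>y. A 3 0 y = A 3
        0 0"
      "A 0 0 0 + A 1 0 0 + A 2 0 0 + A 3 0 0 = 0"
      unfolding constant_relations_iff[OF A] by (simp_all add: pieces_I numeral_eq_Suc)
    then show "\<Phi>_I A = (\<lambda>z. 0)"
      unfolding \<Phi>_I_def pull_def by metis
  qed
  show "\<exists>B\<in>graded_sum [0, 0, 0, 0]. jacobi_bracket (E_I a) (\<Phi>_I A) = \<Phi>_I B"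
  proof
    \<comment> \<open>The bracket with the function u is the Euler operator in the momenta minus the
      identity.\<close>
    define B where "B = (\<lambda>b i. if (b, i) \<in> pieces [0, 0, 0, 0] then (\<lambda>y. a $ 1 * (snd y * D2 (A b i) y -
        A b i y)) else 0)"
    show "B \<in> graded_sum [0, 0, 0, 0]" using sm by (simp add: graded_sum_def B_def)
    have "B b 0 = (\<lambda>y. a $ 1 * (snd y * D2 (A b 0) y - A b 0 y))" if "b < 4" for b
      using that by (auto simp: B_def pieces_def numeral_eq_Suc less_Suc_eq)
    then show "jacobi_bracket (E_I a) (\<Phi>_I A) = \<Phi>_I B"
      unfolding E_I_def \<Phi>_I_def using sm
      by (simp add: jacobi_bracket_eq sum_4) (simp add: pull_def fun_eq_iff algebra_simps)
  qed
  show "E_I a = \<Phi>_I A \<Longrightarrow> a = 0"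
  proof -
    assume eq: "E_I a = \<Phi>_I A"
    have "DU (E_I a) = (\<lambda>z. a $ 1)" "DU (\<Phi>_I A) = (\<lambda>z. 0)"
      using sm by (simp_all add: E_I_def \<Phi>_I_def)
    then have "a $ 1 = 0" unfolding eq by metis
    then show "a = 0" by (simp add: vec_eq_iff)
  qed
  assume B: "B \<in> graded_sum [0, 0, 0, 0]"
  show "\<Phi>_I (A + B) = \<Phi>_I A + \<Phi>_I B"
    by (simp add: \<Phi>_I_def fun_eq_iff pull_def)
  show "jacobi_bracket (\<Phi>_I A) (\<Phi>_I B) = \<Phi>_I (graded_bracket [0, 0, 0, 0] A B)"
    by (rule \<Phi>_I_bracket[OF A B])
qed

section \<open>The equation D\<close>

lemma pd_pd_zero: "smooth a \<Longrightarrow> pd v a = (\<lambda>z. 0) \<Longrightarrow> pd v (pd w a) = (\<lambda>z. 0)"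
  by (simp add: pd_commute[of a v w])

text \<open>A derivative of h is minus that of k, and in each basis direction one of the two is
  zero.\<close>

lemma separated_const:
  assumes "smooth h" "smooth k" "\<forall>b\<in>Basis. pd b h = (\<lambda>z. 0) \<or> pd b k = (\<lambda>z. 0)" "\<forall>z. h z + k z = s"
  obtains m where "\<forall>z. h z = m"
proof -
  have hk: "h = (\<lambda>z. s - k z)" using assms(4) by (auto simp: fun_eq_iff eq_diff_eq)
  have "pd b h = (\<lambda>z. 0)" if "b \<in> Basis" for b
    using assms(3) that assms(2) by (auto simp: hk)
  then have "h z = h 0" for z using all_partials_zero_const[OF assms(1)] by blast
  then show ?thesis using that by blast
qed

lemma pull_neg_zero_iff:
  "v \<bullet> v = 1 \<Longrightarrow> w \<bullet> w = 1 \<Longrightarrow> v \<bullet> w = 0 \<Longrightarrow> (\<lambda>z. - pull v w F z) = (\<lambda>z. 0) \<longleftrightarrow> F = (\<lambda>z. 0)"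
  using pull_zero_iff[of v w F] by (simp add: fun_eq_iff)

lemma smooth_ham [simp, intro]: "smooth A \<Longrightarrow> smooth (ham i j A)"
  unfolding ham_def by simp

lemma ham_zero_arg: "ham i j A 0 = 0"
  by (simp add: ham_def)

lemma pieces_D: "pieces [Suc 0, Suc 0] = {(0, 0), (0, Suc 0), (Suc 0, 0), (Suc 0, Suc 0)}"
  by (auto simp: pieces_def numeral_eq_Suc less_Suc_eq)

text \<open>Since \<open>ham\<close> kills constants, the constants of grading 0 lie in the kernel,
  while those of grading 1 only enter through their sum over the two branches.\<close>

definition \<Phi>_D :: "(nat \<Rightarrow> nat \<Rightarrow> real \<times> real \<Rightarrow> real) \<Rightarrow> jet1 \<Rightarrow> real" where
  "\<Phi>_D A = (\<lambda>z. ham 1 2 (A 0 0) z + pullx 1 2 (A 0 1) z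
     + ham 3 4 (A 1 0) z + pullx 3 4 (A 1 1) z)"

text \<open>The coefficients are the divergences in the planes of x1, x2 and of x3, x4. The terms
  with \<open>uc z / 2\<close> restore the last equation of \<open>determining_D\<close>.\<close>

definition E_D :: "real ^ 2 \<Rightarrow> jet1 \<Rightarrow> real" where
  "E_D a = (\<lambda>z. a $ 1 * ((xc 1 z) * pc 1 z - uc z / 2)
     + a $ 2 * ((xc 3 z) * pc 3 z - uc z / 2))"

lemma cont_eq_D_solve:
  assumes "f \<in> cont eq_D"
  obtains a A where "A \<in> graded_sum [1, 1]" "f = (\<lambda>z. E_D a z + \<Phi>_D A z)"
proof -
  have f: "smooth f" using assms by (simp add: cont_def)
  note conds = assms[unfolded cont_eq_D_iff determining_D_def, THEN conjunct2, unfolded all_conj_distrib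
      fun_eq_iff[symmetric]]
  have fk: "DU (DP k f) = (\<lambda>z. 0)" for k
    using exhaust_4[of k] dx_zero_imp_pd_eu[of "DP k f" 1] dx_zero_imp_pd_eu[of "DP k f" 3] f conds
    by (auto simp: pd_normal[OF f])
  have fi: "dx i (DU f) = (\<lambda>z. 0)" for i
    using exhaust_4[of i] dx_pd_eu_zero[OF f, of i 1] dx_pd_eu_zero[OF f, of i 3] conds
    by (auto simp: dx_normal[OF f])
  obtain c g where g: "smooth g" "f = (\<lambda>z. g z + c * uc z)" "DU f = (\<lambda>z. c)"
    "DU g = (\<lambda>z. 0)" "\<forall>k. DP k f = DP k g"
    "\<forall>i j. dx i (dx j f) = DX i (DX j g)"
    "\<forall>i k. dx i (DP k f) = DX i (DP k g)"
    by (rule reduce_u[OF f]) (use fk fi in blast)+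
  note conds' = conds[unfolded g(6,7)[rule_format], unfolded g(5)[rule_format] g(3)]
  define cl where "cl v = (if v \<in> {ex 1, ep 1, ex 2, ep 2} then 0 else 1 :: nat)" for v
  have "\<forall>v\<in>Basis. \<forall>w\<in>Basis. cl v \<noteq> cl w \<longrightarrow> pd v (pd w g) = (\<lambda>z. 0)"
    using conds' unfolding Basis_jet_explicit
    by (auto simp: cl_def g(1,4) pd_normal)
  moreover have "\<forall>b\<in>Basis. cl b \<le> 1" by (simp add: cl_def)
  ultimately obtain a where a: "\<forall>n. smooth (a n)" "g = (\<lambda>z. \<Sum>n\<le>1. a n z)"
    "\<forall>n\<le>1. \<forall>b\<in>Basis. pd b (a n) = (if cl b = n then pd b g else (\<lambda>z. 0))"
    using split_labels[OF g(1), of cl 1] by blast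
  have a0: "DX 1 (a 0) = DX 1 g" "DX 2 (a 0) = DX 2 g" "DP 1 (a 0) = DP 1 g"
    "DP 2 (a 0) = DP 2 g" "DX 3 (a 0) = (\<lambda>z. 0)" "DX 4 (a 0) = (\<lambda>z. 0)"
    "DP 3 (a 0) = (\<lambda>z. 0)" "DP 4 (a 0) = (\<lambda>z. 0)" "DU (a 0) = (\<lambda>z. 0)"
    and a1: "DX 3 (a 1) = DX 3 g" "DX 4 (a 1) = DX 4 g" "DP 3 (a 1) = DP 3 g"
    "DP 4 (a 1) = DP 4 g" "DX 1 (a 1) = (\<lambda>z. 0)" "DX 2 (a 1) = (\<lambda>z. 0)"
    "DP 1 (a 1) = (\<lambda>z. 0)" "DP 2 (a 1) = (\<lambda>z. 0)" "DU (a 1) = (\<lambda>z. 0)"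
    using a(3)[THEN spec, of 0] a(3)[THEN spec, of 1] g(4) by (simp_all add: Basis_jet_explicit cl_def)
  \<comment> \<open>The divergences of the two blocks live on disjoint sets of variables and add up
    to -2c, so each is constant.\<close>
  define h where "h = (\<lambda>z. DX 1 (DP 1 (a 0)) z + DX 2 (DP 2 (a 0)) z)"
  define k where "k = (\<lambda>z. DX 3 (DP 3 (a 1)) z + DX 4 (DP 4 (a 1)) z)"
  have sm: "smooth (a 0)" "smooth (a 1)" using a(1) by auto
  then have hk: "smooth h" "smooth k" unfolding h_def k_def by simp_all
  have "pd b h = (\<lambda>z. 0)" if "pd b (a 0) = (\<lambda>z. 0)" for b
    unfolding h_def using sm that by (simp add: pd_pd_zero)
  moreover have "pd b k = (\<lambda>z. 0)" if "pd b (a 1) = (\<lambda>z. 0)" for b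
    unfolding k_def using sm that by (simp add: pd_pd_zero)
  ultimately have sep: "\<forall>b\<in>Basis. pd b h = (\<lambda>z. 0) \<or> pd b k = (\<lambda>z. 0)"
    using a0 a1 unfolding Basis_jet_explicit by auto
  have sum: "\<forall>z. h z + k z = - 2 * c"
    unfolding h_def k_def a0 a1 using conds' by simp
  obtain m where m: "\<forall>z. h z = m" by (rule separated_const[OF hk sep sum])
  then have m': "\<forall>z. k z = - 2 * c - m" using sum by (metis add_diff_cancel_left')
  have "\<exists>A K. smooth A \<and> smooth K \<and> a 0 = (\<lambda>z. ham 1 2 A z + pullx 1 2 K z + m * xc 1 z * pc 1 z)"
    using m conds' unfolding h_def
    by (intro block) (simp_all add: sm a0 Basis_jet_explicit)
  then obtain A K where A: "smooth A" "smooth K"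
    "a 0 = (\<lambda>z. ham 1 2 A z + pullx 1 2 K z + m * xc 1 z * pc 1 z)" by blast
  have "\<exists>A K. smooth A \<and> smooth K \<and> a 1 = (\<lambda>z. ham 3 4 A z + pullx 3 4 K z + (- 2 * c - m) * xc 3 z * pc
      3 z)"
    using m' conds' sm(2) a1 unfolding k_def
    by (intro block) (simp_all add: Basis_jet_explicit)
  then obtain B L where B: "smooth B" "smooth L"
    "a 1 = (\<lambda>z. ham 3 4 B z + pullx 3 4 L z + (- 2 * c - m) * xc 3 z * pc 3 z)" by blast
  define C where "C = (\<lambda>(b :: nat) (i :: nat). if b = 0 then (if i = 0 then A else if i = 1 then K else
      0)
    else if b = 1 then (if i = 0 then B else if i = 1 then L else 0) else 0)"
  have "C \<in> graded_sum [1, 1]"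
    using A(1,2) B(1,2) by (auto simp: graded_sum_def pieces_D C_def)
  moreover have "(\<Sum>n\<le>1. a n z) = a 0 z + a 1 z" for z by simp
  then have "f = (\<lambda>z. E_D (vector [m, - 2 * c - m]) z + \<Phi>_D C z)"
    unfolding g(2) a(2) A(3) B(3)
    by (simp add: E_D_def \<Phi>_D_def C_def A(3) B(3)[unfolded One_nat_def] fun_eq_iff algebra_simps)
  ultimately show ?thesis by (rule that)
qed

lemma cont_eq_D_mem:
  assumes A: "A \<in> graded_sum [1, 1]"
  shows "(\<lambda>z. E_D a z + \<Phi>_D A z) \<in> cont eq_D"
  unfolding cont_eq_D_iff determining_D_def E_D_def \<Phi>_D_def ham_def dx_def
  using graded_sum_smooth[OF A] by (simp add: D2_D1 algebra_simps)

lemma \<Phi>_D_bracket: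
  assumes A: "A \<in> graded_sum [1, 1]" and B: "B \<in> graded_sum [1, 1]"
  shows "jacobi_bracket (\<Phi>_D A) (\<Phi>_D B) = \<Phi>_D (graded_bracket [1, 1] A B)"
proof -
  note sm = graded_sum_smooth[OF A] graded_sum_smooth[OF B]
  have "graded_bracket [1, 1] A B 0 0 = poisson (A 0 0) (B 0 0)"
    "graded_bracket [1, 1] A B 1 0 = poisson (A 1 0) (B 1 0)"
    "graded_bracket [1, 1] A B 0 1 = (\<lambda>z. poisson (A 0 0) (B 0 1) z + poisson (A 0 1) (B 0 0) z)"
    "graded_bracket [1, 1] A B 1 1 = (\<lambda>z. poisson (A 1 0) (B 1 1) z + poisson (A 1 1) (B 1 0) z)"
    by (simp_all add: graded_bracket_def pieces_D plus_fun_def)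
  then show ?thesis
    unfolding \<Phi>_D_def ham_def using sm
    by (simp add: jacobi_bracket_eq sum_4 poisson_eq D2_D1) (simp add: pull_def fun_eq_iff algebra_simps)
qed

lemma structure_D: "symmetry_structure [1, 1] \<Phi>_D E_D abelian_bracket (cont eq_D)"
proof (rule symmetry_structure.intro)
  fix A B :: "nat \<Rightarrow> nat \<Rightarrow> real \<times> real \<Rightarrow> real" and c :: real and a b :: "real ^ 2" and f
  show "smooth (E_D a)" by (simp add: E_D_def)
  show "linear E_D" by (rule linearI) (simp_all add: E_D_def fun_eq_iff algebra_simps scaleR_fun_def)
  show "jacobi_bracket (E_D a) (E_D b) = E_D (abelian_bracket a b)"
    by (simp add: E_D_def jacobi_bracket_eq sum_4 abelian_bracket_def fun_eq_iff field_simps)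
  show "f \<in> cont eq_D \<longleftrightarrow> (\<exists>a. \<exists>A\<in>graded_sum [1, 1]. f = (\<lambda>z. E_D a z + \<Phi>_D A z))"
    by (blast elim: cont_eq_D_solve intro: cont_eq_D_mem)
  assume A: "A \<in> graded_sum [1, 1]"
  note sm = graded_sum_smooth[OF A]
  show "smooth (\<Phi>_D A)" using sm by (simp add: \<Phi>_D_def)
  show "\<Phi>_D (c *\<^sub>R A) = c *\<^sub>R \<Phi>_D A"
    using sm by (simp add: \<Phi>_D_def ham_def scaleR_apply2 scaleR_fun_def pull_def fun_eq_iff
        algebra_simps)
  show "\<Phi>_D A = (\<lambda>z. 0) \<longleftrightarrow> A \<in> constant_relations [1, 1]"
  proof
    assume 0: "\<Phi>_D A = (\<lambda>z. 0)"
    have d: "pd v (\<Phi>_D A) = (\<lambda>z. 0)" for v by (simp add: 0)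
    have p: "D1 (A 0 0) = (\<lambda>z. 0)" "D2 (A 0 0) = (\<lambda>z. 0)" "D1 (A 1 0) = (\<lambda>z. 0)" "D2 (A 1 0) = (\<lambda>z. 0)"
      using d[of "ep 1"] d[of "ep 2"] d[of "ep 3"] d[of "ep 4"] sm
      by (simp_all add: \<Phi>_D_def ham_def pull_zero_iff pull_neg_zero_iff)
    have "pull v w (\<lambda>z. 0) = (\<lambda>z. 0)" for v w :: jet1 by (simp add: pull_def)
    with p have "D1 (A 0 1) = (\<lambda>z. 0)" "D2 (A 0 1) = (\<lambda>z. 0)" "D1 (A 1 1) = (\<lambda>z. 0)" "D2 (A 1 1) = (\<lambda>z.
        0)"
      using d[of "ex 1"] d[of "ex 2"] d[of "ex 3"] d[of "ex 4"] sm
      by (simp_all add: \<Phi>_D_def ham_def pull_zero_iff)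
    with p have "\<forall>(b, i)\<in>pieces [1, 1]. \<forall>y. A b i y = A b i 0"
      using plane_const_iff[OF sm] by (simp add: pieces_D)
    moreover have "A 0 1 0 + A 1 1 0 = 0"
      using fun_cong[OF 0, of 0] by (simp add: \<Phi>_D_def pull_zero_arg ham_zero_arg)
    then have "(\<Sum>b<length [1, 1 :: nat]. A b ([1, 1] ! b) 0) = 0" by simp
    ultimately show "A \<in> constant_relations [1, 1]" unfolding constant_relations_iff[OF A] by blast
  next
    assume "A \<in> constant_relations [1, 1]"
    then have *: "\<forall>y. A 0 0 y = A 0 0 0" "\<forall>y. A 0 1 y = A 0 1 0" "\<forall>y. A 1 0 y = A 1 0 0" "\<forall>y. A 1 1 y = A
        1 1 0"
      "A 0 1 0 + A 1 1 0 = 0"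
      unfolding constant_relations_iff[OF A] by (simp_all add: pieces_D)
    then have "D1 (A 0 0) = (\<lambda>z. 0)" "D2 (A 0 0) = (\<lambda>z. 0)" "D1 (A 1 0) = (\<lambda>z. 0)" "D2 (A 1 0) = (\<lambda>z. 0)"
      using plane_const_iff[OF sm] by simp_all
    then have "\<Phi>_D A z = A 0 1 0 + A 1 1 0" for z
      unfolding \<Phi>_D_def ham_def pull_def using *(2,4) by simp
    then show "\<Phi>_D A = (\<lambda>z. 0)" using *(5) by auto
  qed
  show "\<exists>B\<in>graded_sum [1, 1]. jacobi_bracket (E_D a) (\<Phi>_D A) = \<Phi>_D B"
  proof
    \<comment> \<open>Bracketing with -u/2 kills functions linear in the momenta and multiplies
      functions of the positions by 1/2. Hence both coefficients occur in grading 1, but only one in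
      grading 0.\<close>
    define B where "B = (\<lambda>(b :: nat) (i :: nat).
      if b = 0 then (if i = 0 then (\<lambda>y. a $ 1 * (A 0 0 y - fst y * D1 (A 0 0) y))
        else if i = 1 then (\<lambda>y. a $ 1 * (A 0 1 y / 2 - fst y * D1 (A 0 1) y) + a $ 2 * A 0 1 y / 2) else
            0)
      else if b = 1 then (if i = 0 then (\<lambda>y. a $ 2 * (A 1 0 y - fst y * D1 (A 1 0) y))
        else if i = 1 then (\<lambda>y. a $ 2 * (A 1 1 y / 2 - fst y * D1 (A 1 1) y) + a $ 1 * A 1 1 y / 2) else
            0)
      else 0)"
    show "B \<in> graded_sum [1, 1]" using sm by (auto simp: graded_sum_def B_def pieces_D)
    have "B 0 0 = (\<lambda>y. a $ 1 * (A 0 0 y - fst y * D1 (A 0 0) y))"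
      "B 0 1 = (\<lambda>y. a $ 1 * (A 0 1 y / 2 - fst y * D1 (A 0 1) y) + a $ 2 * A 0 1 y / 2)"
      "B 1 0 = (\<lambda>y. a $ 2 * (A 1 0 y - fst y * D1 (A 1 0) y))"
      "B 1 1 = (\<lambda>y. a $ 2 * (A 1 1 y / 2 - fst y * D1 (A 1 1) y) + a $ 1 * A 1 1 y / 2)"
      by (simp_all add: B_def)
    then show "jacobi_bracket (E_D a) (\<Phi>_D A) = \<Phi>_D B"
      unfolding E_D_def \<Phi>_D_def ham_def using sm
      by (simp add: jacobi_bracket_eq sum_4 D2_D1) (simp add: pull_def fun_eq_iff field_simps)
  qed
  show "E_D a = \<Phi>_D A \<Longrightarrow> a = 0"
  proof -
    assume eq: "E_D a = \<Phi>_D A"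
    \<comment> \<open>The two divergences read off \<open>a\<close> and vanish on \<open>ham\<close>
      terms.\<close>
    have e: "(\<lambda>z. DX 1 (DP 1 (E_D a)) z + DX 2 (DP 2 (E_D a)) z) = (\<lambda>z. a $ 1)"
      "(\<lambda>z. DX 3 (DP 3 (E_D a)) z + DX 4 (DP 4 (E_D a)) z) = (\<lambda>z. a $ 2)"
      "(\<lambda>z. DX 1 (DP 1 (\<Phi>_D A)) z + DX 2 (DP 2 (\<Phi>_D A)) z) = (\<lambda>z. 0)"
      "(\<lambda>z. DX 3 (DP 3 (\<Phi>_D A)) z + DX 4 (DP 4 (\<Phi>_D A)) z) = (\<lambda>z. 0)"
      using sm by (simp_all add: E_D_def \<Phi>_D_def ham_def D2_D1)
    have "(\<lambda>z :: jet1. a $ 1) = (\<lambda>z. 0)" by (rule trans[OF e(1)[symmetric, unfolded eq] e(3)])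
    moreover have "(\<lambda>z :: jet1. a $ 2) = (\<lambda>z. 0)" by (rule trans[OF e(2)[symmetric, unfolded eq] e(4)])
    ultimately have "a $ 1 = 0" "a $ 2 = 0" by (auto dest: fun_cong)
    then show "a = 0" by (simp add: vec_eq_iff forall_2)
  qed
  assume B: "B \<in> graded_sum [1, 1]"
  show "\<Phi>_D (A + B) = \<Phi>_D A + \<Phi>_D B"
    using sm graded_sum_smooth[OF B] by (simp add: \<Phi>_D_def ham_def fun_eq_iff pull_def algebra_simps)
  show "jacobi_bracket (\<Phi>_D A) (\<Phi>_D B) = \<Phi>_D (graded_bracket [1, 1] A B)"
    by (rule \<Phi>_D_bracket[OF A B])
qed

section \<open>The equation II\<close>

lemma pieces_II: "pieces [Suc 0, 0, 0] = {(0, 0), (0, Suc 0), (Suc 0, 0), (2, 0)}"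
  by (auto simp: pieces_def numeral_eq_Suc less_Suc_eq)

definition \<Phi>_II :: "(nat \<Rightarrow> nat \<Rightarrow> real \<times> real \<Rightarrow> real) \<Rightarrow> jet1 \<Rightarrow> real" where
  "\<Phi>_II A = (\<lambda>z. ham 2 3 (A 0 0) z + pullx 2 3 (A 0 1) z
     + pull (ex 1) (ep 1) (A 1 0) z + pull (ex 4) (ep 4) (A 2 0) z)"

text \<open>As \<open>w = - C 2 2 - C 3 3\<close> in \<open>determining_II\<close>, the function u
  has to be paired with a field of divergence -1 in the plane of x2 and x3.\<close>

definition E_II :: "real ^ 1 \<Rightarrow> jet1 \<Rightarrow> real" where
  "E_II a = (\<lambda>z. a $ 1 * (uc z - xc 2 z * pc 2 z))"

lemma cont_eq_II_solve:
  assumes "f \<in> cont eq_II"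
  obtains a A where "A \<in> graded_sum [1, 0, 0]" "f = (\<lambda>z. E_II a z + \<Phi>_II A z)"
proof -
  have f: "smooth f" using assms by (simp add: cont_def)
  note conds = assms[unfolded cont_eq_II_iff determining_II_def, THEN conjunct2, unfolded
      all_conj_distrib fun_eq_iff[symmetric]]
  have fk: "DU (DP k f) = (\<lambda>z. 0)" for k
    using exhaust_4[of k] dx_zero_imp_pd_eu[of "DP k f" 1] dx_zero_imp_pd_eu[of "DP k f" 4] f conds
    by (auto simp: pd_normal[OF f])
  have fi: "dx i (DU f) = (\<lambda>z. 0)" for i
    using exhaust_4[of i] dx_pd_eu_zero[OF f, of i 1] dx_pd_eu_zero[OF f, of i 4] conds
    by (auto simp: dx_normal[OF f])
  obtain c g where g: "smooth g" "f = (\<lambda>z. g z + c * uc z)" "DU f = (\<lambda>z. c)"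
    "DU g = (\<lambda>z. 0)" "\<forall>k. DP k f = DP k g"
    "\<forall>i j. dx i (dx j f) = DX i (DX j g)"
    "\<forall>i k. dx i (DP k f) = DX i (DP k g)"
    by (rule reduce_u[OF f]) (use fk fi in blast)+
  note conds' = conds[unfolded g(6,7)[rule_format], unfolded g(5)[rule_format] g(3)]
  define cl where "cl v = (if v \<in> {ex 1, ep 1} then 0 else if v \<in> {ex 4, ep 4} then 1 else 2 :: nat)" for
      v
  have "\<forall>v\<in>Basis. \<forall>w\<in>Basis. cl v \<noteq> cl w \<longrightarrow> pd v (pd w g) = (\<lambda>z. 0)"
    using conds' unfolding Basis_jet_explicit
    by (auto simp: cl_def g(1,4) pd_normal)
  moreover have "\<forall>b\<in>Basis. cl b \<le> 2" by (simp add: cl_def)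
  ultimately obtain a where a: "\<forall>n. smooth (a n)" "g = (\<lambda>z. \<Sum>n\<le>2. a n z)"
    "\<forall>n\<le>2. \<forall>b\<in>Basis. pd b (a n) = (if cl b = n then pd b g else (\<lambda>z. 0))"
    using split_labels[OF g(1), of cl 2] by blast
  have sm: "smooth (a 0)" "smooth (a 1)" "smooth (a 2)" using a(1) by auto
  have "\<exists>A. smooth A \<and> a 0 = pull (ex 1) (ep 1) A" "\<exists>A. smooth A \<and> a 1 = pull (ex 4) (ep 4) A"
    using a(3)[THEN spec, of 0] a(3)[THEN spec, of 1] a(1) g(4)
    by (intro factor_pull; simp add: Basis_jet_explicit cl_def; fail)+
  then obtain A B where A: "smooth A" "a 0 = pull (ex 1) (ep 1) A" and B: "smooth B" "a 1 = pull (ex 4)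
      (ep 4) B"
    by blast
  have a2: "DX 2 (a 2) = DX 2 g" "DX 3 (a 2) = DX 3 g" "DP 2 (a 2) = DP 2 g"
    "DP 3 (a 2) = DP 3 g" "DX 1 (a 2) = (\<lambda>z. 0)" "DX 4 (a 2) = (\<lambda>z. 0)"
    "DP 1 (a 2) = (\<lambda>z. 0)" "DP 4 (a 2) = (\<lambda>z. 0)" "DU (a 2) = (\<lambda>z. 0)"
    using a(3)[THEN spec, of 2] g(4) by (simp_all add: Basis_jet_explicit cl_def)
  have ceq: "(\<lambda>z :: jet1. c) = (\<lambda>z. - DX 2 (DP 2 g) z - DX 3 (DP 3 g) z)"
    using conds' by blast
  have "DX 2 (DP 2 g) z + DX 3 (DP 3 g) z = - c" for z
    using fun_cong[OF ceq, of z] by simp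
  then have div: "\<forall>z. DX 2 (DP 2 g) z + DX 3 (DP 3 g) z = - c" by blast
  have "\<exists>A K. smooth A \<and> smooth K \<and> a 2 = (\<lambda>z. ham 2 3 A z + pullx 2 3 K z + (- c) * xc 2 z * pc 2 z)"
    using conds' div
    by (intro block) (simp_all add: sm a2 Basis_jet_explicit)
  then obtain K L where K: "smooth K" "smooth L"
    "a 2 = (\<lambda>z. ham 2 3 K z + pullx 2 3 L z + (- c) * xc 2 z * pc 2 z)" by blast
  define C where "C = (\<lambda>(b :: nat) (i :: nat). if b = 0 then (if i = 0 then K else if i = 1 then L else
      0)
    else if b = 1 \<and> i = 0 then A else if b = 2 \<and> i = 0 then B else 0)"
  have "C \<in> graded_sum [1, 0, 0]"
    using A(1) B(1) K(1,2) by (auto simp: graded_sum_def pieces_II C_def)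
  moreover have "(\<Sum>n\<le>2. a n z) = a 0 z + a 1 z + a 2 z" for z by (simp add: numeral_eq_Suc)
  then have "f = (\<lambda>z. E_II (vec c) z + \<Phi>_II C z)"
    unfolding g(2) a(2)
    by (simp add: E_II_def \<Phi>_II_def C_def A(2) B(2)[unfolded One_nat_def] K(3) fun_eq_iff algebra_simps)
  ultimately show ?thesis by (rule that)
qed

lemma cont_eq_II_mem:
  assumes A: "A \<in> graded_sum [1, 0, 0]"
  shows "(\<lambda>z. E_II a z + \<Phi>_II A z) \<in> cont eq_II"
  unfolding cont_eq_II_iff determining_II_def E_II_def \<Phi>_II_def ham_def dx_def
  using graded_sum_smooth[OF A] by (simp add: D2_D1 algebra_simps)

lemma \<Phi>_II_bracket:
  assumes A: "A \<in> graded_sum [1, 0, 0]" and B: "B \<in> graded_sum [1, 0, 0]"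
  shows "jacobi_bracket (\<Phi>_II A) (\<Phi>_II B) = \<Phi>_II (graded_bracket [1, 0, 0] A B)"
proof -
  note sm = graded_sum_smooth[OF A] graded_sum_smooth[OF B]
  have "graded_bracket [1, 0, 0] A B 0 0 = poisson (A 0 0) (B 0 0)"
    "graded_bracket [1, 0, 0] A B 1 0 = poisson (A 1 0) (B 1 0)"
    "graded_bracket [1, 0, 0] A B 2 0 = poisson (A 2 0) (B 2 0)"
    "graded_bracket [1, 0, 0] A B 0 1 = (\<lambda>z. poisson (A 0 0) (B 0 1) z + poisson (A 0 1) (B 0 0) z)"
    by (simp_all add: graded_bracket_def pieces_II plus_fun_def)
  then show ?thesis
    unfolding \<Phi>_II_def ham_def using sm
    by (simp add: jacobi_bracket_eq sum_4 poisson_eq D2_D1) (simp add: pull_def fun_eq_iff algebra_simps)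
qed

lemma structure_II: "symmetry_structure [1, 0, 0] \<Phi>_II E_II abelian_bracket (cont eq_II)"
proof (rule symmetry_structure.intro)
  fix A B :: "nat \<Rightarrow> nat \<Rightarrow> real \<times> real \<Rightarrow> real" and c :: real and a b :: "real ^ 1" and f
  show "smooth (E_II a)" by (simp add: E_II_def)
  show "linear E_II" by (rule linearI) (simp_all add: E_II_def fun_eq_iff algebra_simps scaleR_fun_def)
  show "jacobi_bracket (E_II a) (E_II b) = E_II (abelian_bracket a b)"
    by (simp add: E_II_def jacobi_bracket_eq sum_4 abelian_bracket_def fun_eq_iff field_simps)
  show "f \<in> cont eq_II \<longleftrightarrow> (\<exists>a. \<exists>A\<in>graded_sum [1, 0, 0]. f = (\<lambda>z. E_II a z + \<Phi>_II A z))"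
    by (blast elim: cont_eq_II_solve intro: cont_eq_II_mem)
  assume A: "A \<in> graded_sum [1, 0, 0]"
  note sm = graded_sum_smooth[OF A]
  show "smooth (\<Phi>_II A)" using sm by (simp add: \<Phi>_II_def)
  show "\<Phi>_II (c *\<^sub>R A) = c *\<^sub>R \<Phi>_II A"
    using sm by (simp add: \<Phi>_II_def ham_def scaleR_apply2 scaleR_fun_def pull_def fun_eq_iff
        algebra_simps)
  show "\<Phi>_II A = (\<lambda>z. 0) \<longleftrightarrow> A \<in> constant_relations [1, 0, 0]"
  proof
    assume 0: "\<Phi>_II A = (\<lambda>z. 0)"
    have d: "pd v (\<Phi>_II A) = (\<lambda>z. 0)" for v by (simp add: 0)
    have p: "D1 (A 0 0) = (\<lambda>z. 0)" "D2 (A 0 0) = (\<lambda>z. 0)" "D1 (A 1 0) = (\<lambda>z. 0)" "D2 (A 1 0) = (\<lambda>z. 0)"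
      "D1 (A 2 0) = (\<lambda>z. 0)" "D2 (A 2 0) = (\<lambda>z. 0)"
      using d[of "ep 1"] d[of "ep 2"] d[of "ep 3"] d[of "ep 4"] d[of "ex 1"] d[of "ex 4"] sm
      by (simp_all add: \<Phi>_II_def ham_def pull_zero_iff pull_neg_zero_iff)
    have "pull v w (\<lambda>z. 0) = (\<lambda>z. 0)" for v w :: jet1 by (simp add: pull_def)
    with p have "D1 (A 0 1) = (\<lambda>z. 0)" "D2 (A 0 1) = (\<lambda>z. 0)"
      using d[of "ex 2"] d[of "ex 3"] sm
      by (simp_all add: \<Phi>_II_def ham_def pull_zero_iff)
    with p have "\<forall>(b, i)\<in>pieces [1, 0, 0]. \<forall>y. A b i y = A b i 0"
      using plane_const_iff[OF sm] by (simp add: pieces_II)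
    moreover have "A 0 1 0 + A 1 0 0 + A 2 0 0 = 0"
      using fun_cong[OF 0, of 0] by (simp add: \<Phi>_II_def pull_zero_arg ham_zero_arg)
    then have "(\<Sum>b<length [1, 0, 0 :: nat]. A b ([1, 0, 0] ! b) 0) = 0" by (simp add: numeral_eq_Suc)
    ultimately show "A \<in> constant_relations [1, 0, 0]" unfolding constant_relations_iff[OF A] by blast
  next
    assume "A \<in> constant_relations [1, 0, 0]"
    then have *: "\<forall>y. A 0 0 y = A 0 0 0" "\<forall>y. A 0 1 y = A 0 1 0" "\<forall>y. A 1 0 y = A 1 0 0" "\<forall>y. A 2 0 y = A
        2 0 0"
      "A 0 1 0 + A 1 0 0 + A 2 0 0 = 0"
      unfolding constant_relations_iff[OF A] by (simp_all add: pieces_II numeral_eq_Suc)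
    then have "D1 (A 0 0) = (\<lambda>z. 0)" "D2 (A 0 0) = (\<lambda>z. 0)"
      using plane_const_iff[OF sm] by simp_all
    then have "\<Phi>_II A z = A 0 1 0 + A 1 0 0 + A 2 0 0" for z
      unfolding \<Phi>_II_def ham_def pull_def using *(2-4) by simp
    then show "\<Phi>_II A = (\<lambda>z. 0)" using *(5) by auto
  qed
  show "\<exists>B\<in>graded_sum [1, 0, 0]. jacobi_bracket (E_II a) (\<Phi>_II A) = \<Phi>_II B"
  proof
    define B where "B = (\<lambda>(b :: nat) (i :: nat).
      if b = 0 then (if i = 0 then (\<lambda>y. a $ 1 * (fst y * D1 (A 0 0) y - A 0 0 y))
        else if i = 1 then (\<lambda>y. a $ 1 * (fst y * D1 (A 0 1) y - A 0 1 y)) else 0)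
      else if b = 1 \<and> i = 0 then (\<lambda>y. a $ 1 * (snd y * D2 (A 1 0) y - A 1 0 y))
      else if b = 2 \<and> i = 0 then (\<lambda>y. a $ 1 * (snd y * D2 (A 2 0) y - A 2 0 y)) else 0)"
    show "B \<in> graded_sum [1, 0, 0]" using sm by (auto simp: graded_sum_def B_def pieces_II)
    have "B 0 0 = (\<lambda>y. a $ 1 * (fst y * D1 (A 0 0) y - A 0 0 y))"
      "B 0 1 = (\<lambda>y. a $ 1 * (fst y * D1 (A 0 1) y - A 0 1 y))"
      "B 1 0 = (\<lambda>y. a $ 1 * (snd y * D2 (A 1 0) y - A 1 0 y))"
      "B 2 0 = (\<lambda>y. a $ 1 * (snd y * D2 (A 2 0) y - A 2 0 y))"
      by (simp_all add: B_def)
    then show "jacobi_bracket (E_II a) (\<Phi>_II A) = \<Phi>_II B"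
      unfolding E_II_def \<Phi>_II_def ham_def using sm
      by (simp add: jacobi_bracket_eq sum_4 D2_D1) (simp add: pull_def fun_eq_iff field_simps)
  qed
  show "E_II a = \<Phi>_II A \<Longrightarrow> a = 0"
  proof -
    assume eq: "E_II a = \<Phi>_II A"
    have e: "DU (E_II a) = (\<lambda>z. a $ 1)" "DU (\<Phi>_II A) = (\<lambda>z. 0)"
      using sm by (simp_all add: E_II_def \<Phi>_II_def ham_def)
    have "(\<lambda>z :: jet1. a $ 1) = (\<lambda>z. 0)" by (rule trans[OF e(1)[symmetric, unfolded eq] e(2)])
    then have "a $ 1 = 0" by (auto dest: fun_cong)
    then show "a = 0" by (simp add: vec_eq_iff)
  qed
  assume B: "B \<in> graded_sum [1, 0, 0]"
  show "\<Phi>_II (A + B) = \<Phi>_II A + \<Phi>_II B"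
    using sm graded_sum_smooth[OF B] by (simp add: \<Phi>_II_def ham_def fun_eq_iff pull_def algebra_simps)
  show "jacobi_bracket (\<Phi>_II A) (\<Phi>_II B) = \<Phi>_II (graded_bracket [1, 0, 0] A B)"
    by (rule \<Phi>_II_bracket[OF A B])
qed

section \<open>The equation III\<close>

lemma pieces_III: "pieces [2, 0] = {(0, 0), (0, Suc 0), (0, 2), (Suc 0, 0)}"
  by (auto simp: pieces_def numeral_eq_Suc less_Suc_eq le_Suc_eq)

text \<open>With the operator M = p3 D1 - x3 D2, the terms added to \<open>ham 1 2 A\<close> are M
  applied twice to A and halved; correspondingly \<open>III1 B\<close> is M applied to B. The
  factors p3 and x3 are conjugate, which makes two elements of grading 1 bracket to one of grading
  2.\<close>

definition III0 :: "(real \<times> real \<Rightarrow> real) \<Rightarrow> jet1 \<Rightarrow> real" where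
  "III0 A = (\<lambda>z. ham 1 2 A z + pullx 1 2 (D1 (D1 A)) z * (pc 3 z)\<^sup>2 / 2
     - pullx 1 2 (D1 (D2 A)) z * xc 3 z * pc 3 z
     + pullx 1 2 (D2 (D2 A)) z * (xc 3 z)\<^sup>2 / 2)"

definition III1 :: "(real \<times> real \<Rightarrow> real) \<Rightarrow> jet1 \<Rightarrow> real" where
  "III1 B = (\<lambda>z. pullx 1 2 (D1 B) z * pc 3 z - pullx 1 2 (D2 B) z * xc 3 z)"

definition \<Phi>_III :: "(nat \<Rightarrow> nat \<Rightarrow> real \<times> real \<Rightarrow> real) \<Rightarrow> jet1 \<Rightarrow> real" where
  "\<Phi>_III A = (\<lambda>z. III0 (A 0 0) z + III1 (A 0 1) z + pullx 1 2 (A 0 2) z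
     + pull (ex 4) (ep 4) (A 1 0) z)"

text \<open>The multiples of \<open>xc 3 z * pc 3 z\<close> balance
  \<open>w = C 2 2 - C 1 1 - 2 * C 3 3\<close> in both generators. Modulo \<open>\<Phi>_III\<close>
  these span the same plane as the scalings x1 u1 - u and x3 u3 - 2u.\<close>

definition E_III :: "real ^ 2 \<Rightarrow> jet1 \<Rightarrow> real" where
  "E_III a = (\<lambda>z. a $ 1 * (uc z - xc 3 z * pc 3 z / 2)
     + a $ 2 * ((xc 1 z) * pc 1 z - xc 3 z * pc 3 z / 2))"

lemma cont_eq_III_solve:
  assumes "f \<in> cont eq_III"
  obtains a A where "A \<in> graded_sum [2, 0]" "f = (\<lambda>z. E_III a z + \<Phi>_III A z)"
proof -
  have f: "smooth f" using assms by (simp add: cont_def)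
  note conds = assms[unfolded cont_eq_III_iff determining_III_def, THEN conjunct2, unfolded
      all_conj_distrib fun_eq_iff[symmetric]]
  have fk: "DU (DP k f) = (\<lambda>z. 0)" for k
    using exhaust_4[of k] dx_zero_imp_pd_eu[of "DP k f" 1] dx_zero_imp_pd_eu[of "DP k f" 4] f conds
    by (auto simp: pd_normal[OF f])
  have fi: "dx i (DU f) = (\<lambda>z. 0)" for i
    using exhaust_4[of i] dx_pd_eu_zero[OF f, of i 1] dx_pd_eu_zero[OF f, of i 4] conds
    by (auto simp: dx_normal[OF f])
  obtain c g where g: "smooth g" "f = (\<lambda>z. g z + c * uc z)" "DU f = (\<lambda>z. c)"
    "DU g = (\<lambda>z. 0)" "\<forall>k. DP k f = DP k g"
    "\<forall>i j. dx i (dx j f) = DX i (DX j g)"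
    "\<forall>i k. dx i (DP k f) = DX i (DP k g)"
    by (rule reduce_u[OF f]) (use fk fi in blast)+
  note conds' = conds[unfolded g(6,7)[rule_format], unfolded g(5)[rule_format] g(3)]
  have c33: "DP 3 (DP 3 g) = (\<lambda>z. - DX 1 (DP 2 g) z)"
    and s33: "DX 3 (DX 3 g) = DX 2 (DP 1 g)"
    and s13: "DX 1 (DX 3 g) = (\<lambda>z. - DX 2 (DP 3 g) z)"
    and w: "(\<lambda>z. c) = (\<lambda>z. DX 2 (DP 2 g) z - DX 1 (DP 1 g) z - 2 * DX 3 (DP 3 g) z)"
    using conds' by blast+
  define cl where "cl v = (if v \<in> {ex 4, ep 4} then 0 else 1 :: nat)" for v
  have "\<forall>v\<in>Basis. \<forall>w\<in>Basis. cl v \<noteq> cl w \<longrightarrow> pd v (pd w g) = (\<lambda>z. 0)"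
    using conds' unfolding Basis_jet_explicit
    by (auto simp: cl_def g(1,4) pd_normal)
  moreover have "\<forall>b\<in>Basis. cl b \<le> 1" by (simp add: cl_def)
  ultimately obtain a where a: "\<forall>n. smooth (a n)" "g = (\<lambda>z. \<Sum>n\<le>1. a n z)"
    "\<forall>n\<le>1. \<forall>b\<in>Basis. pd b (a n) = (if cl b = n then pd b g else (\<lambda>z. 0))"
    using split_labels[OF g(1), of cl 1] by blast
  have "\<exists>A. smooth A \<and> a 0 = pull (ex 4) (ep 4) A"
    using a(3)[THEN spec, of 0] a(1) g(4)
    by (intro factor_pull; simp add: Basis_jet_explicit cl_def; fail)
  then obtain D where D: "smooth D" "a 0 = pull (ex 4) (ep 4) D" by blast
  define h where "h = a 1"
  have h: "smooth h" using a(1) by (simp add: h_def)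
  have pdh: "DX 1 h = DX 1 g" "DX 2 h = DX 2 g" "DX 3 h = DX 3 g" "DP 1 h = DP 1 g"
    "DP 2 h = DP 2 g" "DP 3 h = DP 3 g" "DX 4 h = (\<lambda>z. 0)"
    "DP 4 h = (\<lambda>z. 0)" "DU h = (\<lambda>z. 0)"
    using a(3)[THEN spec, of 1] g(4) by (simp_all add: Basis_jet_explicit cl_def h_def)
  define p where "p = DP 1 g"
  define q where "q = DP 2 g"
  have pq: "smooth p" "smooth q" unfolding p_def q_def using g(1) by simp_all
  have pz: "DX 3 p = (\<lambda>z. 0)" "DX 4 p = (\<lambda>z. 0)" "DU p = (\<lambda>z. 0)" "DP 1 p = (\<lambda>z. 0)"
    "DP 2 p = (\<lambda>z. 0)" "DP 3 p = (\<lambda>z. 0)" "DP 4 p = (\<lambda>z. 0)"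
    and qz: "DX 3 q = (\<lambda>z. 0)" "DX 4 q = (\<lambda>z. 0)" "DU q = (\<lambda>z. 0)" "DP 1 q = (\<lambda>z. 0)"
    "DP 2 q = (\<lambda>z. 0)" "DP 3 q = (\<lambda>z. 0)" "DP 4 q = (\<lambda>z. 0)"
    using conds' by (simp_all add: p_def q_def pd_normal g(1,4))
  \<comment> \<open>Differentiating the relations \<open>w\<close> and \<open>s13\<close> once more
    and eliminating the derivatives of \<open>DX 3 (DP 3 g)\<close> shows that the divergence of (p,
    q) is constant.\<close>
  have e1: "DX 1 (DX 2 q) z - DX 1 (DX 1 p) z - 2 * DX 1 (DX 3 (DP 3 g)) z = 0" for z
    using fun_cong[OF arg_cong[OF w, of "DX 1"], of z] g(1) by (simp add: p_def q_def)
  have e2: "DX 1 (DX 3 (DP 3 g)) z = DX 1 (DX 2 q) z" for z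
    using fun_cong[OF arg_cong[OF s13, of "DP 3"], of z] g(1) by (simp add: pd_normal c33 q_def)
  have e3: "DX 2 (DX 2 q) z - DX 1 (DX 2 p) z - 2 * DX 2 (DX 3 (DP 3 g)) z = 0" for z
    using fun_cong[OF arg_cong[OF w, of "DX 2"], of z] g(1) by (simp add: p_def q_def pd_normal)
  have e4: "DX 1 (DX 2 p) z = - DX 2 (DX 3 (DP 3 g)) z" for z
    using fun_cong[OF arg_cong[OF s13, of "DX 3"], of z] g(1) by (simp add: pd_normal s33 p_def)
  define s where "s = (\<lambda>z. DX 1 p z + DX 2 q z)"
  have s: "smooth s" unfolding s_def using pq by simp
  have "DX 1 s = (\<lambda>z. 0)"
  proof
    fix z show "DX 1 s z = 0" unfolding s_def using pq e1[of z] e2[of z] by simp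
  qed
  moreover have "DX 2 s = (\<lambda>z. 0)"
  proof
    fix z show "DX 2 s z = 0" unfolding s_def using pq e3[of z] e4[of z] by (simp add: pd_normal)
  qed
  moreover have "pd v s = (\<lambda>z. 0)" if "pd v p = (\<lambda>z. 0)" "pd v q = (\<lambda>z. 0)" for v
    unfolding s_def using pq that by (simp add: pd_pd_zero)
  ultimately have "\<forall>b\<in>Basis. pd b s = (\<lambda>z. 0)" using pz qz unfolding Basis_jet_explicit by simp
  then have "s z = s 0" for z using all_partials_zero_const[OF s] by blast
  then obtain m where m: "\<And>z. DX 1 p z + DX 2 q z = m" unfolding s_def by blast
  have "\<exists>A. smooth A \<and> pullx 1 2 (D2 A) = (\<lambda>z. p z - m * xc 1 z) \<and>
      pullx 1 2 (D1 A) = (\<lambda>z. - q z)"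
    using pq pz qz m by (intro jet_plane_potential) (simp_all add: Basis_jet_explicit algebra_simps)
  then obtain A where A: "smooth A" "pullx 1 2 (D2 A) = (\<lambda>z. p z - m * xc 1 z)"
    "pullx 1 2 (D1 A) = (\<lambda>z. - q z)" by blast
  have A2: "pullx 1 2 (D1 (D1 A)) = (\<lambda>z. - DX 1 q z)"
    "pullx 1 2 (D1 (D2 A)) = (\<lambda>z. - DX 2 q z)" "pullx 1 2 (D2 (D2 A)) = DX 2 p"
    using arg_cong[OF A(3), of "DX 1"] arg_cong[OF A(3), of "DX 2"] arg_cong[OF A(2), of "DX 2"] A(1) pq
    by (simp_all add: D2_D1)
  \<comment> \<open>This is h minus \<open>III0 A\<close> and minus the momentum part of the
    scalings with coefficients c and m. What remains is affine in x3 and p3 and depends otherwise on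
    x1, x2 only.\<close>
  define k where "k = (\<lambda>z. h z - p z * pc 1 z - q z * pc 2 z + DX 1 q z * (pc 3 z)\<^sup>2 / 2
    - DX 2 q z * xc 3 z * pc 3 z - DX 2 p z * (xc 3 z)\<^sup>2 / 2
    + (m + c) / 2 * xc 3 z * pc 3 z)"
  have k: "smooth k" unfolding k_def using h pq by simp
  have zz: "pd v (pd w p) = (\<lambda>z. 0)" if "pd v p = (\<lambda>z. 0)" for v w using pd_pd_zero[OF pq(1) that] .
  have zz': "pd v (pd w q) = (\<lambda>z. 0)" if "pd v q = (\<lambda>z. 0)" for v w using pd_pd_zero[OF pq(2) that] .
  have k0: "DP 1 k = (\<lambda>z. 0)" "DP 2 k = (\<lambda>z. 0)" "DP 4 k = (\<lambda>z. 0)" "DX 4 k = (\<lambda>z. 0)" "DU k = (\<lambda>z. 0)"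
    unfolding k_def using h pq by (simp_all add: pz qz zz zz' pdh, simp_all add: p_def q_def)
  have kp: "DP 3 k = (\<lambda>z. DP 3 g z + DX 1 q z * pc 3 z - DX 2 q z * xc 3 z + (m + c) / 2 * xc 3 z)"
    and kx: "DX 3 k = (\<lambda>z. DX 3 g z - DX 2 q z * pc 3 z - DX 2 p z * xc 3 z + (m + c) / 2 * pc 3 z)"
    unfolding k_def using h pq by (simp_all add: pz qz zz zz' pdh fun_eq_iff)
  have k33: "DP 3 (DP 3 k) = (\<lambda>z. 0)"
    unfolding kp using g(1) pq by (simp add: pz qz zz zz' c33 q_def[symmetric])
  have kx3: "DX 3 (DX 3 k) = (\<lambda>z. 0)"
    unfolding kx using g(1) pq by (simp add: pz qz zz zz' s33 p_def[symmetric])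
  have w': "2 * DX 3 (DP 3 g) z = 2 * DX 2 q z - m - c" for z
    using fun_cong[OF w, of z] m[of z] by (simp add: p_def q_def)
  have kx33: "DX 3 (DP 3 k) = (\<lambda>z. 0)"
  proof
    fix z show "DX 3 (DP 3 k) z = 0"
      unfolding kp using g(1) pq w'[of z] by (simp add: pz qz zz zz' field_simps)
  qed
  have kxp: "DP 3 (DX 3 k) = (\<lambda>z. 0)" using kx33 pd_normal(1)[OF k] by simp
  have kk: "DX 1 (DX 3 k) z + DX 2 (DP 3 k) z = 0" for z
  proof -
    have "DX 2 (DX 2 q) z = - DX 1 (DX 2 p) z" using e3[of z] e4[of z] by simp
    then show ?thesis unfolding kp kx using g(1) pq
      by (simp add: pd_normal(3) s13)
  qed
  have "\<exists>B. smooth B \<and> pullx 1 2 (D2 B) = DX 3 k \<and> pullx 1 2 (D1 B) = (\<lambda>z. - DP 3 k z)"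
    using k0 k33 kx3 kx33 kxp kk k
    by (intro jet_plane_potential) (simp_all add: Basis_jet_explicit pd_pd_zero[OF k])
  then obtain B where B: "smooth B" "pullx 1 2 (D2 B) = DX 3 k" "pullx 1 2 (D1 B) = (\<lambda>z. - DP 3 k z)"
    by blast
  define l where "l = (\<lambda>z. k z - DP 3 k z * pc 3 z - DX 3 k z * xc 3 z)"
  have "\<exists>C. smooth C \<and> l = pullx 1 2 C"
    unfolding l_def using k k0 k33 kx3 kx33 kxp
    by (intro factor_pull) (simp_all add: Basis_jet_explicit pd_pd_zero[OF k])
  then obtain C where C: "smooth C" "l = pullx 1 2 C" by blast
  \<comment> \<open>In \<open>III1\<close> the coefficient of \<open>pc 3\<close> is
    \<open>D1\<close>, whereas \<open>D1 B\<close> is minus \<open>DP 3 k\<close>; so the component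
    of grading 1 is -B.\<close>
  have smB: "smooth (\<lambda>y. - B y)" using B by simp
  define F where "F = (\<lambda>(b :: nat) (i :: nat). if b = 0 then (if i = 0 then A else if i = 1 then (\<lambda>y. - B
      y)
    else if i = 2 then C else 0) else if b = 1 \<and> i = 0 then D else 0)"
  have "F \<in> graded_sum [2, 0]"
    using A(1) smB C(1) D(1) by (auto simp: graded_sum_def pieces_III F_def)
  moreover have "(\<Sum>n\<le>1. a n z) = a 0 z + h z" for z by (simp add: h_def)
  moreover have "III1 (\<lambda>y. - B y) = (\<lambda>z. DP 3 k z * pc 3 z + DX 3 k z * xc 3 z)"
    using B by (simp add: III1_def fun_eq_iff) (simp add: pull_def)
  then have "f = (\<lambda>z. E_III (vector [c, m]) z + \<Phi>_III F z)"
    unfolding g(2) a(2) calculation(2)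
    by (simp add: E_III_def \<Phi>_III_def F_def D(2) III0_def ham_def A A2 fun_eq_iff flip: C(2))
      (simp add: l_def k_def field_simps)
  ultimately show ?thesis using that by blast
qed

lemma cont_eq_III_mem:
  assumes A: "A \<in> graded_sum [2, 0]"
  shows "(\<lambda>z. E_III a z + \<Phi>_III A z) \<in> cont eq_III"
  unfolding cont_eq_III_iff determining_III_def E_III_def \<Phi>_III_def III0_def III1_def ham_def dx_def
  using graded_sum_smooth[OF A] by (simp add: D2_D1 algebra_simps)

lemma \<Phi>_III_bracket:
  assumes A: "A \<in> graded_sum [2, 0]" and B: "B \<in> graded_sum [2, 0]"
  shows "jacobi_bracket (\<Phi>_III A) (\<Phi>_III B) = \<Phi>_III (graded_bracket [2, 0] A B)"
proof -
  note sm = graded_sum_smooth[OF A] graded_sum_smooth[OF B]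
  have "graded_bracket [2, 0] A B 0 0 = poisson (A 0 0) (B 0 0)"
    "graded_bracket [2, 0] A B 1 0 = poisson (A 1 0) (B 1 0)"
    "graded_bracket [2, 0] A B 0 1 = (\<lambda>z. poisson (A 0 0) (B 0 1) z + poisson (A 0 1) (B 0 0) z)"
    "graded_bracket [2, 0] A B 0 2 = (\<lambda>z. poisson (A 0 0) (B 0 2) z + poisson (A 0 1) (B 0 1) z + poisson
        (A 0 2) (B 0 0) z)"
    by (simp_all add: graded_bracket_def pieces_III plus_fun_def, simp_all add: numeral_eq_Suc
        plus_fun_def)
  then show ?thesis
    unfolding \<Phi>_III_def III0_def III1_def ham_def using sm
    by (simp add: jacobi_bracket_eq sum_4 poisson_eq D2_D1)
      (simp add: pull_def fun_eq_iff algebra_simps add_divide_distrib diff_divide_distrib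
          power2_eq_square)
qed

lemma structure_III: "symmetry_structure [2, 0] \<Phi>_III E_III abelian_bracket (cont eq_III)"
proof (rule symmetry_structure.intro)
  fix A B :: "nat \<Rightarrow> nat \<Rightarrow> real \<times> real \<Rightarrow> real" and c :: real and a b :: "real ^ 2" and f
  show "smooth (E_III a)" by (simp add: E_III_def)
  show "linear E_III" by (rule linearI) (simp_all add: E_III_def fun_eq_iff field_simps scaleR_fun_def)
  show "jacobi_bracket (E_III a) (E_III b) = E_III (abelian_bracket a b)"
    by (simp add: E_III_def jacobi_bracket_eq sum_4 abelian_bracket_def fun_eq_iff field_simps)
  show "f \<in> cont eq_III \<longleftrightarrow> (\<exists>a. \<exists>A\<in>graded_sum [2, 0]. f = (\<lambda>z. E_III a z + \<Phi>_III A z))"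
    by (blast elim: cont_eq_III_solve intro: cont_eq_III_mem)
  assume A: "A \<in> graded_sum [2, 0]"
  note sm = graded_sum_smooth[OF A]
  show "smooth (\<Phi>_III A)" using sm by (simp add: \<Phi>_III_def III0_def III1_def)
  show "\<Phi>_III (c *\<^sub>R A) = c *\<^sub>R \<Phi>_III A"
    using sm by (simp add: \<Phi>_III_def III0_def III1_def ham_def scaleR_apply2 scaleR_fun_def pull_def
        fun_eq_iff algebra_simps)
  show "\<Phi>_III A = (\<lambda>z. 0) \<longleftrightarrow> A \<in> constant_relations [2, 0]"
  proof
    assume 0: "\<Phi>_III A = (\<lambda>z. 0)"
    have d: "pd v (\<Phi>_III A) = (\<lambda>z. 0)" for v by (simp add: 0)
    have pz: "pull v w (\<lambda>z. 0) = (\<lambda>z. 0)" for v w :: jet1 by (simp add: pull_def)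
    have p: "D1 (A 0 0) = (\<lambda>z. 0)" "D2 (A 0 0) = (\<lambda>z. 0)" "D1 (A 1 0) = (\<lambda>z. 0)" "D2 (A 1 0) = (\<lambda>z. 0)"
      using d[of "ep 1"] d[of "ep 2"] d[of "ex 4"] d[of "ep 4"] sm
      by (simp_all add: \<Phi>_III_def III0_def III1_def ham_def pull_zero_iff pull_neg_zero_iff)
    have p': "D1 (A 0 1) = (\<lambda>z. 0)" "D2 (A 0 1) = (\<lambda>z. 0)"
      using d[of "ep 3"] d[of "ex 3"] sm p
      by (simp_all add: \<Phi>_III_def III0_def III1_def ham_def pz pull_zero_iff pull_neg_zero_iff)
    have "D1 (A 0 2) = (\<lambda>z. 0)" "D2 (A 0 2) = (\<lambda>z. 0)"
      using d[of "ex 1"] d[of "ex 2"] sm p p'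
      by (simp_all add: \<Phi>_III_def III0_def III1_def ham_def pz pull_zero_iff)
    with p p' have "\<forall>(b, i)\<in>pieces [2, 0]. \<forall>y. A b i y = A b i 0"
      using plane_const_iff[OF sm] by (simp add: pieces_III)
    moreover have "A 0 2 0 + A 1 0 0 = 0"
      using fun_cong[OF 0, of 0] by (simp add: \<Phi>_III_def III0_def III1_def pull_zero_arg ham_zero_arg)
    then have "(\<Sum>b<length [2, 0 :: nat]. A b ([2, 0] ! b) 0) = 0" by simp
    ultimately show "A \<in> constant_relations [2, 0]" unfolding constant_relations_iff[OF A] by blast
  next
    assume "A \<in> constant_relations [2, 0]"
    then have *: "\<forall>y. A 0 0 y = A 0 0 0" "\<forall>y. A 0 1 y = A 0 1 0" "\<forall>y. A 1 0 y = A 1 0 0" "\<forall>y. A 0 2 y = A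
        0 2 0"
      "A 0 2 0 + A 1 0 0 = 0"
      unfolding constant_relations_iff[OF A] by (simp_all add: pieces_III)
    then have "D1 (A 0 0) = (\<lambda>z. 0)" "D2 (A 0 0) = (\<lambda>z. 0)" "D1 (A 0 1) = (\<lambda>z. 0)" "D2 (A 0 1) = (\<lambda>z. 0)"
      using plane_const_iff[OF sm] by simp_all
    then have "\<Phi>_III A z = A 0 2 0 + A 1 0 0" for z
      unfolding \<Phi>_III_def III0_def III1_def ham_def pull_def using *(3,4) by simp
    then show "\<Phi>_III A = (\<lambda>z. 0)" using *(5) by auto
  qed
  show "\<exists>B\<in>graded_sum [2, 0]. jacobi_bracket (E_III a) (\<Phi>_III A) = \<Phi>_III B"
  proof
    define B where "B = (\<lambda>(b :: nat) (i :: nat).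
      if b = 0 then (if i = 0 then (\<lambda>y. a $ 2 * (A 0 0 y - fst y * D1 (A 0 0) y))
        else if i = 1 then (\<lambda>y. - a $ 1 * A 0 1 y / 2 + a $ 2 * (A 0 1 y / 2 - fst y * D1 (A 0 1) y))
        else if i = 2 then (\<lambda>y. - a $ 1 * A 0 2 y - a $ 2 * fst y * D1 (A 0 2) y) else 0)
      else if b = 1 \<and> i = 0 then (\<lambda>y. a $ 1 * (snd y * D2 (A 1 0) y - A 1 0 y)) else 0)"
    show "B \<in> graded_sum [2, 0]" using sm by (auto simp: graded_sum_def B_def pieces_III)
    have "B 0 0 = (\<lambda>y. a $ 2 * (A 0 0 y - fst y * D1 (A 0 0) y))"
      "B 0 1 = (\<lambda>y. - a $ 1 * A 0 1 y / 2 + a $ 2 * (A 0 1 y / 2 - fst y * D1 (A 0 1) y))"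
      "B 0 2 = (\<lambda>y. - a $ 1 * A 0 2 y - a $ 2 * fst y * D1 (A 0 2) y)"
      "B 1 0 = (\<lambda>y. a $ 1 * (snd y * D2 (A 1 0) y - A 1 0 y))"
      by (simp_all add: B_def)
    then show "jacobi_bracket (E_III a) (\<Phi>_III A) = \<Phi>_III B"
      unfolding E_III_def \<Phi>_III_def III0_def III1_def ham_def using sm
      by (simp add: jacobi_bracket_eq sum_4 D2_D1) (simp add: pull_def fun_eq_iff field_simps
          power2_eq_square)
  qed
  show "E_III a = \<Phi>_III A \<Longrightarrow> a = 0"
  proof -
    assume eq: "E_III a = \<Phi>_III A"
    have e: "DU (E_III a) = (\<lambda>z. a $ 1)" "DU (\<Phi>_III A) = (\<lambda>z. 0)"
      "(\<lambda>z. DX 1 (DP 1 (E_III a)) z + DX 2 (DP 2 (E_III a)) z) = (\<lambda>z. a $ 2)"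
      "(\<lambda>z. DX 1 (DP 1 (\<Phi>_III A)) z + DX 2 (DP 2 (\<Phi>_III A)) z) = (\<lambda>z. 0)"
      using sm by (simp_all add: E_III_def \<Phi>_III_def III0_def III1_def ham_def D2_D1)
    have "(\<lambda>z :: jet1. a $ 1) = (\<lambda>z. 0)" by (rule trans[OF e(1)[symmetric, unfolded eq] e(2)])
    moreover have "(\<lambda>z :: jet1. a $ 2) = (\<lambda>z. 0)" by (rule trans[OF e(3)[symmetric, unfolded eq] e(4)])
    ultimately have "a $ 1 = 0" "a $ 2 = 0" by (auto dest: fun_cong)
    then show "a = 0" by (simp add: vec_eq_iff forall_2)
  qed
  assume B: "B \<in> graded_sum [2, 0]"
  show "\<Phi>_III (A + B) = \<Phi>_III A + \<Phi>_III B"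
    using sm graded_sum_smooth[OF B] by (simp add: \<Phi>_III_def III0_def III1_def ham_def fun_eq_iff
        pull_def algebra_simps add_divide_distrib)
  show "jacobi_bracket (\<Phi>_III A) (\<Phi>_III B) = \<Phi>_III (graded_bracket [2, 0] A B)"
    by (rule \<Phi>_III_bracket[OF A B])
qed

section \<open>The equation N\<close>

lemma dx_minus [simp]: "smooth f \<Longrightarrow> dx i (\<lambda>z. - f z) = (\<lambda>z. - dx i f z)"
  using dx_cmult[of f i "-1"] by simp

lemma dx_diff [simp]: "smooth f \<Longrightarrow> smooth g \<Longrightarrow> dx i (\<lambda>z. f z - g z) = (\<lambda>z. dx i f z - dx i g z)"
  using dx_add[of f "\<lambda>z. - g z"] by simp

lemma const_if_partials:
  assumes "smooth s" "\<forall>b\<in>Basis. pd b s = (\<lambda>z. 0)" obtains m where "\<forall>z. s z = m"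
  using all_partials_zero_const[OF assms(1)] assms(2) by metis

text \<open>The determining equations of N relate the second derivatives in x to mixed ones instead
  of making them vanish, so \<open>dx_pd_eu_zero\<close> does not apply. The last four conclusions
  come out of the same elimination that makes f_u constant; they are what later forces the weights
  of the scalings to be constants.\<close>

lemma cont_eq_N_reduce:
  assumes "f \<in> cont eq_N"
  obtains c g where "smooth g" "f = (\<lambda>z. g z + c * uc z)" "DU g = (\<lambda>z. 0)"
    "\<forall>k l. DP l (DP k g) = (\<lambda>z. 0)"
    "DX 2 (DP 4 g) = (\<lambda>z. 0)" "DX 1 (DP 3 g) = (\<lambda>z. 0)"
    "DX 2 (DP 3 g) = (\<lambda>z. 0)" "DX 1 (DP 4 g) = (\<lambda>z. 0)"
    "DX 2 (DP 1 g) = DX 3 (DP 4 g)" "DX 1 (DP 2 g) = DX 4 (DP 3 g)"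
    "DX 1 (DX 3 g) = DX 2 (DX 4 g)"
    "\<forall>z. DX 3 (DP 3 g) z = DX 2 (DP 2 g) z + DX 4 (DP 4 g) z - DX 1 (DP 1 g) z"
    "\<forall>z. c = DX 4 (DP 4 g) z - 2 * DX 1 (DP 1 g) z - DX 2 (DP 2 g) z"
    "\<forall>z. 2 * DX 1 (DX 2 g) z = DX 4 (DP 1 g) z - DX 3 (DP 2 g) z"
    "DX 1 (DX 1 g) = (\<lambda>z. - DX 4 (DP 2 g) z)"
    "DX 2 (DX 2 g) = DX 3 (DP 1 g)"
    "\<forall>z. DX 3 (DX 3 (DP 3 g)) z = - DX 3 (DX 4 (DP 4 g)) z"
    "\<forall>z. DX 3 (DX 4 (DP 3 g)) z = - DX 4 (DX 4 (DP 4 g)) z"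
    "\<forall>z. DX 1 (DX 3 (DP 1 g)) z = DX 3 (DX 4 (DP 4 g)) z"
    "\<forall>z. DX 1 (DX 4 (DP 1 g)) z = DX 4 (DX 4 (DP 4 g)) z"
proof -
  have f: "smooth f" using assms by (simp add: cont_def)
  note conds = assms[unfolded cont_eq_N_iff determining_N_def, THEN conjunct2, unfolded all_conj_distrib
      fun_eq_iff[symmetric]]
  define a where "a k = DP k f" for k
  have sa: "smooth (a k)" for k unfolding a_def using f by simp
  note conds1 = conds[folded a_def]
  have ap: "DP l (a k) = (\<lambda>z. 0)" for l k
    unfolding a_def using exhaust_4[of k] exhaust_4[of l] conds by (auto simp: pd_normal[OF f])
  have au34: "DU (a 3) = (\<lambda>z. 0)" "DU (a 4) = (\<lambda>z. 0)"
    using dx_zero_imp_pd_eu[OF sa, of 1 3] dx_zero_imp_pd_eu[OF sa, of 2 4] conds1 by (simp_all add: ap)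
  \<comment> \<open>\<open>DP 2\<close> produces a \<open>DU\<close> term only on the left of the
    first relation, and \<open>DP 1\<close> only on the left of the second.\<close>
  have "dx 2 (a 1) = dx 3 (a 4)" "dx 1 (a 2) = dx 4 (a 3)" using conds1 by simp_all
  from arg_cong[OF this(1), of "DP 2"] arg_cong[OF this(2), of "DP 1"]
  have au12: "DU (a 1) = (\<lambda>z. 0)" "DU (a 2) = (\<lambda>z. 0)"
    by (simp_all add: pd_ep_dx[OF sa] ap)
  have au: "DU (a k) = (\<lambda>z. 0)" for k using exhaust_4[of k] au12 au34 by auto
  have dxa: "dx i (a k) = DX i (a k)" for i k by (rule dx_eq_pd[OF au])
  have dxa2: "dx i (DX j (a k)) = DX i (DX j (a k))" for i j k
    by (rule dx_eq_pd) (simp add: pd_pd_zero[OF sa au])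
  note conds2 = conds1[unfolded dxa]
  define c where "c = DU f"
  note conds3 = conds2[folded c_def]
  have sc: "smooth c" unfolding c_def using f by simp
  have cp: "DP k c = (\<lambda>z. 0)" for k using au[of k] pd_commute[OF f, of "ep k" eu] by (simp add: c_def
      a_def)
  have z34: "DX 1 (a 3) = (\<lambda>z. 0)" "DX 2 (a 3) = (\<lambda>z. 0)" "DX 1 (a 4) = (\<lambda>z. 0)" "DX 2 (a 4) = (\<lambda>z. 0)"
    using conds2 by simp_all
  have ddx: "DP k (dx i (dx j f)) = (\<lambda>z. DX i (DX j (a k)) z + (if j = k then dx i c z else 0)
      + (if i = k then dx j c z else 0))" for i j k
    using f by (cases "j = k") (auto simp: pd_ep_dx pd_eu_dx fun_eq_iff dxa dxa2 a_def[symmetric]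
        c_def[symmetric] sa sc)
  have s13: "dx 1 (dx 3 f) = dx 2 (dx 4 f)" using conds by simp
  have c1: "dx 1 c = (\<lambda>z. 0)"
    using arg_cong[OF s13, of "DP 3"] unfolding ddx by (simp add: z34 pd_pd_zero[OF sa] pd_normal[OF sa])
  have c2: "dx 2 c = (\<lambda>z. 0)"
    using arg_cong[OF s13, of "DP 4"] unfolding ddx by (simp add: z34 pd_pd_zero[OF sa] pd_normal[OF sa]
        fun_eq_iff)
  have r3: "DX 1 (DX 3 (a 1)) z + dx 3 c z = DX 2 (DX 4 (a 1)) z" for z
    using fun_cong[OF arg_cong[OF s13, of "DP 1"], of z] unfolding ddx by simp
  have r4: "DX 1 (DX 3 (a 2)) z = DX 2 (DX 4 (a 2)) z + dx 4 c z" for z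
    using fun_cong[OF arg_cong[OF s13, of "DP 2"], of z] unfolding ddx by simp
  have cu: "DU c = (\<lambda>z. 0)"
    by (rule dx_zero_imp_pd_eu[OF sc c1]) (simp add: cp)
  have dxc: "dx i c = DX i c" for i by (rule dx_eq_pd[OF cu])
  have s11: "dx 1 (dx 1 f) = (\<lambda>z. - DX 4 (a 2) z)" and s22: "dx 2 (dx 2 f) = DX 3 (a 1)"
    and a23: "DX 3 (a 2) = (\<lambda>z. DX 4 (a 1) z - 2 * dx 1 (dx 2 f) z)"
    and a12: "DX 2 (a 1) = DX 3 (a 4)" "DX 1 (a 2) = DX 4 (a 3)"
    and a33: "DX 3 (a 3) = (\<lambda>z. DX 2 (a 2) z + DX 4 (a 4) z - DX 1 (a 1) z)"
    and cc: "c = (\<lambda>z. DX 4 (a 4) z - 2 * DX 1 (a 1) z - DX 2 (a 2) z)"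
    using conds3 by blast+
  \<comment> \<open>Third-order consequences of the determining equations. They form two linear
    systems, one for the derivatives of c and of the coefficients that involve x3 and one for those
    that involve x4, solved in \<open>c3\<close> and \<open>c4\<close>.\<close>
  have t1: "dx 1 (dx 1 (dx 2 f)) z = - DX 2 (DX 4 (a 2)) z" for z
    using fun_cong[OF arg_cong[OF s11, of "dx 2"], of z] f by (simp add: dx_normal sa dxa2)
  have t2: "DX 1 (DX 3 (a 2)) z = DX 1 (DX 4 (a 1)) z - 2 * dx 1 (dx 1 (dx 2 f)) z" for z
    using fun_cong[OF arg_cong[OF a23, of "dx 1"], of z] f by (simp add: dx_normal sa dxa2)
  have t3: "dx 1 (dx 2 (dx 2 f)) z = DX 1 (DX 3 (a 1)) z" for z
    using fun_cong[OF arg_cong[OF s22, of "dx 1"], of z] f by (simp add: dx_normal sa dxa2)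
  have t4: "DX 2 (DX 3 (a 2)) z = DX 2 (DX 4 (a 1)) z - 2 * dx 1 (dx 2 (dx 2 f)) z" for z
    using fun_cong[OF arg_cong[OF a23, of "dx 2"], of z] f by (simp add: dx_normal sa dxa2)
  have t5: "DX 2 (DX 4 (a 1)) z = DX 3 (DX 4 (a 4)) z" for z
    using fun_cong[OF arg_cong[OF a12(1), of "DX 4"], of z] by (simp add: pd_normal[OF sa])
  have t6: "DX 1 (DX 3 (a 2)) z = DX 3 (DX 4 (a 3)) z" for z
    using fun_cong[OF arg_cong[OF a12(2), of "DX 3"], of z] by (simp add: pd_normal[OF sa])
  have t7: "DX 3 (DX 3 (a 3)) z = DX 2 (DX 3 (a 2)) z + DX 3 (DX 4 (a 4)) z - DX 1 (DX 3 (a 1)) z" for z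
    using fun_cong[OF arg_cong[OF a33, of "DX 3"], of z] by (simp add: pd_normal[OF sa] sa)
  have t8: "DX 3 (DX 4 (a 3)) z = DX 2 (DX 4 (a 2)) z + DX 4 (DX 4 (a 4)) z - DX 1 (DX 4 (a 1)) z" for z
    using fun_cong[OF arg_cong[OF a33, of "DX 4"], of z] by (simp add: pd_normal[OF sa] sa)
  have t9: "dx 3 c z = DX 3 (DX 4 (a 4)) z - 2 * DX 1 (DX 3 (a 1)) z - DX 2 (DX 3 (a 2)) z" for z
    using fun_cong[OF arg_cong[OF cc, of "DX 3"], of z] by (simp add: pd_normal[OF sa] sa dxc)
  have t10: "dx 4 c z = DX 4 (DX 4 (a 4)) z - 2 * DX 1 (DX 4 (a 1)) z - DX 2 (DX 4 (a 2)) z" for z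
    using fun_cong[OF arg_cong[OF cc, of "DX 4"], of z] by (simp add: pd_normal[OF sa] sa dxc)
  have c3: "dx 3 c z = 0" "DX 3 (DX 3 (a 3)) z = - DX 3 (DX 4 (a 4)) z"
    "DX 1 (DX 3 (a 1)) z = DX 3 (DX 4 (a 4)) z" for z
    using r3[of z] t3[of z] t4[of z] t5[of z] t7[of z] t9[of z] by linarith+
  have c4: "dx 4 c z = 0" "DX 3 (DX 4 (a 3)) z = - DX 4 (DX 4 (a 4)) z"
    "DX 1 (DX 4 (a 1)) z = DX 4 (DX 4 (a 4)) z" for z
    using r4[of z] t1[of z] t2[of z] t6[of z] t8[of z] t10[of z] by linarith+
  have "dx 3 c = (\<lambda>z. 0)" "dx 4 c = (\<lambda>z. 0)" using c3(1) c4(1) by auto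
  then have fi: "dx i (DU f) = (\<lambda>z. 0)" for i
    using exhaust_4[of i] c1 c2 by (auto simp flip: c_def)
  have fk: "DU (DP k f) = (\<lambda>z. 0)" for k using au by (simp add: a_def)
  obtain d g where g: "smooth g" "f = (\<lambda>z. g z + d * uc z)" "DU f = (\<lambda>z. d)"
    "DU g = (\<lambda>z. 0)" "\<forall>k. DP k f = DP k g"
    "\<forall>i j. dx i (dx j f) = DX i (DX j g)"
    "\<forall>i k. dx i (DP k f) = DX i (DP k g)"
    by (rule reduce_u[OF f]) (use fk fi in blast)+
  have ag: "a k = DP k g" for k using g(5) by (simp add: a_def)
  have cd: "c = (\<lambda>z. d)" using g(3) by (simp add: c_def)
  have 1: "\<forall>k l. DP l (DP k g) = (\<lambda>z. 0)" using ap ag by simp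
  have 2: "\<forall>z. DX 3 (a 3) z = DX 2 (a 2) z + DX 4 (a 4) z - DX 1 (a 1) z"
    "\<forall>z. d = DX 4 (a 4) z - 2 * DX 1 (a 1) z - DX 2 (a 2) z"
    using fun_cong[OF a33] fun_cong[OF cc] by (auto simp: cd)
  have 3: "\<forall>z. 2 * DX 1 (DX 2 g) z = DX 4 (a 1) z - DX 3 (a 2) z"
    using fun_cong[OF a23] g(6) by simp
  have 4: "DX 1 (DX 3 g) = DX 2 (DX 4 g)" using s13 g(6) by simp
  have 5: "DX 1 (DX 1 g) = (\<lambda>z. - DX 4 (a 2) z)" "DX 2 (DX 2 g) = DX 3 (a 1)"
    using s11 s22 g(6) by simp_all
  have 6: "\<forall>z. DX 3 (DX 3 (a 3)) z = - DX 3 (DX 4 (a 4)) z"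
    "\<forall>z. DX 3 (DX 4 (a 3)) z = - DX 4 (DX 4 (a 4)) z"
    "\<forall>z. DX 1 (DX 3 (a 1)) z = DX 3 (DX 4 (a 4)) z"
    "\<forall>z. DX 1 (DX 4 (a 1)) z = DX 4 (DX 4 (a 4)) z"
    using c3(2,3) c4(2,3) by blast+
  show ?thesis
    by (rule that[OF g(1,2,4) 1 z34(4,1,2,3)[unfolded ag] a12[unfolded ag] 4 2[unfolded ag] 3[unfolded
        ag]
          5[unfolded ag] 6[unfolded ag]])
qed

lemma pieces_N: "pieces [3] = {(0, 0), (0, Suc 0), (0, 2), (0, 3)}"
  by (auto simp: pieces_def numeral_eq_Suc less_Suc_eq le_Suc_eq)

text \<open>With \<open>L = x\<^sup>1\<partial>\<^sub>4 + x\<^sup>2\<partial>\<^sub>3\<close> acting on functions of \<open>(x\<^sup>3, x\<^sup>4)\<close>, the pieces are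
  \<open>A\<^sub>4p\<^sub>3 - A\<^sub>3p\<^sub>4 + (LA)\<^sub>4p\<^sub>2 - (LA)\<^sub>3p\<^sub>1 - L\<^sup>3A/6\<close>, \<open>B\<^sub>4p\<^sub>2 - B\<^sub>3p\<^sub>1 - L\<^sup>2B/2\<close>, \<open>- LC\<close> and \<open>- D\<close>.\<close>

definition N0 :: "(real \<times> real \<Rightarrow> real) \<Rightarrow> jet1 \<Rightarrow> real" where
  "N0 A = (\<lambda>z. ham 3 4 A z
     + ((xc 1 z) * pullx 3 4 (D2 (D2 A)) z + xc 2 z * pullx 3 4 (D1 (D2 A)) z) * pc 2 z
     - ((xc 1 z) * pullx 3 4 (D1 (D2 A)) z + xc 2 z * pullx 3 4 (D1 (D1 A)) z) * pc 1 z
     - ((xc 1 z) ^ 3 * pullx 3 4 (D2 (D2 (D2 A))) z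
       + 3 * (xc 1 z)\<^sup>2 * xc 2 z * pullx 3 4 (D1 (D2 (D2 A))) z
       + 3 * xc 1 z * (xc 2 z)\<^sup>2 * pullx 3 4 (D1 (D1 (D2 A))) z
       + xc 2 z ^ 3 * pullx 3 4 (D1 (D1 (D1 A))) z) / 6)"

definition N1 :: "(real \<times> real \<Rightarrow> real) \<Rightarrow> jet1 \<Rightarrow> real" where
  "N1 B = (\<lambda>z. pullx 3 4 (D2 B) z * pc 2 z - pullx 3 4 (D1 B) z * pc 1 z
     - ((xc 1 z)\<^sup>2 * pullx 3 4 (D2 (D2 B)) z
       + 2 * xc 1 z * xc 2 z * pullx 3 4 (D1 (D2 B)) z
       + (xc 2 z)\<^sup>2 * pullx 3 4 (D1 (D1 B)) z) / 2)"

definition N2 :: "(real \<times> real \<Rightarrow> real) \<Rightarrow> jet1 \<Rightarrow> real" where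
  "N2 C = (\<lambda>z. - ((xc 1 z) * pullx 3 4 (D2 C) z + xc 2 z * pullx 3 4 (D1 C) z))"

definition \<Phi>_N :: "(nat \<Rightarrow> nat \<Rightarrow> real \<times> real \<Rightarrow> real) \<Rightarrow> jet1 \<Rightarrow> real" where
  "\<Phi>_N A = (\<lambda>z. N0 (A 0 0) z + N1 (A 0 1) z + N2 (A 0 2) z - pullx 3 4 (A 0 3) z)"

text \<open>The u coefficients 1 and -3 are dictated by
  \<open>w = C 4 4 - 2 * C 1 1 - C 2 2\<close>. In the third generator the derivatives
  \<open>C 4 1\<close> and \<open>C 3 2\<close> are equal, while in \<open>N1 B\<close> they are
  opposite at the origin; so it is not Hamiltonian.\<close>

definition E_N :: "(real \<times> real) \<times> real \<Rightarrow> jet1 \<Rightarrow> real" where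
  "E_N = (\<lambda>((a, b), c) z. a * ((xc 3 z) * pc 3 z + xc 4 z * pc 4 z + uc z)
     + b * ((xc 1 z) * pc 1 z + xc 2 z * pc 2 z - 3 * uc z)
     + c * ((xc 4 z) * pc 1 z + xc 3 z * pc 2 z))"

text \<open>This treats what is left of a symmetry after grading 0 and the two scalings are removed:
  p3 and p4 no longer occur, and the coefficients of p1 and p2 depend on x3 and x4 only.\<close>

lemma N_linear_part:
  assumes h: "smooth h" and hu: "DU h = (\<lambda>z. 0)" and h34: "DP 3 h = (\<lambda>z. 0)" "DP 4 h = (\<lambda>z. 0)"
    and hpp: "\<forall>k l. DP l (DP k h) = (\<lambda>z. 0)"
    and h12: "DX 1 (DP 1 h) = (\<lambda>z. 0)" "DX 2 (DP 1 h) = (\<lambda>z. 0)"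
      "DX 1 (DP 2 h) = (\<lambda>z. 0)" "DX 2 (DP 2 h) = (\<lambda>z. 0)"
    and s13: "DX 1 (DX 3 h) = DX 2 (DX 4 h)"
    and s12: "\<forall>z. 2 * DX 1 (DX 2 h) z = DX 4 (DP 1 h) z - DX 3 (DP 2 h) z"
    and s11: "DX 1 (DX 1 h) = (\<lambda>z. - DX 4 (DP 2 h) z)"
    and s22: "DX 2 (DX 2 h) = DX 3 (DP 1 h)"
  obtains r B C D where "smooth B" "smooth C" "smooth D"
    "h = (\<lambda>z. N1 B z + N2 C z + pullx 3 4 D z + r * ((xc 4 z) * pc 1 z + xc 3 z * pc 2 z))"
proof -
  define e1 where "e1 = DP 1 h"
  define e2 where "e2 = DP 2 h"
  have se: "smooth e1" "smooth e2" unfolding e1_def e2_def using h by simp_all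
  have z1: "DX 1 e1 = (\<lambda>z. 0)" "DX 2 e1 = (\<lambda>z. 0)" "DP k e1 = (\<lambda>z. 0)" "DU e1 = (\<lambda>z. 0)"
    and z2: "DX 1 e2 = (\<lambda>z. 0)" "DX 2 e2 = (\<lambda>z. 0)" "DP k e2 = (\<lambda>z. 0)" "DU e2 = (\<lambda>z. 0)" for k
    using h12 hpp pd_pd_zero[OF h hu] by (simp_all add: e1_def e2_def)
  note zz = pd_pd_zero[OF se(1)] pd_pd_zero[OF se(2)] pd_pd_zero[OF smooth_pd[OF se(1)]]
    pd_pd_zero[OF smooth_pd[OF se(2)]]
  note s = s11[folded e2_def] s22[folded e1_def] s12[folded e1_def e2_def]
  have s12': "DX 1 (DX 2 h) = (\<lambda>z. (DX 4 e1 z - DX 3 e2 z) / 2)"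
    using s(3) by (auto simp: fun_eq_iff field_simps)
  \<comment> \<open>Third derivatives of h computed in two ways, through \<open>s13\<close>, yield
    \<open>w3\<close> and \<open>w4\<close>, which say that the divergence \<open>w\<close> below is
    constant.\<close>
  have t1: "DX 1 (DX 2 (DX 4 h)) z = (DX 4 (DX 4 e1) z - DX 3 (DX 4 e2) z) / 2" for z
    using fun_cong[OF arg_cong[OF s12', of "DX 4"], of z] h se by (simp add: pd_normal)
  have t2: "DX 1 (DX 2 (DX 3 h)) z = (DX 3 (DX 4 e1) z - DX 3 (DX 3 e2) z) / 2" for z
    using fun_cong[OF arg_cong[OF s12', of "DX 3"], of z] h se by (simp add: pd_normal)
  have t3: "DX 1 (DX 1 (DX 3 h)) z = - DX 3 (DX 4 e2) z" for z
    using fun_cong[OF arg_cong[OF s(1), of "DX 3"], of z] h se by (simp add: pd_normal)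
  have t4: "DX 2 (DX 2 (DX 4 h)) z = DX 3 (DX 4 e1) z" for z
    using fun_cong[OF arg_cong[OF s(2), of "DX 4"], of z] h se by (simp add: pd_normal)
  have t5: "DX 1 (DX 1 (DX 3 h)) z = DX 1 (DX 2 (DX 4 h)) z"
    and t6: "DX 1 (DX 2 (DX 3 h)) z = DX 2 (DX 2 (DX 4 h)) z" for z
    using fun_cong[OF arg_cong[OF s13, of "DX 1"], of z] fun_cong[OF arg_cong[OF s13, of "DX 2"], of z] h
    by (simp_all add: pd_normal)
  define w where "w = (\<lambda>z. DX 4 e1 z + DX 3 e2 z)"
  have w: "smooth w" unfolding w_def using se by simp
  have w3: "DX 3 (DX 3 e2) z = - DX 3 (DX 4 e1) z" for z
    using t2[of z] t4[of z] t6[of z] by simp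
  have w4: "DX 4 (DX 4 e1) z = - DX 3 (DX 4 e2) z" for z
    using t1[of z] t3[of z] t5[of z] by simp
  have "\<forall>b\<in>Basis. pd b w = (\<lambda>z. 0)"
    unfolding Basis_jet_explicit w_def using se by (simp add: z1 z2 zz pd_normal w3 w4)
  then obtain m where m: "\<forall>z. w z = m" using const_if_partials[OF w] by blast
  \<comment> \<open>Half of the constant divergence is assigned to each of
    \<open>xc 4 z * pc 1 z\<close> and \<open>xc 3 z * pc 2 z\<close>; the remaining field has a
    potential.\<close>
  define r where "r = m / 2"
  have e23: "DX 3 e2 = (\<lambda>z. 2 * r - DX 4 e1 z)" using m by (auto simp: w_def r_def fun_eq_iff
      algebra_simps)
  have "\<exists>B. smooth B \<and> pullx 3 4 (D2 B) = (\<lambda>z. e2 z - r * xc 3 z) \<and>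
      pullx 3 4 (D1 B) = (\<lambda>z. - (e1 z - r * xc 4 z))"
    using se by (intro jet_plane_potential) (simp_all add: Basis_jet_explicit z1 z2 e23)
  then obtain B where B: "smooth B" "pullx 3 4 (D2 B) = (\<lambda>z. e2 z - r * xc 3 z)"
    "pullx 3 4 (D1 B) = (\<lambda>z. - (e1 z - r * xc 4 z))" by blast
  have B2: "pullx 3 4 (D2 (D2 B)) = DX 4 e2" "pullx 3 4 (D1 (D2 B)) = (\<lambda>z. - (DX 4 e1 z - r))"
    "pullx 3 4 (D1 (D1 B)) = (\<lambda>z. - DX 3 e1 z)"
    using arg_cong[OF B(2), of "DX 4"] arg_cong[OF B(3), of "DX 4"] arg_cong[OF B(3), of "DX 3"] B(1) se
    by (simp_all add: D2_D1)
  \<comment> \<open>h without \<open>N1 B\<close> and the multiple of the third generator. It is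
    free of momenta and affine in x1 and x2, hence made of \<open>N2\<close> and a function of x3,
    x4.\<close>
  define k where "k = (\<lambda>z. h z - e2 z * pc 2 z - e1 z * pc 1 z + (xc 1 z)\<^sup>2 * DX 4 e2 z / 2
    - xc 1 z * xc 2 z * (DX 4 e1 z - r) - (xc 2 z)\<^sup>2 * DX 3 e1 z / 2)"
  have k: "smooth k" unfolding k_def using h se by simp
  have kz: "DP 1 k = (\<lambda>z. 0)" "DP 2 k = (\<lambda>z. 0)" "DP 3 k = (\<lambda>z. 0)" "DP 4 k = (\<lambda>z. 0)" "DU k = (\<lambda>z. 0)"
    unfolding k_def using h se by (simp_all add: z1 z2 zz hu h34 e1_def[symmetric] e2_def[symmetric])
  have k1: "DX 1 k = (\<lambda>z. DX 1 h z + xc 1 z * DX 4 e2 z - xc 2 z * (DX 4 e1 z - r))"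
    and k2: "DX 2 k = (\<lambda>z. DX 2 h z - xc 1 z * (DX 4 e1 z - r) - xc 2 z * DX 3 e1 z)"
    unfolding k_def using h se by (simp_all add: z1 z2 zz)
  have kk: "DX 1 (DX 1 k) = (\<lambda>z. 0)" "DX 2 (DX 2 k) = (\<lambda>z. 0)"
    unfolding k1 k2 using h se by (simp_all add: z1 z2 zz s)
  have kk2: "DX 1 (DX 2 k) = (\<lambda>z. 0)"
    unfolding k2 using h se by (simp add: z1 z2 zz s12' e23 fun_eq_iff field_simps)
  have kk3: "DX 1 (DX 3 k) z = DX 2 (DX 4 k) z" for z
  proof -
    have "DX 3 (DX 1 k) z = DX 4 (DX 2 k) z"
      unfolding k1 k2 using h se
      by (simp add: pd_normal s13 w4) 
    then show ?thesis using k by (simp add: pd_normal)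
  qed
  define l1 where "l1 = DX 1 k"
  define l2 where "l2 = DX 2 k"
  have sl: "smooth l1" "smooth l2" unfolding l1_def l2_def using k by simp_all
  have lz: "DX 1 l1 = (\<lambda>z. 0)" "DX 2 l1 = (\<lambda>z. 0)" "DP i l1 = (\<lambda>z. 0)" "DU l1 = (\<lambda>z. 0)"
    "DX 1 l2 = (\<lambda>z. 0)" "DX 2 l2 = (\<lambda>z. 0)" "DP i l2 = (\<lambda>z. 0)" "DU l2 = (\<lambda>z. 0)" for i
    unfolding l1_def l2_def using kk kk2 pd_normal(3)[OF k] kz exhaust_4[of i] by (auto simp:
        pd_pd_zero[OF k])
  have l34: "DX 3 l1 z = DX 4 l2 z" for z using kk3[of z] k by (simp add: l1_def l2_def pd_normal)
  have "\<exists>C. smooth C \<and> pullx 3 4 (D2 C) = (\<lambda>z. - l1 z) \<and> pullx 3 4 (D1 C) = (\<lambda>z. - l2 z)"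
    using sl by (intro jet_plane_potential) (simp_all add: Basis_jet_explicit lz l34)
  then obtain C where C: "smooth C" "pullx 3 4 (D2 C) = (\<lambda>z. - l1 z)" "pullx 3 4 (D1 C) = (\<lambda>z. - l2 z)"
    by blast
  define r' where "r' = (\<lambda>z. k z - xc 1 z * l1 z - xc 2 z * l2 z)"
  have "\<exists>D. smooth D \<and> r' = pullx 3 4 D"
    unfolding r'_def using k sl
    by (intro factor_pull) (simp_all add: Basis_jet_explicit lz kz, simp_all add: l1_def l2_def)
  then obtain D where D: "smooth D" "r' = pullx 3 4 D" by blast
  have "h = (\<lambda>z. N1 B z + N2 C z + pullx 3 4 D z + r * ((xc 4 z) * pc 1 z + xc 3 z * pc 2 z))"
    unfolding N1_def N2_def B B2 C D(2)[symmetric]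
    by (simp add: r'_def k_def fun_eq_iff field_simps)
  then show ?thesis using that B(1) C(1) D(1) by blast
qed

lemma cont_eq_N_solve:
  assumes "f \<in> cont eq_N"
  obtains a A where "A \<in> graded_sum [3]" "f = (\<lambda>z. E_N a z + \<Phi>_N A z)"
proof -
  obtain c g where g: "smooth g" "f = (\<lambda>z. g z + c * uc z)" "DU g = (\<lambda>z. 0)"
    and pp: "\<forall>k l. DP l (DP k g) = (\<lambda>z. 0)"
    and z34: "DX 2 (DP 4 g) = (\<lambda>z. 0)" "DX 1 (DP 3 g) = (\<lambda>z. 0)"
    "DX 2 (DP 3 g) = (\<lambda>z. 0)" "DX 1 (DP 4 g) = (\<lambda>z. 0)"
    and a12: "DX 2 (DP 1 g) = DX 3 (DP 4 g)" "DX 1 (DP 2 g) = DX 4 (DP 3 g)"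
    and s13: "DX 1 (DX 3 g) = DX 2 (DX 4 g)"
    and a33: "\<forall>z. DX 3 (DP 3 g) z = DX 2 (DP 2 g) z + DX 4 (DP 4 g) z - DX 1 (DP 1 g) z"
    and cc: "\<forall>z. c = DX 4 (DP 4 g) z - 2 * DX 1 (DP 1 g) z - DX 2 (DP 2 g) z"
    and s12: "\<forall>z. 2 * DX 1 (DX 2 g) z = DX 4 (DP 1 g) z - DX 3 (DP 2 g) z"
    and s11: "DX 1 (DX 1 g) = (\<lambda>z. - DX 4 (DP 2 g) z)"
    and s22: "DX 2 (DX 2 g) = DX 3 (DP 1 g)"
    and t: "\<forall>z. DX 3 (DX 3 (DP 3 g)) z = - DX 3 (DX 4 (DP 4 g)) z"
    "\<forall>z. DX 3 (DX 4 (DP 3 g)) z = - DX 4 (DX 4 (DP 4 g)) z"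
    "\<forall>z. DX 1 (DX 3 (DP 1 g)) z = DX 3 (DX 4 (DP 4 g)) z"
    "\<forall>z. DX 1 (DX 4 (DP 1 g)) z = DX 4 (DX 4 (DP 4 g)) z"
    by (rule cont_eq_N_reduce[OF assms])
  define a where "a k = DP k g" for k
  have sa: "smooth (a k)" for k unfolding a_def using g(1) by simp
  have az: "DP l (a k) = (\<lambda>z. 0)" "DU (a k) = (\<lambda>z. 0)" for k l
    using pp pd_pd_zero[OF g(1,3)] by (simp_all add: a_def)
  note z34 = z34[folded a_def] and a12 = a12[folded a_def] and a33 = a33[folded a_def] and cc = cc[folded
      a_def]
    and s = s11[folded a_def] s22[folded a_def] s12[folded a_def] and t = t[folded a_def]
  note zz = pd_pd_zero[OF sa] pd_pd_zero[OF smooth_pd[OF sa]]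
  have a11: "DX 1 (DX 1 (a 1)) = (\<lambda>z. 0)"
    using arg_cong[OF s(1), of "DP 1"] g(1) by (simp add: pd_normal sa zz az a_def[symmetric])
  have a12': "DX 1 (DX 2 (a 1)) = (\<lambda>z. 0)" by (simp add: a12 zz z34)
  \<comment> \<open>\<open>w\<close> and \<open>w'\<close> turn out to be constants by
    \<open>t\<close>; they encode the two weights of the scalings.\<close>
  define w where "w = (\<lambda>z. DX 3 (a 3) z + DX 4 (a 4) z)"
  have w: "smooth w" unfolding w_def using sa by simp
  have "\<forall>b\<in>Basis. pd b w = (\<lambda>z. 0)"
    unfolding Basis_jet_explicit w_def using sa by (simp add: z34 az zz pd_normal[OF sa] t[rule_format])
  then obtain n where n: "\<forall>z. w z = n" using const_if_partials[OF w] by blast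
  define w' where "w' = (\<lambda>z. DX 1 (a 1) z - DX 4 (a 4) z)"
  have w': "smooth w'" unfolding w'_def using sa by simp
  have "\<forall>b\<in>Basis. pd b w' = (\<lambda>z. 0)"
    unfolding Basis_jet_explicit w'_def using sa a11 a12' by (simp add: z34 az zz pd_normal[OF sa]
        t[rule_format])
  then obtain m' where m': "\<forall>z. w' z = m'" using const_if_partials[OF w'] by blast
  \<comment> \<open>v and m are the coefficients of the two scalings in \<open>E_N\<close>: with v
    taken off both x3 and x4 the field in that plane is divergence-free. By \<open>c_eq\<close> the
    u coefficient is then the one in \<open>E_N\<close>.\<close>
  define v where "v = n / 2"
  define m where "m = m' + v"
  have b33: "DX 3 (a 3) = (\<lambda>z. 2 * v - DX 4 (a 4) z)"
    and b11: "DX 1 (a 1) = (\<lambda>z. DX 4 (a 4) z + m - v)"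
    using n m' by (auto simp: fun_eq_iff w_def w'_def v_def m_def algebra_simps)
  have b22: "DX 2 (a 2) = (\<lambda>z. m + v - DX 4 (a 4) z)"
    using a33 by (auto simp: fun_eq_iff b33 b11 algebra_simps)
  have c_eq: "c = v - 3 * m" using cc[THEN spec, of 0] by (simp add: b11 b22)
  have t2: "DX 3 (DX 4 (a 3)) = (\<lambda>z. - DX 4 (DX 4 (a 4)) z)" using t(2) by auto
  have "\<exists>A. smooth A \<and> pullx 3 4 (D2 A) = (\<lambda>z. a 3 z - v * xc 3 z) \<and>
      pullx 3 4 (D1 A) = (\<lambda>z. - (a 4 z - v * xc 4 z))"
    using sa by (intro jet_plane_potential) (simp_all add: Basis_jet_explicit z34 az b33)
  then obtain A where A: "smooth A" "pullx 3 4 (D2 A) = (\<lambda>z. a 3 z - v * xc 3 z)"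
      "pullx 3 4 (D1 A) = (\<lambda>z. - (a 4 z - v * xc 4 z))" by blast
  have A2: "pullx 3 4 (D2 (D2 A)) = DX 4 (a 3)"
    "pullx 3 4 (D1 (D2 A)) = (\<lambda>z. v - DX 4 (a 4) z)"
    "pullx 3 4 (D1 (D1 A)) = (\<lambda>z. - DX 3 (a 4) z)"
    using arg_cong[OF A(2), of "DX 4"] arg_cong[OF A(3), of "DX 4"] arg_cong[OF A(3), of "DX 3"] A(1) sa
    by (simp_all add: D2_D1)
  have A3: "pullx 3 4 (D2 (D2 (D2 A))) = DX 4 (DX 4 (a 3))"
    "pullx 3 4 (D1 (D2 (D2 A))) = (\<lambda>z. - DX 4 (DX 4 (a 4)) z)"
    "pullx 3 4 (D1 (D1 (D2 A))) = (\<lambda>z. - DX 3 (DX 4 (a 4)) z)"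
    "pullx 3 4 (D1 (D1 (D1 A))) = (\<lambda>z. - DX 3 (DX 3 (a 4)) z)"
    using arg_cong[OF A2(1), of "DX 4"] arg_cong[OF A2(2), of "DX 4"] arg_cong[OF A2(2), of "DX 3"]
      arg_cong[OF A2(3), of "DX 3"] A(1) sa
    by (simp_all add: D2_D1)
  \<comment> \<open>g minus \<open>N0 A\<close> and the momentum parts of both scalings, written in
    terms of \<open>a\<close>, so that the hypotheses of \<open>N_linear_part\<close> can be
    computed directly.\<close>
  define h where "h = (\<lambda>z. g z - a 3 z * pc 3 z - a 4 z * pc 4 z
    - ((xc 1 z) * DX 4 (a 3) z + xc 2 z * (m + v - DX 4 (a 4) z)) * pc 2 z
    - ((xc 1 z) * (DX 4 (a 4) z + m - v) + xc 2 z * DX 3 (a 4) z) * pc 1 z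
    + ((xc 1 z) ^ 3 * DX 4 (DX 4 (a 3)) z
      - 3 * (xc 1 z)\<^sup>2 * xc 2 z * DX 4 (DX 4 (a 4)) z
      - 3 * xc 1 z * (xc 2 z)\<^sup>2 * DX 3 (DX 4 (a 4)) z
      - xc 2 z ^ 3 * DX 3 (DX 3 (a 4)) z) / 6)"
  have h: "smooth h" unfolding h_def using g(1) sa by simp
  have hp: "DP 1 h = (\<lambda>z. a 1 z - ((xc 1 z) * (DX 4 (a 4) z + m - v) + xc 2 z * DX 3 (a 4) z))"
    "DP 2 h = (\<lambda>z. a 2 z - ((xc 1 z) * DX 4 (a 3) z + xc 2 z * (m + v - DX 4 (a 4) z)))"
    "DP 3 h = (\<lambda>z. 0)" "DP 4 h = (\<lambda>z. 0)" "DU h = (\<lambda>z. 0)"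
    unfolding h_def using g(1) sa by (simp_all add: az zz g(3) a_def[symmetric])
  have x1: "DX 1 h = (\<lambda>z. DX 1 g z - DX 4 (a 3) z * pc 2 z - (DX 4 (a 4) z + m - v) * pc 1 z
      + ((xc 1 z)\<^sup>2 * DX 4 (DX 4 (a 3)) z
      - 2 * xc 1 z * xc 2 z * DX 4 (DX 4 (a 4)) z
      - (xc 2 z)\<^sup>2 * DX 3 (DX 4 (a 4)) z) / 2)"
    and x2: "DX 2 h = (\<lambda>z. DX 2 g z - (m + v - DX 4 (a 4) z) * pc 2 z - DX 3 (a 4) z * pc 1 z
      - ((xc 1 z)\<^sup>2 * DX 4 (DX 4 (a 4)) z
      + 2 * xc 1 z * xc 2 z * DX 3 (DX 4 (a 4)) z
      + (xc 2 z)\<^sup>2 * DX 3 (DX 3 (a 4)) z) / 2)"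
    unfolding h_def using g(1) sa by (simp_all add: z34 zz fun_eq_iff field_simps power2_eq_square)
  have e1: "DX 4 (DP 1 h) = (\<lambda>z. DX 4 (a 1) z - ((xc 1 z) * DX 4 (DX 4 (a 4)) z + xc 2 z * DX 3 (DX 4 (a
      4)) z))"
    "DX 3 (DP 1 h) = (\<lambda>z. DX 3 (a 1) z - ((xc 1 z) * DX 3 (DX 4 (a 4)) z + xc 2 z * DX 3 (DX 3 (a 4))
        z))"
    "DX 4 (DP 2 h) = (\<lambda>z. DX 4 (a 2) z - ((xc 1 z) * DX 4 (DX 4 (a 3)) z - xc 2 z * DX 4 (DX 4 (a 4))
        z))"
    "DX 3 (DP 2 h) = (\<lambda>z. DX 3 (a 2) z + ((xc 1 z) * DX 4 (DX 4 (a 4)) z + xc 2 z * DX 3 (DX 4 (a 4))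
        z))"
    unfolding hp using sa by (simp_all add: pd_normal[OF sa] t2 fun_eq_iff algebra_simps)
  have h13: "DX 1 (DX 3 h) = DX 2 (DX 4 h)"
  proof -
    have t2': "DX 3 (DX 4 (DX 4 (a 3))) = (\<lambda>z. - DX 4 (DX 4 (DX 4 (a 4))) z)"
      using arg_cong[OF t2, of "DX 4"] sa by (simp add: pd_normal)
    have "DX 3 (DX 1 h) = DX 4 (DX 2 h)"
      unfolding x1 x2 using g(1) sa by (simp add: pd_normal s13 t2 t2' fun_eq_iff field_simps)
    then show ?thesis using h by (simp add: pd_normal)
  qed
  have h12: "\<forall>z. 2 * DX 1 (DX 2 h) z = DX 4 (DP 1 h) z - DX 3 (DP 2 h) z"
    unfolding e1 x2 using s(3) g(1) sa by (simp add: z34 zz fun_eq_iff field_simps)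
  have h11: "DX 1 (DX 1 h) = (\<lambda>z. - DX 4 (DP 2 h) z)"
    unfolding e1 x1 using g(1) sa by (simp add: s z34 zz fun_eq_iff field_simps)
  have h22: "DX 2 (DX 2 h) = DX 3 (DP 1 h)"
    unfolding e1 x2 using g(1) sa by (simp add: s z34 zz fun_eq_iff field_simps)
  have hpp: "\<forall>k l. DP l (DP k h) = (\<lambda>z. 0)"
  proof (intro allI)
    show "DP l (DP k h) = (\<lambda>z. 0)" for k l
      using exhaust_4[of k] sa by (auto simp: hp az zz)
  qed
  have hz: "DX 1 (DP 1 h) = (\<lambda>z. 0)" "DX 2 (DP 1 h) = (\<lambda>z. 0)"
      "DX 1 (DP 2 h) = (\<lambda>z. 0)" "DX 2 (DP 2 h) = (\<lambda>z. 0)"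
    unfolding hp using sa by (simp_all add: z34 zz b11 b22 a12)
  obtain r B C D where BCD: "smooth B" "smooth C" "smooth D"
    "h = (\<lambda>z. N1 B z + N2 C z + pullx 3 4 D z + r * ((xc 4 z) * pc 1 z + xc 3 z * pc 2 z))"
    by (rule N_linear_part[OF h hp(5,3,4) hpp hz h13 h12 h11 h22])
  define F where "F = (\<lambda>(b :: nat) (i :: nat). if b = 0 then (if i = 0 then A else if i = 1 then B
    else if i = 2 then C else if i = 3 then (\<lambda>y. - D y) else 0) else 0)"
  have "F \<in> graded_sum [3]"
    using A(1) BCD(1-3) by (auto simp: graded_sum_def pieces_N F_def)
  moreover have "g = (\<lambda>z. h z + N0 A z + v * ((xc 3 z) * pc 3 z + xc 4 z * pc 4 z)
      + m * ((xc 1 z) * pc 1 z + xc 2 z * pc 2 z))"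
    unfolding N0_def ham_def A A2 A3 by (simp add: h_def fun_eq_iff field_simps)
  then have "f = (\<lambda>z. E_N ((v, m), r) z + \<Phi>_N F z)"
    unfolding g(2) BCD(4) c_eq
    by (simp add: E_N_def \<Phi>_N_def F_def fun_eq_iff algebra_simps) (simp add: pull_def)
  ultimately show ?thesis by (rule that)
qed

text \<open>The determining equations are linear in f, so membership can be verified for each piece
  separately.\<close>

lemma cont_eq_N_add:
  assumes "f \<in> cont eq_N" "g \<in> cont eq_N" shows "(\<lambda>z. f z + g z) \<in> cont eq_N"
proof -
  have sm: "smooth f" "smooth g" using assms by (simp_all add: cont_eq_N_iff)
  note F = assms(1)[unfolded cont_eq_N_iff determining_N_def, THEN conjunct2, THEN spec]
  note G = assms(2)[unfolded cont_eq_N_iff determining_N_def, THEN conjunct2, THEN spec]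
  show ?thesis unfolding cont_eq_N_iff determining_N_def by (simp add: sm F G algebra_simps)
qed

lemma N0_mem: "smooth A \<Longrightarrow> N0 A \<in> cont eq_N"
  unfolding cont_eq_N_iff determining_N_def N0_def ham_def dx_def
  by (simp add: D2_D1) (simp add: algebra_simps add_divide_distrib diff_divide_distrib power2_eq_square
      power3_eq_cube)

lemma N1_mem: "smooth A \<Longrightarrow> N1 A \<in> cont eq_N"
  unfolding cont_eq_N_iff determining_N_def N1_def dx_def
  by (simp add: D2_D1 algebra_simps add_divide_distrib diff_divide_distrib)

lemma N2_mem: "smooth A \<Longrightarrow> N2 A \<in> cont eq_N"
  unfolding cont_eq_N_iff determining_N_def N2_def dx_def by (simp add: D2_D1)

lemma pull_mem_N: "smooth A \<Longrightarrow> (\<lambda>z. - pullx 3 4 A z) \<in> cont eq_N"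
  unfolding cont_eq_N_iff determining_N_def dx_def by simp

lemma E_N_mem: "E_N a \<in> cont eq_N"
  by (cases a) (auto simp: cont_eq_N_iff determining_N_def E_N_def dx_def algebra_simps)

lemma cont_eq_N_mem:
  assumes A: "A \<in> graded_sum [3]"
  shows "(\<lambda>z. E_N a z + \<Phi>_N A z) \<in> cont eq_N"
  unfolding \<Phi>_N_def diff_conv_add_uminus using graded_sum_smooth[OF A]
  by (intro cont_eq_N_add E_N_mem N0_mem N1_mem N2_mem pull_mem_N)

section \<open>Brackets of the four pieces of equation N\<close>

lemma smooth_N [simp, intro]:
  "smooth A \<Longrightarrow> smooth (N0 A)" "smooth A \<Longrightarrow> smooth (N1 A)" "smooth A \<Longrightarrow> smooth (N2 A)"
  by (simp_all add: N0_def N1_def N2_def)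

lemma N0_N0_bracket:
  assumes "smooth A" "smooth B"
  shows "jacobi_bracket (N0 A) (N0 B) = N0 (poisson A B)"
  unfolding N0_def ham_def using assms
  by (simp add: jacobi_bracket_eq sum_4 poisson_eq D2_D1)
    (simp add: pull_def fun_eq_iff algebra_simps add_divide_distrib diff_divide_distrib power2_eq_square
        power3_eq_cube)

text \<open>With \<open>- pullx 3 4\<close> as the piece of grading 3, this is the graded bracket,
  including its truncation above 3. The signs in \<open>N2\<close> and in the last term of
  \<open>\<Phi>_N\<close> are the ones that make these relations hold.\<close>

lemma N_brackets:
  assumes "smooth A" "smooth B"
  shows "jacobi_bracket (N0 A) (N1 B) = N1 (poisson A B)"
    "jacobi_bracket (N0 A) (N2 B) = N2 (poisson A B)"
    "jacobi_bracket (N1 A) (N1 B) = N2 (poisson A B)"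
    "jacobi_bracket (N0 A) (pullx 3 4 B) = pullx 3 4 (poisson A B)"
    "jacobi_bracket (N1 A) (N2 B) = (\<lambda>z. - pullx 3 4 (poisson A B) z)"
    "jacobi_bracket (N1 A) (pullx 3 4 B) = (\<lambda>z. 0)"
    "jacobi_bracket (N2 A) (N2 B) = (\<lambda>z. 0)"
    "jacobi_bracket (N2 A) (pullx 3 4 B) = (\<lambda>z. 0)"
    "jacobi_bracket (pullx 3 4 A) (pullx 3 4 B) = (\<lambda>z. 0)"
  unfolding N0_def N1_def N2_def ham_def using assms
  by (simp_all add: jacobi_bracket_eq sum_4 poisson_eq D2_D1)
    (simp_all add: pull_def fun_eq_iff algebra_simps add_divide_distrib diff_divide_distrib
        power2_eq_square power3_eq_cube)

lemma N_linear:
  assumes "smooth A" "smooth B"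
  shows "N1 (\<lambda>y. A y + B y) = (\<lambda>z. N1 A z + N1 B z)" "N2 (\<lambda>y. A y + B y) = (\<lambda>z. N2 A z + N2 B z)"
    "pull v w (\<lambda>y. A y + B y) = (\<lambda>z. pull v w A z + pull v w B z)"
  using assms by (simp_all add: N1_def N2_def pull_def fun_eq_iff field_simps)

lemma pull_minus: "pull v w (\<lambda>y. - A y) = (\<lambda>z. - pull v w A z)"
  by (simp add: pull_def)

lemma jacobi_minus_right:
  "smooth f \<Longrightarrow> smooth g \<Longrightarrow> jacobi_bracket f (\<lambda>z. - g z) = (\<lambda>z. - jacobi_bracket f g z)"
  by (simp add: jacobi_bracket_eq sum_4 fun_eq_iff)

lemma \<Phi>_N_bracket:
  assumes A: "A \<in> graded_sum [3]" and B: "B \<in> graded_sum [3]"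
  shows "jacobi_bracket (\<Phi>_N A) (\<Phi>_N B) = \<Phi>_N (graded_bracket [3] A B)"
proof -
  note sm = graded_sum_smooth[OF A] graded_sum_smooth[OF B]
  have gb: "graded_bracket [3] A B 0 0 = poisson (A 0 0) (B 0 0)"
    "graded_bracket [3] A B 0 1 = (\<lambda>z. poisson (A 0 0) (B 0 1) z + poisson (A 0 1) (B 0 0) z)"
    "graded_bracket [3] A B 0 2 = (\<lambda>z. poisson (A 0 0) (B 0 2) z + poisson (A 0 1) (B 0 1) z + poisson (A
        0 2) (B 0 0) z)"
    "graded_bracket [3] A B 0 3 = (\<lambda>z. poisson (A 0 0) (B 0 3) z + poisson (A 0 1) (B 0 2) z + poisson (A
        0 2) (B 0 1) z + poisson (A 0 3) (B 0 0) z)"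
    by (simp_all add: graded_bracket_def pieces_N plus_fun_def, simp_all add: numeral_eq_Suc
        plus_fun_def)
  \<comment> \<open>A nested sum without subtraction, so that the additivity lemmas for the bracket
    apply to it as rewrite rules.\<close>
  define F where "F C = (\<lambda>z. N0 (C 0 0) z + (N1 (C 0 1) z + (N2 (C 0 2) z + pullx 3 4 (\<lambda>y. - C 0 3 y)
      z)))"
    for C :: "nat \<Rightarrow> nat \<Rightarrow> real \<times> real \<Rightarrow> real"
  have F: "\<Phi>_N C = F C" for C by (simp add: F_def \<Phi>_N_def fun_eq_iff) (simp add: pull_def)
  note anti = jacobi_antisym[of "N0 _" "N1 _"] jacobi_antisym[of "N0 _" "N2 _"] jacobi_antisym[of "N1 _"
      "N2 _"]
    jacobi_antisym[of "N0 _" "pullx 3 4 _"] jacobi_antisym[of "N1 _" "pullx 3 4 _"]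
    jacobi_antisym[of "N2 _" "pullx 3 4 _"]
  have "jacobi_bracket (F A) (F B) = F (graded_bracket [3] A B)"
    unfolding F_def gb using sm
    by (simp add: jacobi_add_left jacobi_add_right anti N_brackets N_linear)
      (simp add: fun_eq_iff pull_def N1_def N2_def poisson_eq D2_D1 field_simps power2_eq_square
          N0_N0_bracket)
  then show ?thesis by (simp only: F)
qed

section \<open>Action of the three generators of the quotient on the pieces of equation N\<close>

definition eN :: "jet1 \<Rightarrow> real" where
  "eN = (\<lambda>z. (xc 3 z) * pc 3 z + xc 4 z * pc 4 z + uc z)"

definition eM :: "jet1 \<Rightarrow> real" where
  "eM = (\<lambda>z. (xc 1 z) * pc 1 z + xc 2 z * pc 2 z - 3 * uc z)"

definition eO :: "jet1 \<Rightarrow> real" where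
  "eO = (\<lambda>z. (xc 4 z) * pc 1 z + xc 3 z * pc 2 z)"

text \<open>A multiple of the identity minus the Euler operator of the plane. On grading i the
  generator \<open>eN\<close> acts by it with k = 2 - i.\<close>

definition euler_shift :: "real \<Rightarrow> (real \<times> real \<Rightarrow> real) \<Rightarrow> real \<times> real \<Rightarrow> real" where
  "euler_shift k A = (\<lambda>y. k * A y - (fst y * D1 A y + snd y * D2 A y))"

lemma smooth_euler_shift [simp, intro]: "smooth A \<Longrightarrow> smooth (euler_shift k A)"
  by (simp add: euler_shift_def)

lemma smooth_eNMO [simp, intro]: "smooth eN" "smooth eM" "smooth eO"
  by (simp_all add: eN_def eM_def eO_def)

lemma eN_brackets:
  assumes "smooth A"
  shows "jacobi_bracket eN (N0 A) = N0 (euler_shift 2 A)" "jacobi_bracket eN (N1 A) = N1 (euler_shift 1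
      A)"
    "jacobi_bracket eN (N2 A) = N2 (euler_shift 0 A)"
    "jacobi_bracket eN (pullx 3 4 A) = pullx 3 4 (euler_shift (-1) A)"
  unfolding eN_def N0_def N1_def N2_def ham_def euler_shift_def using assms
  by (simp_all add: jacobi_bracket_eq sum_4 D2_D1)
    (simp_all add: pull_def fun_eq_iff algebra_simps add_divide_distrib diff_divide_distrib
        power2_eq_square power3_eq_cube)

text \<open>\<open>eM\<close> is the grading derivation: it multiplies the piece of grading i by
  i.\<close>

lemma eM_brackets:
  assumes "smooth A"
  shows "jacobi_bracket eM (N0 A) = (\<lambda>z. 0)" "jacobi_bracket eM (N1 A) = N1 A"
    "jacobi_bracket eM (N2 A) = (\<lambda>z. 2 * N2 A z)"
    "jacobi_bracket eM (pullx 3 4 A) = (\<lambda>z. 3 * pullx 3 4 A z)"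
  unfolding eM_def N0_def N1_def N2_def ham_def using assms
  by (simp_all add: jacobi_bracket_eq sum_4 D2_D1)
    (simp_all add: pull_def fun_eq_iff algebra_simps add_divide_distrib diff_divide_distrib
        power2_eq_square power3_eq_cube)

text \<open>\<open>eO\<close> raises the grading by one; on grading i it acts through the same
  \<open>euler_shift (2 - i)\<close> as \<open>eN\<close>.\<close>

lemma eO_brackets:
  assumes "smooth A"
  shows "jacobi_bracket eO (N0 A) = N1 (euler_shift 2 A)" "jacobi_bracket eO (N1 A) = N2 (euler_shift 1
      A)"
    "jacobi_bracket eO (N2 A) = (\<lambda>z. - pullx 3 4 (euler_shift 0 A) z)"
    "jacobi_bracket eO (pullx 3 4 A) = (\<lambda>z. 0)"
  unfolding eO_def N0_def N1_def N2_def ham_def euler_shift_def using assms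
  by (simp_all add: jacobi_bracket_eq sum_4 D2_D1)
    (simp_all add: pull_def fun_eq_iff algebra_simps add_divide_distrib diff_divide_distrib
        power2_eq_square power3_eq_cube)

lemma N_scale:
  assumes "smooth A"
  shows "N0 (\<lambda>y. c * A y) = (\<lambda>z. c * N0 A z)" "N1 (\<lambda>y. c * A y) = (\<lambda>z. c * N1 A z)"
    "N2 (\<lambda>y. c * A y) = (\<lambda>z. c * N2 A z)" "pull v w (\<lambda>y. c * A y) = (\<lambda>z. c * pull v w A z)"
  using assms by (simp_all add: N0_def ham_def N1_def N2_def pull_def fun_eq_iff algebra_simps
    add_divide_distrib diff_divide_distrib)

lemma E_N_\<Phi>_N:
  assumes A: "A \<in> graded_sum [3]"
  shows "\<exists>B\<in>graded_sum [3]. jacobi_bracket (E_N ((n, m), r)) (\<Phi>_N A) = \<Phi>_N B"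
proof
  note sm = graded_sum_smooth[OF A]
  define B where "B = (\<lambda>(b :: nat) (i :: nat). if b = 0 then
    (if i = 0 then (\<lambda>y. n * euler_shift 2 (A 0 0) y)
    else if i = 1 then (\<lambda>y. n * euler_shift 1 (A 0 1) y + (m * A 0 1 y + r * euler_shift 2 (A 0 0) y))
    else if i = 2 then (\<lambda>y. n * euler_shift 0 (A 0 2) y + (2 * m * A 0 2 y + r * euler_shift 1 (A 0 1)
        y))
    else if i = 3 then (\<lambda>y. n * euler_shift (-1) (A 0 3) y + (3 * m * A 0 3 y + r * euler_shift 0 (A 0 2)
        y))
    else 0) else 0)"
  show "B \<in> graded_sum [3]" using sm by (auto simp: graded_sum_def B_def pieces_N)
  have B: "B 0 0 = (\<lambda>y. n * euler_shift 2 (A 0 0) y)"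
    "B 0 1 = (\<lambda>y. n * euler_shift 1 (A 0 1) y + (m * A 0 1 y + r * euler_shift 2 (A 0 0) y))"
    "B 0 2 = (\<lambda>y. n * euler_shift 0 (A 0 2) y + (2 * m * A 0 2 y + r * euler_shift 1 (A 0 1) y))"
    "B 0 3 = (\<lambda>y. n * euler_shift (-1) (A 0 3) y + (3 * m * A 0 3 y + r * euler_shift 0 (A 0 2) y))"
    by (simp_all add: B_def)
  have E: "E_N ((n, m), r) = (\<lambda>z. n * eN z + (m * eM z + r * eO z))"
    by (simp add: E_N_def eN_def eM_def eO_def add.assoc)
  have \<Phi>: "\<Phi>_N C = (\<lambda>z. N0 (C 0 0) z + (N1 (C 0 1) z + (N2 (C 0 2) z + pullx 3 4 (\<lambda>y. - C 0 3 y) z)))"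
      for C
    by (simp add: \<Phi>_N_def fun_eq_iff) (simp add: pull_def)
  have split: "jacobi_bracket e (\<Phi>_N A) = (\<lambda>z. jacobi_bracket e (N0 (A 0 0)) z + (jacobi_bracket e (N1 (A
      0 1)) z
      + (jacobi_bracket e (N2 (A 0 2)) z + jacobi_bracket e (pullx 3 4 (\<lambda>y. - A 0 3 y)) z)))"
    if "smooth e" for e
    unfolding \<Phi> using that sm by (simp add: jacobi_add_right)
  have s\<Phi>: "smooth (\<Phi>_N A)" unfolding \<Phi> using sm by simp
  have "jacobi_bracket (E_N ((n, m), r)) (\<Phi>_N A) =
      (\<lambda>z. n * jacobi_bracket eN (\<Phi>_N A) z + (m * jacobi_bracket eM (\<Phi>_N A) z + r * jacobi_bracket eO
          (\<Phi>_N A) z))"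
    unfolding E using s\<Phi> by (simp add: jacobi_add_left jacobi_cmult_left)
  also have "\<dots> = \<Phi>_N B"
    unfolding split[OF smooth_eNMO(1)] split[OF smooth_eNMO(2)] split[OF smooth_eNMO(3)]
    unfolding \<Phi>_N_def B using sm
    by (simp add: eN_brackets eM_brackets eO_brackets N_linear N_scale pull_minus jacobi_minus_right)
      (simp add: fun_eq_iff algebra_simps)
  finally show "jacobi_bracket (E_N ((n, m), r)) (\<Phi>_N A) = \<Phi>_N B" .
qed

lemma structure_N:
  "symmetry_structure [3] \<Phi>_N E_N (semidirect_bracket (\<lambda>a. snd a - fst a)) (cont eq_N)"
proof (rule symmetry_structure.intro)
  fix A B :: "nat \<Rightarrow> nat \<Rightarrow> real \<times> real \<Rightarrow> real" and c :: real and a b :: "(real \<times> real) \<times> real" and f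
  obtain n m r where a: "a = ((n, m), r)" by (cases a) auto
  obtain n' m' r' where b: "b = ((n', m'), r')" by (cases b) auto
  show "smooth (E_N a)" by (simp add: E_N_def a)
  show "linear E_N" by (rule linearI) (auto simp: E_N_def fun_eq_iff algebra_simps scaleR_fun_def)
  show "jacobi_bracket (E_N a) (E_N b) = E_N (semidirect_bracket (\<lambda>a. snd a - fst a) a b)"
    by (simp add: a b E_N_def jacobi_bracket_eq sum_4 semidirect_bracket_def)
      (simp add: zero_prod_def fun_eq_iff algebra_simps)
  show "f \<in> cont eq_N \<longleftrightarrow> (\<exists>a. \<exists>A\<in>graded_sum [3]. f = (\<lambda>z. E_N a z + \<Phi>_N A z))"
    by (blast elim: cont_eq_N_solve intro: cont_eq_N_mem)
  assume A: "A \<in> graded_sum [3]"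
  note sm = graded_sum_smooth[OF A]
  show "smooth (\<Phi>_N A)" using sm by (simp add: \<Phi>_N_def)
  show "\<Phi>_N (c *\<^sub>R A) = c *\<^sub>R \<Phi>_N A"
    using sm by (simp add: \<Phi>_N_def N0_def N1_def N2_def ham_def scaleR_apply2 scaleR_fun_def pull_def
        fun_eq_iff
        algebra_simps add_divide_distrib)
  show "\<Phi>_N A = (\<lambda>z. 0) \<longleftrightarrow> A \<in> constant_relations [3]"
  proof
    assume 0: "\<Phi>_N A = (\<lambda>z. 0)"
    have d: "pd v (\<Phi>_N A) = (\<lambda>z. 0)" for v by (simp add: 0)
    note unf = \<Phi>_N_def N0_def N1_def N2_def ham_def
    have pz: "pull v w (\<lambda>z. 0) = (\<lambda>z. 0)" for v w :: jet1 by (simp add: pull_def)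
    have p: "D1 (A 0 0) = (\<lambda>z. 0)" "D2 (A 0 0) = (\<lambda>z. 0)"
      using d[of "ep 3"] d[of "ep 4"] sm by (simp_all add: unf pull_zero_iff pull_neg_zero_iff)
    have p': "D1 (A 0 1) = (\<lambda>z. 0)" "D2 (A 0 1) = (\<lambda>z. 0)"
      using d[of "ep 1"] d[of "ep 2"] sm p by (simp_all add: unf pz pull_zero_iff pull_neg_zero_iff)
    have p'': "D1 (A 0 2) = (\<lambda>z. 0)" "D2 (A 0 2) = (\<lambda>z. 0)"
      using d[of "ex 1"] d[of "ex 2"] sm p p' by (simp_all add: unf pz pull_zero_iff pull_neg_zero_iff)
    have "D1 (A 0 3) = (\<lambda>z. 0)" "D2 (A 0 3) = (\<lambda>z. 0)"
      using d[of "ex 3"] d[of "ex 4"] sm p p' p'' by (simp_all add: unf pz pull_zero_iff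
          pull_neg_zero_iff)
    with p p' p'' have "\<forall>(b, i)\<in>pieces [3]. \<forall>y. A b i y = A b i 0"
      using plane_const_iff[OF sm] by (simp add: pieces_N)
    \<comment> \<open>There is only one branch, so the constant of its top piece has nothing to
      cancel against.\<close>
    moreover have "A 0 3 0 = 0"
      using fun_cong[OF 0, of 0] by (simp add: \<Phi>_N_def N0_def N1_def N2_def pull_zero_arg ham_zero_arg)
    then have "(\<Sum>b<length [3 :: nat]. A b ([3] ! b) 0) = 0" by simp
    ultimately show "A \<in> constant_relations [3]" unfolding constant_relations_iff[OF A] by blast
  next
    assume "A \<in> constant_relations [3]"
    then have *: "\<forall>y. A 0 0 y = A 0 0 0" "\<forall>y. A 0 1 y = A 0 1 0" "\<forall>y. A 0 2 y = A 0 2 0" "\<forall>y. A 0 3 y = A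
        0 3 0"
      "A 0 3 0 = 0"
      unfolding constant_relations_iff[OF A] by (simp_all add: pieces_N)
    then have "D1 (A 0 0) = (\<lambda>z. 0)" "D2 (A 0 0) = (\<lambda>z. 0)" "D1 (A 0 1) = (\<lambda>z. 0)" "D2 (A 0 1) = (\<lambda>z. 0)"
      "D1 (A 0 2) = (\<lambda>z. 0)" "D2 (A 0 2) = (\<lambda>z. 0)"
      using plane_const_iff[OF sm] by simp_all
    then show "\<Phi>_N A = (\<lambda>z. 0)"
      unfolding \<Phi>_N_def N0_def N1_def N2_def ham_def pull_def using *(4,5) by simp
  qed
  show "\<exists>B\<in>graded_sum [3]. jacobi_bracket (E_N a) (\<Phi>_N A) = \<Phi>_N B"
    unfolding a by (rule E_N_\<Phi>_N[OF A])
  show "E_N a = \<Phi>_N A \<Longrightarrow> a = 0"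
  proof -
    assume eq: "E_N a = \<Phi>_N A"
    \<comment> \<open>At the origin r equals both a mixed derivative of \<open>A 0 1\<close> and its
      negative, and m likewise for \<open>A 0 0\<close>; so both are 0, and then \<open>DU\<close>
      gives n = 0.\<close>
    have e: "DU (E_N a) = (\<lambda>z. n - m * 3)" "DU (\<Phi>_N A) = (\<lambda>z. 0)"
      "DX 3 (DP 2 (E_N a)) 0 = r" "DX 3 (DP 2 (\<Phi>_N A)) 0 = D1 (D2 (A 0 1)) 0"
      "DX 4 (DP 1 (E_N a)) 0 = r" "DX 4 (DP 1 (\<Phi>_N A)) 0 = - D1 (D2 (A 0 1)) 0"
      "DX 1 (DP 1 (E_N a)) 0 = m" "DX 1 (DP 1 (\<Phi>_N A)) 0 = - D1 (D2 (A 0 0)) 0"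
      "DX 2 (DP 2 (E_N a)) 0 = m" "DX 2 (DP 2 (\<Phi>_N A)) 0 = D1 (D2 (A 0 0)) 0"
      using sm by (simp_all add: a E_N_def \<Phi>_N_def N0_def N1_def N2_def ham_def D2_D1 pull_zero_arg)
    have "m = 0" "r = 0" using e(3-10) unfolding eq by linarith+
    moreover have "n - m * 3 = 0" using fun_cong[OF e(1), of 0] e(2) unfolding eq by simp
    ultimately show "a = 0" by (simp add: a zero_prod_def)
  qed
  assume B: "B \<in> graded_sum [3]"
  show "\<Phi>_N (A + B) = \<Phi>_N A + \<Phi>_N B"
    using sm graded_sum_smooth[OF B]
    by (simp add: \<Phi>_N_def N0_def N1_def N2_def ham_def fun_eq_iff pull_def algebra_simps
        add_divide_distrib diff_divide_distrib)
  show "jacobi_bracket (\<Phi>_N A) (\<Phi>_N B) = \<Phi>_N (graded_bracket [3] A B)"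
    by (rule \<Phi>_N_bracket[OF A B])
qed

theorem theorem1:
  fixes \<alpha> \<beta> :: real
  assumes "\<alpha> \<noteq> 0" "\<beta> \<noteq> 0" "\<alpha> + \<beta> \<noteq> 0"
  shows
    "(let g = cont eq_N;
          s = derived_algebra jacobi_bracket (derived_algebra jacobi_bracket g)
      in is_graded_sum [3] s \<and>
         (\<exists>w. linear w \<and> (\<exists>a. w a \<noteq> 0) \<and> lie_extension jacobi_bracket s g (semidirect_bracket w)))
   \<and> (let g = cont eq_D;
          s = derived_algebra jacobi_bracket g
      in is_graded_sum [1, 1] s \<and>
         lie_extension jacobi_bracket s g (abelian_bracket :: real ^ 2 \<Rightarrow> _))
   \<and> (let g = cont eq_III;
          s = derived_algebra jacobi_bracket (derived_algebra jacobi_bracket g)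
      in is_graded_sum [2, 0] s \<and>
         lie_extension jacobi_bracket s g (abelian_bracket :: real ^ 2 \<Rightarrow> _))
   \<and> (let g = cont eq_II;
          s = derived_algebra jacobi_bracket g
      in is_graded_sum [1, 0, 0] s \<and>
         lie_extension jacobi_bracket s g (abelian_bracket :: real ^ 1 \<Rightarrow> _))
   \<and> (let g = cont (eq_I \<alpha> \<beta>);
          s = derived_algebra jacobi_bracket g
      in is_graded_sum [0, 0, 0, 0] s \<and>
         lie_extension jacobi_bracket s g (abelian_bracket :: real ^ 1 \<Rightarrow> _))"
proof -
  interpret N: symmetry_structure "[3]" \<Phi>_N E_N "semidirect_bracket (\<lambda>a. snd a - fst a)" "cont eq_N"
    by (rule structure_N)
  interpret D: symmetry_structure "[1, 1]" \<Phi>_D E_D abelian_bracket "cont eq_D" by (rule structure_D)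
  interpret III: symmetry_structure "[2, 0]" \<Phi>_III E_III abelian_bracket "cont eq_III" by (rule
      structure_III)
  interpret II: symmetry_structure "[1, 0, 0]" \<Phi>_II E_II abelian_bracket "cont eq_II" by (rule
      structure_II)
  interpret I: symmetry_structure "[0, 0, 0, 0]" \<Phi>_I E_I abelian_bracket "cont (eq_I \<alpha> \<beta>)"
    by (rule structure_I[OF assms])
  let ?w = "\<lambda>a :: real \<times> real. snd a - fst a"
  \<comment> \<open>The abelian ideal \<real> of the semidirect product, in which all its brackets
    lie.\<close>
  let ?T = "{a :: (real \<times> real) \<times> real. fst a = 0}"
  have sN: "derived_algebra jacobi_bracket (derived_algebra jacobi_bracket (cont eq_N)) = N.S"
  proof (rule N.second_derived[of ?T])
    show "subspace ?T" by (auto simp: subspace_def)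
    show "semidirect_bracket ?w a b \<in> ?T" for a b by (auto simp: semidirect_bracket_def split:
        prod.splits)
    show "semidirect_bracket ?w a b = 0" if "a \<in> ?T" "b \<in> ?T" for a b
      using that by (cases a; cases b) (simp add: semidirect_bracket_def zero_prod_def)
  qed
  have "linear ?w" by (auto intro!: linearI simp: algebra_simps)
  moreover have "\<exists>a. ?w a \<noteq> 0" by (rule exI[of _ "(0, 1)"]) simp
  ultimately have N: "\<exists>w. linear w \<and> (\<exists>a. w a \<noteq> 0) \<and> lie_extension jacobi_bracket N.S (cont eq_N)
      (semidirect_bracket w)"
    using N.extension by blast
  have sD: "derived_algebra jacobi_bracket (cont eq_D) = D.S"
    by (rule D.derived_abelian[OF _ D.S_subset_G]) (simp_all add: abelian_bracket_def)
  have sII: "derived_algebra jacobi_bracket (cont eq_II) = II.S"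
    by (rule II.derived_abelian[OF _ II.S_subset_G]) (simp_all add: abelian_bracket_def)
  have sI: "derived_algebra jacobi_bracket (cont (eq_I \<alpha> \<beta>)) = I.S"
    by (rule I.derived_abelian[OF _ I.S_subset_G]) (simp_all add: abelian_bracket_def)
  have "derived_algebra jacobi_bracket (cont eq_III) = III.S"
    by (rule III.derived_abelian[OF _ III.S_subset_G]) (simp_all add: abelian_bracket_def)
  \<comment> \<open>The first derived algebra is already \<open>III.S\<close>, and this algebra is
    perfect.\<close>
  then have sIII: "derived_algebra jacobi_bracket (derived_algebra jacobi_bracket (cont eq_III)) = III.S"
    using III.derived_abelian[OF _ subset_refl III.S_subset_G] by (simp add: abelian_bracket_def)
  show ?thesis
    unfolding Let_def sN sD sII sI sIII
    using N N.is_graded_sum_S D.is_graded_sum_S D.extension II.is_graded_sum_S II.extension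
      I.is_graded_sum_S I.extension III.is_graded_sum_S III.extension by blast
qed

end
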